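(* There is a finite set $S\subset\mathbb{R}$ such that, with $F=\operatorname{int}(F_0)\setminus S$, for every closed interval $E\subset F$ and every sufficiently small $p>0$, there exist $\epsilon>0$ and $k(E)>0$ such that for all $0<|k|<k(E)$, $$\sup_{\lambda\in R(E,\epsilon)}\mathbb{E}\big(\mathrm{w}^{1+p}(G^x(\lambda))\big)<\infty\qquad\text{for all }x\in\mathbb{T}_p.$$
   Context: Let $\mathbb{B}$ be an infinite rooted binary tree with root $o$ of degree $2$ and all other vertices of degree $3$ (each non-root vertex has one neighbour towards the root and two "forward" neighbours). At $o$ and at each vertex of $\mathbb{B}$, one of the two forward edges is designated the top edge and the other the bottom edge. Fix nonnegative integers $m\neq n$. The tree $\mathbb{T}$ is obtained by inserting $m$ new vertices on every top edge and $n$ new vertices on every bottom edge. The non-root vertices of $\mathbb{B}$ are the principal nodes $\mathbb{T}_p$; the inserted vertices are the auxiliary nodes $\mathbb{T}_a$; $\mathbb{T}=\{o\}\cup\mathbb{T}_p\cup\mathbb{T}_a$. On $\ell^2(\mathbb{T})$, $(\Delta\varphi)(x)=\sum_{y:\,d(x,y)=1}(\varphi(x)-\varphi(y))$ and $H=\Delta+kq$, where $\{q(x)\}_{x\in\mathbb{T}}$ are i.i.d. real random variables with distribution $\nu$, $\int|q|^{2(1+p_0)}d\nu<\infty$ for some $p_0>0$ (and $p\le p_0$ is implicit), $k\in\mathbb{R}$. For $x\in\mathbb{T}$, $\mathbb{T}^x$ is the subtree of vertices whose path to $o$ passes through $x$ (rooted at $x$), $H^x$ is the restriction of $H$ to $\ell^2(\mathbb{T}^x)$,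 and $G^x(\lambda)=\langle\delta_x,(H^x-\lambda)^{-1}\delta_x\rangle$ is the forward Green function. Let $\mathbb{H}=\{z:\operatorname{Im}z>0\}$, $M=m+n+1$, $\phi_0(z,\lambda)=z$, $\phi_j(z,q_1,\dots,q_j,\lambda)=\dfrac{-1}{\phi_{j-1}(z,q_1,\dots,q_{j-1},\lambda)+\lambda-q_j+1}$, $\phi(z_1,z_2,q_1,\dots,q_M,\lambda)=\dfrac{-1}{\phi_n(z_1,q_1,\dots,q_n,\lambda)+\phi_m(z_2,q_{n+1},\dots,q_{n+m},\lambda)+\lambda-q_M}$; for $x\in\mathbb{T}_p$ one has $G^x(\lambda)=\phi(G^{x_1}(\lambda),G^{x_2}(\lambda),kq_1,\dots,kq_M,\lambda)$ with $x_1,x_2$ the next principal nodes forward of $x$ and $q_i$ the potentials at the intermediate vertices and at $x$. For $\operatorname{Im}\lambda>0$, $z_\lambda\in\mathbb{H}$ is the unique fixed point in $\mathbb{H}$ of $z\mapsto\phi(z,z,0,\dots,0,\lambda)$; it extends continuously to real $\lambda$, and $F_0=\{\lambda\in\mathbb{R}:z_\lambda\in\mathbb{H}\}$. $R(E,\epsilon)=\{\lambda:\operatorname{Re}\lambda\in E,\ 0<\operatorname{Im}\lambda\le\epsilon\}$. The weight is $\mathrm{w}(z)=\dfrac{|z-z_\lambda|^2}{\operatorname{Im}(z)\operatorname{Im}(z_\lambda)}=2(\cosh(\operatorname{dist}_{\mathbb{H}}(z,z_\lambda))-1)$ (depending on $\lambda$).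
   Formalization: H is taken to be Δ − 3 + kq instead of Δ + kq, because the stated recursion for G^x, and hence z_λ, F_0 and the weight, holds only after this energy shift by 3. *)

theory Defs
  imports "HOL-Probability.Probability"
begin

text \<open>Vertices are pairs (u,i): u is a vertex of the binary tree B (a list of booleans,
  True = top edge, False = bottom edge, [] = root o); (u,0) is the vertex u itself and,
  for u nonempty, (u,i) with 1 <= i <= (number of inserted vertices on the edge into u)
  is the i-th auxiliary vertex on the edge from the parent of u to u, counted from u.\<close>

type_synonym vtx = "bool list \<times> nat"

definition elen :: "nat \<Rightarrow> nat \<Rightarrow> bool \<Rightarrow> nat" where
  "elen m n b = (if b then m else n)"

definition Tset :: "nat \<Rightarrow> nat \<Rightarrow> vtx set" where
  "Tset m n = {(u,i). i = 0 \<or> (u \<noteq> [] \<and> 1 \<le> i \<and> i \<le> elen m n (last u))}"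

definition troot :: vtx where
  "troot = ([], 0)"

definition tpar :: "nat \<Rightarrow> nat \<Rightarrow> vtx \<Rightarrow> vtx" where
  "tpar m n v = (case v of (u,i) \<Rightarrow>
     if u = [] then ([],0)
     else if i < elen m n (last u) then (u, i+1) else (butlast u, 0))"

definition tadj :: "nat \<Rightarrow> nat \<Rightarrow> vtx \<Rightarrow> vtx \<Rightarrow> bool" where
  "tadj m n x y \<longleftrightarrow> x \<in> Tset m n \<and> y \<in> Tset m n \<and> x \<noteq> y \<and>
     (tpar m n x = y \<or> tpar m n y = x)"

definition Tprin :: "nat \<Rightarrow> nat \<Rightarrow> vtx set" where
  "Tprin m n = {(u,0) | u. u \<noteq> []}"

definition Tsub :: "nat \<Rightarrow> nat \<Rightarrow> vtx \<Rightarrow> vtx set" where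
  "Tsub m n x = {y \<in> Tset m n. \<exists>j. (tpar m n ^^ j) y = x}"

definition Hop :: "nat \<Rightarrow> nat \<Rightarrow> real \<Rightarrow> (vtx \<Rightarrow> real) \<Rightarrow> (vtx \<Rightarrow> complex) \<Rightarrow> vtx \<Rightarrow> complex" where
  "Hop m n k q psi y =
     (\<Sum>y'\<in>{y'. tadj m n y y'}. (psi y - psi y')) - 3 * psi y + of_real (k * q y) * psi y"

text \<open>G^x(lambda) = <delta_x, (H^x - lambda)^{-1} delta_x>: the value at x of the
  unique l^2(T^x) solution psi of (H^x - lambda) psi = delta_x.\<close>
definition greenF :: "nat \<Rightarrow> nat \<Rightarrow> real \<Rightarrow> (vtx \<Rightarrow> real) \<Rightarrow> vtx \<Rightarrow> complex \<Rightarrow> complex" where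
  "greenF m n k q x lam = (THE g. \<exists>psi.
      (\<forall>y. y \<notin> Tsub m n x \<longrightarrow> psi y = 0) \<and>
      (\<lambda>y. (cmod (psi y))\<^sup>2) summable_on Tsub m n x \<and>
      (\<forall>y\<in>Tsub m n x. Hop m n k q psi y - lam * psi y = (if y = x then 1 else 0)) \<and>
      g = psi x)"

fun phi0 :: "nat \<Rightarrow> complex \<Rightarrow> complex \<Rightarrow> complex" where
  "phi0 0 z lam = z"
| "phi0 (Suc j) z lam = -1 / (phi0 j z lam + lam + 1)"

definition phiz :: "nat \<Rightarrow> nat \<Rightarrow> complex \<Rightarrow> complex \<Rightarrow> complex" where
  "phiz m n z lam = -1 / (phi0 n z lam + phi0 m z lam + lam)"

definition zfix :: "nat \<Rightarrow> nat \<Rightarrow> complex \<Rightarrow> complex" where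
  "zfix m n lam = (THE z. 0 < Im z \<and> phiz m n z lam = z)"

definition zlam :: "nat \<Rightarrow> nat \<Rightarrow> complex \<Rightarrow> complex" where
  "zlam m n lam = (if 0 < Im lam then zfix m n lam
                   else Lim (at lam within {mu. 0 < Im mu}) (zfix m n))"

definition F0 :: "nat \<Rightarrow> nat \<Rightarrow> real set" where
  "F0 m n = {t. 0 < Im (zlam m n (of_real t))}"

definition wgt :: "nat \<Rightarrow> nat \<Rightarrow> complex \<Rightarrow> complex \<Rightarrow> real" where
  "wgt m n lam z = (cmod (z - zlam m n lam))\<^sup>2 / (Im z * Im (zlam m n lam))"

definition Rset :: "real set \<Rightarrow> real \<Rightarrow> complex set" where
  "Rset E eps = {lam. Re lam \<in> E \<and> 0 < Im lam \<and> Im lam \<le> eps}"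

end

theory Submission
  imports Defs "HOL-Complex_Analysis.Great_Picard"
begin

text \<open>Write \<open>sw \<zeta> z = |z - cnj \<zeta>|\<^sup>2 / (Im z * Im \<zeta>)\<close>, the weight centred at \<open>\<zeta>\<close> plus 4, and let \<open>cay \<zeta>\<close> map the
  upper half plane to the disc, so that \<open>sw \<zeta> z * (1 - |cay \<zeta> z|\<^sup>2) = 4\<close>. A chain of auxiliary vertices acts
  on \<open>cay\<close> almost like a rotation, up to an error of order \<open>|q| + Im lam\<close>. Joining two branches is a weighted
  average of \<open>sw\<close> minus an explicit nonnegative defect. If neither
  the defect for \<open>(z1, z2)\<close> nor the one for \<open>(z2, z1)\<close> contributes near the boundary, then the rotations of
  the two branches must have equal squares. At real energies this is a polynomial condition on the energy
  that for \<open>m \<noteq> n\<close> only has finitely many solutions. Elsewhere the sum over the two orders contracts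
  \<open>sw\<^sup>1\<^sup>+\<^sup>p\<close>, uniformly for small potentials, while large potentials cost a factor with a small
  expectation as \<open>k \<rightarrow> 0\<close>. Since the two branches are independent and identically distributed, this
  bounds the moments of the truncated Green functions uniformly in the truncation, and Fatou's lemma
  passes to the limit.\<close>

section \<open>The weight in the disc model\<close>

text \<open>With the 4 added, the weight is \<open>4 cosh^2(d/2)\<close> for the hyperbolic distance
  d. It is then bounded below, and a real shift of z costs only a factor independent of z; this
  fails for the weight itself, which vanishes at its centre. The potentials of a block thus cost a
  product of squares, whose power 1+p is integrable because moments of order 2(1+p0) exist.

  The obstacle is that at real energy and zero potential the chain steps are isometries, so the
  defect is the only source of gain. A single order of the branches does not suffice: equal weights
  and disc coordinates with \<mu> c1 = \<nu> c2, where \<mu> and \<nu> are the rotations, make the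
  defect vanish. In the reversed order this also needs \<mu> c2 = \<nu> c1, and for c1 nonzero the
  two conditions together force equal squares of \<mu> and \<nu>. Hence the squares, and hence the
  failure of the method for m = n, where both rotations coincide.

  No constant may degenerate as lam approaches the real axis. All requirements on lam are therefore
  collected in one lower bound c, supplied by compactness of the energy interval, and every later
  constant depends on lam only through c.\<close>

definition sw :: "complex \<Rightarrow> complex \<Rightarrow> real" where
  "sw a z = (cmod (z - cnj a))\<^sup>2 / (Im z * Im a)"

definition cay :: "complex \<Rightarrow> complex \<Rightarrow> complex" where
  "cay a z = (z - a) / (z - cnj a)"

lemma sw_eq_dist:
  assumes "0 < Im a" "0 < Im z"
  shows "sw a z = 4 + (cmod (z - a))\<^sup>2 / (Im z * Im a)"
  using assms unfolding sw_def cmod_power2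
  by (simp add: field_simps power2_eq_square)

lemma sw_ge_4: "0 < Im a \<Longrightarrow> 0 < Im z \<Longrightarrow> 4 \<le> sw a z"
  by (simp add: sw_eq_dist)

lemma norm_diff_cnj_ge:
  assumes "0 < Im a" "0 \<le> Im z"
  shows "Im a \<le> cmod (z - cnj a)"
  using abs_Im_le_cmod[of "z - cnj a"] assms by simp

lemma cmod_cay:
  assumes "0 < Im a" "0 < Im z"
  shows "sw a z * (1 - (cmod (cay a z))\<^sup>2) = 4"
proof -
  have nz: "cmod (z - cnj a) > 0" using norm_diff_cnj_ge[of a z] assms by linarith
  have "(cmod (z - cnj a))\<^sup>2 - (cmod (z - a))\<^sup>2 = 4 * Im z * Im a"
    unfolding cmod_power2 by (simp add: power2_eq_square algebra_simps)
  then have "(cmod (z - a))\<^sup>2 = (cmod (z - cnj a))\<^sup>2 - 4 * Im z * Im a" by simp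
  then have "1 - (cmod (cay a z))\<^sup>2 = 4 * Im z * Im a / (cmod (z - cnj a))\<^sup>2"
    using nz unfolding cay_def norm_divide power_divide by (simp add: field_simps)
  then show ?thesis using nz assms by (simp add: sw_def)
qed

lemma cmod_cay_le_1:
  assumes "0 < Im a" "0 < Im z"
  shows "cmod (cay a z) \<le> 1"
proof -
  have "1 - (cmod (cay a z))\<^sup>2 \<ge> 0"
    using cmod_cay[OF assms] sw_ge_4[OF assms] by (smt (verit) mult_pos_neg)
  then show ?thesis by (simp add: power2_nonneg_ge_1_iff abs_square_le_1 flip: abs_le_square_iff)
qed

lemma sw_inversion:
  assumes "0 < Im a" "0 < Im z"
  shows "sw (-1/a) (-1/z) = sw a z"
proof -
  have nz: "a \<noteq> 0" "z \<noteq> 0" using assms by auto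
  have "(-1/z) - cnj (-1/a) = (z - cnj a) / (z * cnj a)"
    using nz by (simp add: field_simps)
  moreover have "Im (-1/w) = Im w / (cmod w)\<^sup>2" for w
    by (simp add: Im_divide cmod_power2)
  ultimately show ?thesis
    using nz assms unfolding sw_def
    by (simp add: norm_divide norm_mult power_divide power_mult_distrib field_simps)
qed

text \<open>In the disc centred at a the isometry z -> -1/z is a rotation whose angle depends on a
  alone. These factors accumulate in \<open>turn\<close>.\<close>

lemma cay_inversion:
  assumes "0 < Im a" "0 < Im z"
  shows "cay (-1/a) (-1/z) = (cnj a / a) * cay a z"
proof -
  have nz: "a \<noteq> 0" "z \<noteq> 0" using assms by auto
  have nz2: "z - cnj a \<noteq> 0" using norm_diff_cnj_ge[of a z] assms by force
  have e: "(-1/z) - cnj (-1/a) = (z - cnj a) / (z * cnj a)" "(-1/z) - (-1/a) = (z - a) / (z * a)"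
    using nz by (simp_all add: field_simps)
  show ?thesis unfolding cay_def e using nz nz2 by (simp add: field_simps)
qed

text \<open>Adding s keeps z - a and increases both imaginary parts, so it only brings the points
  closer. The shift by q changes \<open>z - cnj a\<close> by at most a fraction
  \<open>\<bar>q\<bar> / Im a\<close> of its modulus, which is at least \<open>Im a\<close>; this is
  where a purely multiplicative bound comes from.\<close>

lemma sw_translate:
  assumes a: "0 < Im a" and z: "0 < Im z" and s: "0 \<le> Im s"
  shows "sw (a + s) (z + s - of_real q) \<le> (1 + \<bar>q\<bar> / Im a)\<^sup>2 * sw a z"
proof -
  define z' where "z' = z - of_real q"
  have z': "0 < Im z'" using z by (simp add: z'_def)
  have le: "Im z' * Im a \<le> (Im z' + Im s) * (Im a + Im s)"
    using a z' s by (intro mult_mono) auto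
  have "sw (a + s) (z' + s) = 4 + (cmod (z' - a))\<^sup>2 / ((Im z' + Im s) * (Im a + Im s))"
    using a z' s by (subst sw_eq_dist) auto
  also have "\<dots> \<le> 4 + (cmod (z' - a))\<^sup>2 / (Im z' * Im a)"
    using le a z' by (intro add_left_mono divide_left_mono) (auto intro!: mult_pos_pos add_pos_nonneg s)
  also have "\<dots> = sw a z'" using a z' by (simp add: sw_eq_dist)
  also have "\<dots> \<le> (1 + \<bar>q\<bar> / Im a)\<^sup>2 * sw a z"
  proof -
    have "cmod (z' - cnj a) \<le> cmod (z - cnj a) + \<bar>q\<bar>"
      using norm_triangle_ineq4[of "z - cnj a" "of_real q"] by (simp add: z'_def algebra_simps)
    also have "\<bar>q\<bar> \<le> \<bar>q\<bar> / Im a * cmod (z - cnj a)"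
      using norm_diff_cnj_ge[of a z] a z 
      by (simp add: field_simps) (metis abs_ge_zero mult.commute mult_left_mono)
    finally have "cmod (z' - cnj a) \<le> (1 + \<bar>q\<bar> / Im a) * cmod (z - cnj a)"
      by (simp add: algebra_simps)
    then have "(cmod (z' - cnj a))\<^sup>2 \<le> ((1 + \<bar>q\<bar> / Im a) * cmod (z - cnj a))\<^sup>2"
      by (intro power_mono) auto
    then show ?thesis using a z unfolding sw_def
      by (simp add: z'_def power_mult_distrib divide_right_mono)
  qed
  finally show ?thesis by (simp add: z'_def algebra_simps)
qed

text \<open>The bound has to be uniform as z approaches the boundary or infinity. The numerator of
  the difference of the quotients is linear in q and \<open>Im s\<close>, and
  \<open>cmod (z - a) \<le> cmod (z - cnj a)\<close> cancels one of the two denominators.\<close>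

lemma cay_translate:
  assumes a: "0 < Im a" and z: "0 < Im z" and s: "0 \<le> Im s"
  shows "cmod (cay (a + s) (z + s - of_real q) - cay a z) \<le> 2 * (\<bar>q\<bar> + Im s) / Im a"
proof -
  define D where "D = z - cnj a"
  define D' where "D' = z + s - of_real q - cnj (a + s)"
  have D: "Im a \<le> cmod D" unfolding D_def using norm_diff_cnj_ge a z by simp
  have D': "Im a \<le> cmod D'" 
    using abs_Im_le_cmod[of D'] a z s by (simp add: D'_def)
  have nz: "D \<noteq> 0" "D' \<noteq> 0" using D D' a by auto
  have ss: "s - cnj s = 2 * \<i> * of_real (Im s)" "a - cnj a = 2 * \<i> * of_real (Im a)"
    by (simp_all add: complex_eq_iff)
  have aa: "cnj a = a - 2 * \<i> * of_real (Im a)" "cnj s = s - 2 * \<i> * of_real (Im s)"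
    by (simp_all add: complex_eq_iff)
  have "cay (a + s) (z + s - of_real q) - cay a z = (z - of_real q - a) / D' - (z - a) / D"
    by (simp add: cay_def D_def D'_def)
  also have "\<dots> = ((z - of_real q - a) * D - (z - a) * D') / (D * D')"
    using nz by (simp add: field_simps)
  also have "(z - of_real q - a) * D - (z - a) * D' =
      - (2 * \<i> * of_real q * of_real (Im a)) - 2 * \<i> * of_real (Im s) * (z - a)"
    unfolding D_def D'_def complex_cnj_add aa by (simp add: algebra_simps)
  finally have e: "cay (a + s) (z + s - of_real q) - cay a z =
    (- (2 * \<i> * of_real q * of_real (Im a)) - 2 * \<i> * of_real (Im s) * (z - a)) / (D * D')" .
  have "cmod (z - a) \<le> cmod D"
    using cmod_cay_le_1[OF a z] nz by (simp add: cay_def norm_divide D_def field_simps)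
  then have "cmod (- (2 * \<i> * of_real q * of_real (Im a)) - 2 * \<i> * of_real (Im s) * (z - a))
     \<le> 2 * \<bar>q\<bar> * cmod D + 2 * Im s * cmod D"
    using norm_triangle_ineq4[of "- (2 * \<i> * of_real q * of_real (Im a))" "2 * \<i> * of_real (Im s) * (z - a)"]
      s a D
    by (simp add: norm_mult) (smt (verit) mult_left_mono)
  also have "\<dots> = 2 * (\<bar>q\<bar> + Im s) * cmod D" by (simp add: algebra_simps)
  finally have "cmod (cay (a + s) (z + s - of_real q) - cay a z) \<le> 2 * (\<bar>q\<bar> + Im s) * cmod D / (cmod D * cmod D')"
    unfolding e norm_divide norm_mult[of D D'] by (intro divide_right_mono) auto
  also have "\<dots> = 2 * (\<bar>q\<bar> + Im s) / cmod D'" using nz by simp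
  also have "\<dots> \<le> 2 * (\<bar>q\<bar> + Im s) / Im a"
    using D' a s nz by (intro divide_left_mono) auto
  finally show ?thesis .
qed

text \<open>The weight is the perspective function |u|^2/s, with u = \<open>a - cnj A\<close> and s
  = \<open>Im a\<close>, and this function is jointly convex. The convexity gap is exactly st/(s+t)
  times |u/s - v/t|^2, and \<open>key\<close> identifies u/s, up to conjugation and a factor of
  modulus 2, with \<open>sw A a * (1 - cay A a)\<close>. The bound m enters only to keep
  \<open>Im a\<close> and \<open>Im b\<close> away from 0.\<close>

lemma sw_add:
  assumes A: "0 < Im A" and B: "0 < Im B" and a: "0 < Im a" and b: "0 < Im b"
    and m: "sw A a \<le> m" "sw B b \<le> m"
    and r: "\<rho> = Im A / (Im A + Im B)" and s: "\<sigma> = Im B / (Im A + Im B)"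
  shows "sw (A + B) (a + b) \<le> \<rho> * sw A a + \<sigma> * sw B b
     - \<rho> * \<sigma> / (4 * m) * (cmod (sw A a * (1 - cay A a) - sw B b * (1 - cay B b)))\<^sup>2"
proof -
  have key: "sw w z * (1 - cay w z) = 2 * \<i> * cnj (z - cnj w) / of_real (Im z)"
    and im: "Im w / sw w z \<le> Im z"
    if w: "0 < Im w" and z: "0 < Im z" for w z
  proof -
    have nz: "z - cnj w \<noteq> 0" using norm_diff_cnj_ge[of w z] w z by force
    have nz': "cnj z - w \<noteq> 0" using nz by (metis complex_cnj_cnj complex_cnj_diff complex_cnj_zero)
    have d: "z - cnj w - (z - w) = 2 * \<i> * of_real (Im w)"
      by (simp add: complex_eq_iff)
    have "1 - cay w z = (z - cnj w - (z - w)) / (z - cnj w)"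
      unfolding cay_def using nz by (simp add: field_simps)
    then have e: "1 - cay w z = 2 * \<i> * of_real (Im w) / (z - cnj w)" by (simp only: d)
    have n: "of_real ((cmod (z - cnj w))\<^sup>2) = (z - cnj w) * cnj (z - cnj w)"
      by (rule complex_norm_square)
    have sws: "of_real (sw w z) = (z - cnj w) * cnj (z - cnj w) / (of_real (Im z) * of_real (Im w))"
      unfolding sw_def by (simp only: of_real_divide of_real_mult n)
    have nn: "(of_real (Im w) :: complex) \<noteq> 0" "(of_real (Im z)::complex) \<noteq> 0" using w z by auto
    show "sw w z * (1 - cay w z) = 2 * \<i> * cnj (z - cnj w) / of_real (Im z)"
      unfolding sws e using nz nn by (simp add: divide_simps)
    have "(Im w)\<^sup>2 \<le> (cmod (z - cnj w))\<^sup>2"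
      using norm_diff_cnj_ge[of w z] w z by (intro power_mono) auto
    then have "Im w \<le> Im z * sw w z"
      unfolding sw_def using w z by (simp add: field_simps power2_eq_square)
    then show "Im w / sw w z \<le> Im z"
      using sw_ge_4[OF w z] by (simp add: field_simps)
  qed
  define u where "u = a - cnj A"
  define v where "v = b - cnj B"
  define N where "N = (cmod (u / of_real (Im a) - v / of_real (Im b)))\<^sup>2"
  have mpos: "0 < m" using m sw_ge_4[OF A a] by linarith
  have "sw A a * (1 - cay A a) - sw B b * (1 - cay B b)
      = 2 * \<i> * cnj (u / of_real (Im a) - v / of_real (Im b))"
    unfolding key[OF A a] key[OF B b] u_def v_def by (simp add: algebra_simps)
  then have N: "(cmod (sw A a * (1 - cay A a) - sw B b * (1 - cay B b)))\<^sup>2 = 4 * N"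
    by (simp add: norm_mult power_mult_distrib N_def del: complex_cnj_diff complex_cnj_divide)
  have Nn: "0 \<le> N" by (simp add: N_def)
  have id: "\<rho> * sw A a + \<sigma> * sw B b - sw (A + B) (a + b)
      = Im a * Im b / ((Im a + Im b) * (Im A + Im B)) * N"
  proof -
    have *: "(x1\<^sup>2 + y1\<^sup>2) / s + (x2\<^sup>2 + y2\<^sup>2) / t - ((x1+x2)\<^sup>2 + (y1+y2)\<^sup>2) / (s+t)
       = s * t / (s + t) * ((x1/s - x2/t)\<^sup>2 + (y1/s - y2/t)\<^sup>2)"
      if "s > 0" "t > 0" for x1 x2 y1 y2 s t :: real
    proof -
      have "(x1\<^sup>2 + y1\<^sup>2) / s + (x2\<^sup>2 + y2\<^sup>2) / t - ((x1+x2)\<^sup>2 + (y1+y2)\<^sup>2) / (s+t)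
          = ((t * x1 - s * x2)\<^sup>2 + (t * y1 - s * y2)\<^sup>2) / (s * t * (s + t))"
        using that by (simp add: divide_simps add_nonneg_eq_0_iff) algebra
      also have "t * x1 - s * x2 = s * t * (x1/s - x2/t)" using that by (simp add: field_simps)
      also have "t * y1 - s * y2 = s * t * (y1/s - y2/t)"
        using that by (simp_all add: field_simps)
      also have "((s * t * (x1/s - x2/t))\<^sup>2 + (s * t * (y1/s - y2/t))\<^sup>2) / (s * t * (s + t))
          = (s * t)\<^sup>2 * ((x1/s - x2/t)\<^sup>2 + (y1/s - y2/t)\<^sup>2) / (s * t * (s + t))"
        by (simp only: power_mult_distrib distrib_left)
      also have "\<dots> = s * t / (s + t) * ((x1/s - x2/t)\<^sup>2 + (y1/s - y2/t)\<^sup>2)"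
        using that by (simp add: power2_eq_square)
      finally show ?thesis .
    qed
    have "\<rho> * sw A a + \<sigma> * sw B b - sw (A + B) (a + b) =
       ((cmod u)\<^sup>2 / Im a + (cmod v)\<^sup>2 / Im b - (cmod (u + v))\<^sup>2 / (Im a + Im b)) / (Im A + Im B)"
    proof -
      have "\<rho> * sw A a = (cmod u)\<^sup>2 / Im a / (Im A + Im B)" using A by (simp add: sw_def r u_def)
      moreover have "\<sigma> * sw B b = (cmod v)\<^sup>2 / Im b / (Im A + Im B)" using B by (simp add: sw_def s v_def)
      moreover have "sw (A + B) (a + b) = (cmod (u + v))\<^sup>2 / (Im a + Im b) / (Im A + Im B)"
        by (simp add: sw_def u_def v_def algebra_simps)
      ultimately show ?thesis by (simp only: diff_divide_distrib add_divide_distrib)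
    qed
    also have "(cmod u)\<^sup>2 / Im a + (cmod v)\<^sup>2 / Im b - (cmod (u + v))\<^sup>2 / (Im a + Im b)
        = Im a * Im b / (Im a + Im b) * N"
      unfolding N_def cmod_power2 using *[OF a b, of "Re u" "Im u" "Re v" "Im v"] by simp
    finally show ?thesis by simp
  qed
  have "Im A / m \<le> Im A / sw A a" "Im B / m \<le> Im B / sw B b"
    using m mpos A B sw_ge_4[OF A a] sw_ge_4[OF B b]
    by (auto intro!: divide_left_mono mult_pos_pos)
  then have i: "Im A / m \<le> Im a" "Im B / m \<le> Im b" using im[OF A a] im[OF B b] by linarith+
  \<comment> \<open>st/(s+t) is half the harmonic mean, hence increasing in both arguments, so the
    lower bounds \<open>Im A / m\<close> and \<open>Im B / m\<close> may be inserted.\<close>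
  have "\<rho> * \<sigma> / m \<le> Im a * Im b / ((Im a + Im b) * (Im A + Im B))"
  proof -
    have mono: "x * y / (x + y) \<le> x' * y' / (x' + y')"
      if "0 < x" "0 < y" "x \<le> x'" "y \<le> y'" for x y x' y' :: real
    proof -
      have "1 / x' + 1 / y' \<le> 1 / x + 1 / y" using that by (intro add_mono) (auto simp: field_simps)
      then have "inverse (1 / x + 1 / y) \<le> inverse (1 / x' + 1 / y')"
        using that by (intro le_imp_inverse_le) (auto intro: add_pos_pos)
      then show ?thesis using that by (simp add: field_simps)
    qed
    have "\<rho> * \<sigma> / m = (Im A / m) * (Im B / m) / (Im A / m + Im B / m) / (Im A + Im B)"
      using mpos A B unfolding r s
      by (simp add: divide_simps)
    also have "\<dots> \<le> Im a * Im b / (Im a + Im b) / (Im A + Im B)"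
      using i A B mpos by (intro divide_right_mono mono) auto
    finally show ?thesis by simp
  qed
  then have "\<rho> * \<sigma> / m * N \<le> \<rho> * sw A a + \<sigma> * sw B b - sw (A + B) (a + b)"
    unfolding id using Nn by (rule mult_right_mono)
  then show ?thesis unfolding N using mpos by simp
qed

section \<open>Mismatching rotations\<close>

text \<open>The two near-equalities force \<open>V1\<close> and \<open>V2\<close> to be nearly equal, hence \<open>\<mu> c1\<close> to be close to
  \<open>\<nu> c2\<close> and \<open>\<mu> c2\<close> close to \<open>\<nu> c1\<close>, which is impossible near the unit circle if \<open>\<mu>\<^sup>2 \<noteq> \<nu>\<^sup>2\<close>.\<close>
lemma rotation_mismatch_ordered:
  fixes \<mu> \<nu> c1 c2 :: complex and V1 V2 :: real
  assumes unit: "cmod \<mu> = 1" "cmod \<nu> = 1" and d: "0 < d" "d \<le> cmod (\<mu>\<^sup>2 - \<nu>\<^sup>2)"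
    and V: "0 < V2" "V2 \<le> V1" and c: "cmod c2 \<le> 1" "V1 * (1 - (cmod c1)\<^sup>2) = 4"
    and big: "4000 / d ^ 3 \<le> V1" and eps: "\<epsilon> \<le> d ^ 3 / 2000"
    and near: "cmod (V1 * (1 - \<mu> * c1) - V2 * (1 - \<nu> * c2)) \<le> \<epsilon> * V1"
      "cmod (V2 * (1 - \<mu> * c2) - V1 * (1 - \<nu> * c1)) \<le> \<epsilon> * V1"
  shows False
proof -
  define r where "r = V2 / V1"
  define \<kappa> where "\<kappa> = 4 / V1"
  have V1: "0 < V1" using V by simp
  have r: "0 \<le> r" "r \<le> 1" using V V1 by (simp_all add: r_def)
  have "cmod (\<mu>\<^sup>2 - \<nu>\<^sup>2) \<le> 2" 
    using norm_triangle_ineq4[of "\<mu>\<^sup>2" "\<nu>\<^sup>2"] unit by (simp add: norm_power)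
  then have d2: "d \<le> 2" using d by simp
  have d3: "0 < d ^ 3" "d ^ 3 \<le> 8" using d d2 power_mono[of d 2 3] by auto
  have \<kappa>: "0 < \<kappa>" "\<kappa> \<le> d ^ 3 / 1000"
    using V1 big d3 by (auto simp: \<kappa>_def field_simps)
  have \<epsilon>0: "0 \<le> \<epsilon>" using near(1) V1 norm_ge_zero order_trans zero_le_mult_iff by (metis not_less)
  have c1: "(cmod c1)\<^sup>2 = 1 - \<kappa>" using c(2) V1 by (simp add: \<kappa>_def field_simps)
  have scale: "cmod (of_real V1 * X) \<le> \<epsilon> * V1 \<Longrightarrow> cmod X \<le> \<epsilon>" for X
    using V1 by (simp add: norm_mult)
  have V2: "complex_of_real V2 = of_real V1 * of_real r" using V1 by (simp add: r_def)
  have uc: "(cmod (\<mu> * c1))\<^sup>2 = 1 - \<kappa>" "(cmod (\<nu> * c1))\<^sup>2 = 1 - \<kappa>" "cmod (\<mu> * c2) \<le> 1" "cmod (\<nu> * c2) \<le> 1"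
    using c1 c unit by (simp_all add: norm_mult)
  \<comment> \<open>After division by V1, e lies within \<epsilon> of the disc of radius r about 1 -
    r, which touches the unit circle from inside at 1. As e is almost on that circle, either r is
    near 1 or e is near 1; the first inequality is the quantitative form.\<close>
  have gap: "(1 - r) * (cmod (1 - e))\<^sup>2 \<le> \<kappa> + 2 * \<epsilon> + \<epsilon>\<^sup>2" "cmod (e - f) \<le> \<epsilon> + 2 * (1 - r)"
    if e: "(cmod e)\<^sup>2 = 1 - \<kappa>" and f: "cmod f \<le> 1" and E: "cmod (of_real V1 * (1 - e) - of_real V2 * (1 - f)) \<le> \<epsilon> * V1" for e f
  proof -
    define P where "P = (1 - e) - of_real r * (1 - f)"
    have P: "cmod P \<le> \<epsilon>" using E unfolding V2 by (intro scale) (simp add: P_def algebra_simps)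
    have "e - of_real (1 - r) = of_real r * f - P" by (simp add: P_def algebra_simps)
    moreover have "cmod (of_real r * f) \<le> r" using f r by (simp add: norm_mult mult_left_le)
    ultimately have "cmod (e - of_real (1 - r)) \<le> r + \<epsilon>"
      using norm_triangle_ineq4[of "of_real r * f" P] P by simp
    then have "(cmod (e - of_real (1 - r)))\<^sup>2 \<le> (r + \<epsilon>)\<^sup>2" by (intro power_mono) auto
    moreover have "(cmod (e - of_real (1 - r)))\<^sup>2 = (cmod e)\<^sup>2 - 2 * (1 - r) * Re e + (1 - r)\<^sup>2"
      unfolding cmod_power2 by (simp add: power2_eq_square algebra_simps)
    moreover have "(r + \<epsilon>)\<^sup>2 \<le> r\<^sup>2 + 2 * \<epsilon> + \<epsilon>\<^sup>2"
      using mult_right_mono[of r 1 \<epsilon>] r \<epsilon>0 by (simp add: power2_eq_square algebra_simps)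
    ultimately have A: "(1 - r) * (2 - 2 * Re e) \<le> \<kappa> + 2 * \<epsilon> + \<epsilon>\<^sup>2"
      using e by (simp add: power2_eq_square algebra_simps)
    have "(cmod (1 - e))\<^sup>2 = 1 - 2 * Re e + (cmod e)\<^sup>2"
      unfolding cmod_power2 by (simp add: power2_eq_square algebra_simps)
    then have "(1 - r) * (cmod (1 - e))\<^sup>2 \<le> (1 - r) * (2 - 2 * Re e)" using r e \<kappa> by (intro mult_left_mono) auto
    with A show "(1 - r) * (cmod (1 - e))\<^sup>2 \<le> \<kappa> + 2 * \<epsilon> + \<epsilon>\<^sup>2" by simp
    have "e - f = of_real (1 - r) * (1 - f) - P" by (simp add: P_def algebra_simps)
    then have "cmod (e - f) \<le> cmod (of_real (1 - r) * (1 - f)) + cmod P"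
      using norm_triangle_ineq4 by metis
    also have "cmod (of_real (1 - r) * (1 - f)) = (1 - r) * cmod (1 - f)"
      using r by (simp only: norm_mult norm_of_real)
    also have "(1 - r) * cmod (1 - f) \<le> (1 - r) * 2"
      using norm_triangle_ineq4[of 1 f] f r by (intro mult_left_mono) auto
    finally show "cmod (e - f) \<le> \<epsilon> + 2 * (1 - r)" using P by simp
  qed
  have near2: "cmod (of_real V1 * (1 - \<nu> * c1) - of_real V2 * (1 - \<mu> * c2)) \<le> \<epsilon> * V1"
    using near(2) by (simp add: norm_minus_commute)
  \<comment> \<open>If 1 - r were not small, both \<open>\<mu> * c1\<close> and
    \<open>\<nu> * c1\<close> would be near 1. Their distance is
    \<open>cmod (\<mu> - \<nu>) * cmod c1\<close>, bounded below through d, so r must be near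
    1.\<close>
  note m1 = gap(1)[OF uc(1,4) near(1)] and m2 = gap(1)[OF uc(2,3) near2]
  have sq: "(x + y)\<^sup>2 \<le> 2 * x\<^sup>2 + 2 * y\<^sup>2" for x y :: real
    using zero_le_power2[of "x - y"] by (simp add: power2_eq_square algebra_simps)
  have "(cmod (\<mu> * c1 - \<nu> * c1))\<^sup>2 \<le> (cmod (1 - \<mu> * c1) + cmod (1 - \<nu> * c1))\<^sup>2"
    using norm_triangle_ineq4[of "1 - \<nu> * c1" "1 - \<mu> * c1"] by (intro power_mono) auto
  also have "\<dots> \<le> 2 * (cmod (1 - \<mu> * c1))\<^sup>2 + 2 * (cmod (1 - \<nu> * c1))\<^sup>2" by (rule sq)
  finally have "(1 - r) * (cmod (\<mu> * c1 - \<nu> * c1))\<^sup>2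
      \<le> (1 - r) * (2 * (cmod (1 - \<mu> * c1))\<^sup>2 + 2 * (cmod (1 - \<nu> * c1))\<^sup>2)"
    using r by (intro mult_left_mono) auto
  with m1 m2 have m3: "(1 - r) * (cmod (\<mu> * c1 - \<nu> * c1))\<^sup>2 \<le> 4 * (\<kappa> + 2 * \<epsilon> + \<epsilon>\<^sup>2)"
    by (simp add: algebra_simps)
  have "d \<le> 2 * cmod (\<mu> - \<nu>)"
  proof -
    have "cmod (\<mu>\<^sup>2 - \<nu>\<^sup>2) = cmod (\<mu> + \<nu>) * cmod (\<mu> - \<nu>)"
      by (simp add: norm_mult[symmetric] power2_eq_square algebra_simps)
    also have "\<dots> \<le> 2 * cmod (\<mu> - \<nu>)"
      using norm_triangle_ineq[of \<mu> \<nu>] unit by (intro mult_right_mono) auto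
    finally show ?thesis using d by simp
  qed
  then have "d\<^sup>2 \<le> (2 * cmod (\<mu> - \<nu>))\<^sup>2" using d by (intro power_mono) auto
  then have "d\<^sup>2 * (1 - \<kappa>) \<le> (2 * cmod (\<mu> - \<nu>))\<^sup>2 * (1 - \<kappa>)"
    using \<kappa> d3 by (intro mult_right_mono) auto
  also have "\<dots> = 4 * (cmod (\<mu> * c1 - \<nu> * c1))\<^sup>2"
    by (simp add: c1[symmetric] power_mult_distrib norm_mult[symmetric] left_diff_distrib[symmetric] 
        flip: power_mult_distrib norm_mult)
  finally have d4: "d\<^sup>2 * (1 - \<kappa>) \<le> 4 * (cmod (\<mu> * c1 - \<nu> * c1))\<^sup>2" .
  have kk: "\<kappa> \<le> 1/100" "\<epsilon> \<le> 1/250" using \<kappa> eps d3 by auto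
  have e2: "\<epsilon>\<^sup>2 \<le> \<epsilon>" using kk \<epsilon>0 by (simp add: power2_eq_square mult_left_le)
  have "(1 - r) * (d\<^sup>2 * (1 - \<kappa>)) \<le> (1 - r) * (4 * (cmod (\<mu> * c1 - \<nu> * c1))\<^sup>2)"
    using d4 r by (intro mult_left_mono) auto
  also have "\<dots> \<le> 16 * (\<kappa> + 3 * \<epsilon>)" using m3 e2 by simp
  finally have "(1 - r) * (d\<^sup>2 * (1 - \<kappa>)) \<le> 16 * (\<kappa> + 3 * \<epsilon>)" .
  moreover have "(1 - r) * (d\<^sup>2 * (1/2)) \<le> (1 - r) * (d\<^sup>2 * (1 - \<kappa>))"
    using r kk by (intro mult_left_mono) auto
  ultimately have r1: "(1 - r) * d\<^sup>2 \<le> 32 * (\<kappa> + 3 * \<epsilon>)" by simp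
  have q1: "cmod (\<mu> * c1 - \<nu> * c2) \<le> \<epsilon> + 2 * (1 - r)" by (rule gap(2)[OF uc(1,4) near(1)])
  have q2: "cmod (\<mu> * c2 - \<nu> * c1) \<le> \<epsilon> + 2 * (1 - r)"
    using gap(2)[OF uc(2,3) near2] by (simp add: norm_minus_commute)
  \<comment> \<open>Eliminating c2 from \<mu> c1 = \<nu> c2 and \<mu> c2 = \<nu> c1 leaves the
    difference of the squares.\<close>
  have "c1 * (\<mu>\<^sup>2 - \<nu>\<^sup>2) = \<mu> * (\<mu> * c1 - \<nu> * c2) + \<nu> * (\<mu> * c2 - \<nu> * c1)"
    by (simp add: power2_eq_square algebra_simps)
  then have "cmod (c1 * (\<mu>\<^sup>2 - \<nu>\<^sup>2)) \<le> cmod (\<mu> * c1 - \<nu> * c2) + cmod (\<mu> * c2 - \<nu> * c1)"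
    using norm_triangle_ineq[of "\<mu> * (\<mu> * c1 - \<nu> * c2)" "\<nu> * (\<mu> * c2 - \<nu> * c1)"] unit
    by (simp add: norm_mult)
  also have "\<dots> \<le> 2 * \<epsilon> + 4 * (1 - r)" using q1 q2 by simp
  finally have f1: "cmod c1 * cmod (\<mu>\<^sup>2 - \<nu>\<^sup>2) \<le> 2 * \<epsilon> + 4 * (1 - r)" by (simp add: norm_mult)
  have "cmod c1 \<ge> 1/2"
  proof (rule ccontr)
    assume "\<not> ?thesis"
    then have "(cmod c1)\<^sup>2 \<le> (1/2)\<^sup>2" by (intro power_mono) auto
    then show False using c1 kk by (simp add: power2_eq_square)
  qed
  then have "1/2 * d \<le> cmod c1 * cmod (\<mu>\<^sup>2 - \<nu>\<^sup>2)" using d by (intro mult_mono) auto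
  with f1 have "d \<le> 4 * \<epsilon> + 8 * (1 - r)" by simp
  then have "d * d\<^sup>2 \<le> (4 * \<epsilon> + 8 * (1 - r)) * d\<^sup>2" by (intro mult_right_mono) auto
  also have "\<dots> = 4 * \<epsilon> * d\<^sup>2 + 8 * ((1 - r) * d\<^sup>2)" by (simp add: algebra_simps)
  also have "4 * \<epsilon> * d\<^sup>2 \<le> 4 * \<epsilon> * 4" using \<epsilon>0 d d2 power_mono[of d 2 2] by (intro mult_left_mono) auto
  \<comment> \<open>The right side is 784 \<epsilon> + 256 \<kappa>. With \<epsilon> at most
    d^3/2000 and \<kappa> = 4/V1 at most d^3/1000 it is below 0.65 d^3; this fixes the two constants
    in the hypotheses.\<close>
  finally have "d ^ 3 \<le> 16 * \<epsilon> + 256 * (\<kappa> + 3 * \<epsilon>)" using r1 by (simp add: power3_eq_cube power2_eq_square mult.assoc)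
  then show False using \<kappa>(2) eps d3 by simp
qed

text \<open>Chains with small potentials rotate only up to an error \<tau>, which is moved into
  \<epsilon>. Exchanging the indices 1 and 2 exchanges the two near-equalities without touching
  \<mu> and \<nu>, so the order of V1 and V2 is immaterial.\<close>

lemma rotation_mismatch:
  fixes \<mu> \<nu> c1 c2 e1 e2 f1 f2 :: complex and V1 V2 :: real
  assumes "cmod \<mu> = 1" "cmod \<nu> = 1" "0 < d" "d \<le> cmod (\<mu>\<^sup>2 - \<nu>\<^sup>2)"
    and V: "0 < V1" "0 < V2" and c: "cmod c1 \<le> 1" "cmod c2 \<le> 1"
    and "V1 * (1 - (cmod c1)\<^sup>2) = 4" "V2 * (1 - (cmod c2)\<^sup>2) = 4"
    and "4000 / d ^ 3 \<le> max V1 V2" and "\<epsilon> + 2 * \<tau> \<le> d ^ 3 / 2000"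
    and e: "cmod (e1 - \<mu> * c1) \<le> \<tau>" "cmod (e2 - \<mu> * c2) \<le> \<tau>"
      "cmod (f1 - \<nu> * c1) \<le> \<tau>" "cmod (f2 - \<nu> * c2) \<le> \<tau>"
    and near: "cmod (V1 * (1 - e1) - V2 * (1 - f2)) \<le> \<epsilon> * max V1 V2"
      "cmod (V2 * (1 - e2) - V1 * (1 - f1)) \<le> \<epsilon> * max V1 V2"
  shows False
proof -
  define m where "m = max V1 V2"
  have *: "cmod (x * (1 - e') - y * (1 - f')) \<le> (\<epsilon> + 2 * \<tau>) * m"
    if "cmod (x * (1 - e) - y * (1 - f)) \<le> \<epsilon> * m" "0 < x" "0 < y" "x \<le> m" "y \<le> m"
      "cmod (e - e') \<le> \<tau>" "cmod (f - f') \<le> \<tau>" for x y :: real and e f e' f' :: complex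
  proof -
    have "x * (1 - e') - y * (1 - f') = (x * (1 - e) - y * (1 - f)) + (x * (e - e') - y * (f - f'))"
      by (simp add: algebra_simps)
    then have "cmod (x * (1 - e') - y * (1 - f')) \<le> cmod (x * (1 - e) - y * (1 - f)) + cmod (x * (e - e') - y * (f - f'))"
      using norm_triangle_ineq by metis
    also have "cmod (x * (e - e') - y * (f - f')) \<le> x * cmod (e - e') + y * cmod (f - f')"
      using norm_triangle_ineq4[of "x * (e - e')" "y * (f - f')"] that by (simp add: norm_mult)
    also have "\<dots> \<le> m * \<tau> + m * \<tau>"
      using that by (intro add_mono mult_mono) auto
    finally show ?thesis using that by (simp add: algebra_simps)
  qed
  note near' = near[folded m_def]
  have 1: "cmod (V1 * (1 - \<mu> * c1) - V2 * (1 - \<nu> * c2)) \<le> (\<epsilon> + 2 * \<tau>) * m"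
    by (rule *[OF near'(1)]) (use V e in \<open>auto simp: m_def\<close>)
  have 2: "cmod (V2 * (1 - \<mu> * c2) - V1 * (1 - \<nu> * c1)) \<le> (\<epsilon> + 2 * \<tau>) * m"
    by (rule *[OF near'(2)]) (use V e in \<open>auto simp: m_def\<close>)
  show False
  proof (cases "V2 \<le> V1")
    case True
    then show False using rotation_mismatch_ordered[of \<mu> \<nu> d V2 V1 c2 c1 "\<epsilon> + 2 * \<tau>"] 1 2 assms
      by (simp add: m_def max_def)
  next
    case False
    then show False using rotation_mismatch_ordered[of \<mu> \<nu> d V1 V2 c1 c2 "\<epsilon> + 2 * \<tau>"] 1 2 assms
      by (simp add: m_def max_def)
  qed
qed

section \<open>Strict contraction from the defect\<close>

text \<open>V and W are the weights before the chains, V' and W' those after. The total loss is a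
  sum of nonnegative terms, so a small total makes each small: the slacks give V' close to V and W'
  close to W within 2tm, the defect gives an error of at most 3tm for V' and W'. Since 1 - e and 1 -
  f have modulus at most 2, the constant is 3 + 4 + 4 = 11.\<close>

lemma weighted_pair_le_near_equality:
  fixes e f :: complex and V W V' W' \<rho> \<sigma> \<theta> t m \<rho>0 :: real
  assumes \<rho>0: "0 < \<rho>0" "\<rho>0 \<le> \<rho>" "\<rho>0 \<le> \<sigma>" and sum: "\<rho> + \<sigma> = 1"
    and \<theta>: "1 \<le> \<theta>" "\<theta> \<le> 1 + t" and t: "0 \<le> t" "t \<le> 1"
    and m: "0 < m" "V \<le> m" "W \<le> m" and V: "0 \<le> V" "0 \<le> W"
    and V': "V' \<le> \<theta> * V" "W' \<le> \<theta> * W"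
    and ef: "cmod e \<le> 1" "cmod f \<le> 1"
    and G: "\<theta> * (\<rho> * (\<theta> * V - V') + \<sigma> * (\<theta> * W - W') + \<rho> * \<sigma> / (4 * (\<theta> * m)) * (cmod (V' * (1 - e) - W' * (1 - f)))\<^sup>2)
       < \<rho>0\<^sup>2 * t\<^sup>2 * m"
  shows "cmod (V * (1 - e) - W * (1 - f)) \<le> 11 * t * m"
proof -
  define gV where "gV = \<theta> * V - V'"
  define gW where "gW = \<theta> * W - W'"
  define N where "N = cmod (V' * (1 - e) - W' * (1 - f))"
  define D where "D = \<rho> * \<sigma> / (4 * (\<theta> * m)) * N\<^sup>2"
  have g: "0 \<le> gV" "0 \<le> gW" using V' by (simp_all add: gV_def gW_def)
  have \<rho>\<sigma>: "0 < \<rho>" "0 < \<sigma>" using \<rho>0 by auto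
  have D: "0 \<le> D" unfolding D_def using \<rho>\<sigma> \<theta> m by simp
  have nn: "0 \<le> \<rho> * gV" "0 \<le> \<sigma> * gW" using g \<rho>\<sigma> by auto
  have "\<rho> * gV + \<sigma> * gW + D \<le> \<theta> * (\<rho> * gV + \<sigma> * gW + D)"
    using \<theta> nn D mult_right_mono[of 1 \<theta> "\<rho> * gV + \<sigma> * gW + D"] by simp
  also have "\<dots> < \<rho>0\<^sup>2 * t\<^sup>2 * m" using G by (simp add: gV_def gW_def D_def N_def)
  finally have tot: "\<rho> * gV + \<sigma> * gW + D < \<rho>0\<^sup>2 * t\<^sup>2 * m" .
  have "\<rho>0 * 2 \<le> 1" using \<rho>0 sum by simp
  then have r1: "\<rho>0 * t * t \<le> 1 * t" using \<rho>0 t mult_le_one[of \<rho>0 t] by (intro mult_right_mono) auto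
  have small: "g' \<le> t * m" if "0 \<le> g'" "\<rho>0 \<le> r" "r * g' < \<rho>0\<^sup>2 * t\<^sup>2 * m" for g' r
  proof -
    have "\<rho>0 * g' \<le> r * g'" using that by (intro mult_right_mono) auto
    with that have "\<rho>0 * g' < \<rho>0 * (\<rho>0 * t * t * m)" by (simp add: power2_eq_square algebra_simps)
    then have "g' < \<rho>0 * t * t * m" using \<rho>0 by simp
    also have "\<dots> \<le> 1 * t * m" using r1 m by (simp add: mult_right_mono)
    finally show ?thesis by simp
  qed
  have gV: "gV \<le> t * m" using small[of gV \<rho>] g \<rho>0 tot nn D by linarith
  have gW: "gW \<le> t * m" using small[of gW \<sigma>] g \<rho>0 tot nn D by linarith
  have N: "N \<le> 3 * t * m"
  proof -
    have "\<rho>0 * \<rho>0 * N\<^sup>2 \<le> \<rho> * \<sigma> * N\<^sup>2" using \<rho>0 by (intro mult_right_mono mult_mono) auto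
    also have "\<dots> = D * (4 * (\<theta> * m))" using \<theta> m by (simp add: D_def)
    also have "\<dots> \<le> (\<rho>0\<^sup>2 * t\<^sup>2 * m) * (4 * (2 * m))"
      using tot nn D \<theta> t m by (intro mult_mono) auto
    finally have "\<rho>0\<^sup>2 * N\<^sup>2 \<le> \<rho>0\<^sup>2 * (8 * (t * m)\<^sup>2)" by (simp add: power2_eq_square algebra_simps)
    then have "N\<^sup>2 \<le> 8 * (t * m)\<^sup>2" using \<rho>0 by simp
    also have "\<dots> \<le> (3 * t * m)\<^sup>2" by (simp add: power_mult_distrib)
    finally show ?thesis using t m by (intro power2_le_imp_le[of N]) auto
  qed
  have close: "\<bar>x - x'\<bar> \<le> 2 * t * m" if "0 \<le> x" "x \<le> m" "\<theta> * x - x' \<le> t * m" "x' \<le> \<theta> * x" for x x'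
  proof -
    have "(\<theta> - 1) * x \<le> t * m" using \<theta> t that m by (intro mult_mono) auto
    moreover have "0 \<le> (\<theta> - 1) * x" using \<theta> that by simp
    ultimately show ?thesis using that t m by (auto simp: abs_le_iff algebra_simps)
  qed
  have cV: "\<bar>V - V'\<bar> \<le> 2 * t * m" using close[of V V'] gV V m V' by (simp add: gV_def)
  have cW: "\<bar>W - W'\<bar> \<le> 2 * t * m" using close[of W W'] gW V m V' by (simp add: gW_def)
  have n2: "cmod (1 - x) \<le> 2" if "cmod x \<le> 1" for x using norm_triangle_ineq4[of 1 x] that by simp
  have "V * (1 - e) - W * (1 - f) = (V' * (1 - e) - W' * (1 - f)) + (of_real (V - V') * (1 - e) - of_real (W - W') * (1 - f))"
    by (simp add: algebra_simps)
  then have "cmod (V * (1 - e) - W * (1 - f)) \<le> N + cmod (of_real (V - V') * (1 - e) - of_real (W - W') * (1 - f))"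
    unfolding N_def using norm_triangle_ineq by metis
  also have "cmod (of_real (V - V') * (1 - e) - of_real (W - W') * (1 - f))
      \<le> \<bar>V - V'\<bar> * cmod (1 - e) + \<bar>W - W'\<bar> * cmod (1 - f)"
    using norm_triangle_ineq4[of "of_real (V - V') * (1 - e)" "of_real (W - W') * (1 - f)"]
    by (simp only: norm_mult norm_of_real)
  also have "\<dots> \<le> (2 * t * m) * 2 + (2 * t * m) * 2"
    using cV cW n2 ef t m by (intro add_mono mult_mono) auto
  finally show ?thesis using N by (simp add: algebra_simps)
qed

text \<open>For s = X/W in the unit interval, s^(1+p) is at most s. An additive gain thus survives
  the power with the factor W^p.\<close>

lemma powr_le_diff:
  fixes X W G p :: real
  assumes "0 \<le> X" "0 < W" "0 \<le> G" "X \<le> W - G" "0 < p"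
  shows "X powr (1 + p) \<le> W powr (1 + p) - G * W powr p"
proof -
  define s where "s = X / W"
  have s: "0 \<le> s" "s \<le> 1" "s \<le> 1 - G / W" using assms by (auto simp: s_def field_simps)
  have "s powr (1 + p) \<le> s powr 1" using s assms by (intro powr_mono') auto
  then have "s powr (1 + p) \<le> 1 - G / W" using s by simp
  then have "W powr (1 + p) * s powr (1 + p) \<le> W powr (1 + p) * (1 - G / W)"
    by (intro mult_left_mono) auto
  moreover have "W powr (1 + p) * s powr (1 + p) = X powr (1 + p)"
    using assms s by (simp add: powr_mult[symmetric] s_def)
  moreover have "W powr (1 + p) * (1 - G / W) = W powr (1 + p) - G * W powr p"
    using assms by (simp add: powr_add field_simps)
  ultimately show ?thesis by simp
qed

lemma powr_convex_combination:
  fixes x y \<rho> \<sigma> p :: real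
  assumes "0 < x" "0 < y" "0 \<le> \<rho>" "0 \<le> \<sigma>" "\<rho> + \<sigma> = 1" "0 < p"
  shows "(\<rho> * x + \<sigma> * y) powr (1 + p) \<le> \<rho> * x powr (1 + p) + \<sigma> * y powr (1 + p)"
  using powr_convex[of "1 + p"] assms unfolding convex_on_def by auto

text \<open>Convexity moves the power inside the average, and over both orders each of V1, V2
  receives total weight \<rho> + \<sigma> = 1, so unequal branch weights do no harm. The averages
  are at least \<open>\<rho>0 * m\<close> with m the larger weight, so a gain of
  \<open>\<delta> * m\<close> in one order is worth
  \<open>\<delta> * \<rho>0 powr p * m powr (1 + p)\<close>; the last power is at least half the sum
  of the two, whence the division by 2.\<close>

lemma swapped_pair_contraction:
  fixes X Y V1 V2 \<rho> \<sigma> \<theta> \<delta> \<rho>0 p G1 G2 :: real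
  assumes \<rho>0: "0 < \<rho>0" "\<rho>0 \<le> \<rho>" "\<rho>0 \<le> \<sigma>" and sum: "\<rho> + \<sigma> = 1" and p: "0 < p"
    and V: "0 < V1" "0 < V2" and XY: "0 \<le> X" "0 \<le> Y" and \<theta>: "1 \<le> \<theta>" and \<delta>: "0 \<le> \<delta>"
    and X: "X \<le> \<theta>\<^sup>2 * (\<rho> * V1 + \<sigma> * V2) - G1" and Y: "Y \<le> \<theta>\<^sup>2 * (\<rho> * V2 + \<sigma> * V1) - G2"
    and G: "0 \<le> G1" "0 \<le> G2" "\<delta> * max V1 V2 \<le> G1 \<or> \<delta> * max V1 V2 \<le> G2"
  shows "X powr (1 + p) + Y powr (1 + p)
    \<le> ((\<theta>\<^sup>2) powr (1 + p) - \<delta> * \<rho>0 powr p / 2) * (V1 powr (1 + p) + V2 powr (1 + p))"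
proof -
  define m where "m = max V1 V2"
  define Q where "Q = V1 powr (1 + p) + V2 powr (1 + p)"
  have m: "0 < m" "V1 \<le> m" "V2 \<le> m" using V by (auto simp: m_def)
  have \<rho>\<sigma>: "0 < \<rho>" "0 < \<sigma>" using \<rho>0 by auto
  have \<theta>2: "1 \<le> \<theta>\<^sup>2" using \<theta> by simp
  have low: "\<rho>0 * m \<le> \<theta>\<^sup>2 * (r * x + s * y)"
    if "\<rho>0 \<le> r" "\<rho>0 \<le> s" "0 < x" "0 < y" "max x y = m" for r s x y
  proof -
    have *: "\<rho>0 * x \<le> r * x" "\<rho>0 * y \<le> s * y" using that by (auto intro: mult_right_mono)
    have "0 < r * x" "0 < s * y" using that \<rho>0 by auto
    moreover have "m = x \<or> m = y" using that by auto
    ultimately have "\<rho>0 * m \<le> r * x + s * y" using * by (smt (verit))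
    moreover have "1 * (r * x + s * y) \<le> \<theta>\<^sup>2 * (r * x + s * y)"
      using \<theta>2 \<open>0 < r * x\<close> \<open>0 < s * y\<close> by (intro mult_right_mono) auto
    ultimately show ?thesis by simp
  qed
  have bound: "Z powr (1 + p) \<le> (\<theta>\<^sup>2) powr (1 + p) * (r * x powr (1 + p) + s * y powr (1 + p)) - H * (\<rho>0 * m) powr p"
    if "\<rho>0 \<le> r" "\<rho>0 \<le> s" "r + s = 1" "0 < x" "0 < y" "max x y = m" "0 \<le> Z" "0 \<le> H"
      "Z \<le> \<theta>\<^sup>2 * (r * x + s * y) - H" for Z r x s y H
  proof -
    define W where "W = \<theta>\<^sup>2 * (r * x + s * y)"
    have l: "\<rho>0 * m \<le> W" unfolding W_def using that by (intro low) auto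
    then have W: "0 < W" using \<rho>0 m by (smt (verit) mult_pos_pos)
    have "Z powr (1 + p) \<le> W powr (1 + p) - H * W powr p"
      using that W p by (intro powr_le_diff) (auto simp: W_def)
    also have "\<dots> \<le> W powr (1 + p) - H * (\<rho>0 * m) powr p"
      using that l \<rho>0 m p by (intro diff_left_mono mult_left_mono powr_mono2) auto
    also have "W powr (1 + p) = (\<theta>\<^sup>2) powr (1 + p) * (r * x + s * y) powr (1 + p)"
      unfolding W_def using that \<rho>0 by (simp add: powr_mult)
    also have "\<dots> \<le> (\<theta>\<^sup>2) powr (1 + p) * (r * x powr (1 + p) + s * y powr (1 + p))"
      using that \<rho>0 p by (intro mult_left_mono powr_convex_combination) auto
    finally show ?thesis by simp
  qed
  have bX: "X powr (1 + p) \<le> (\<theta>\<^sup>2) powr (1 + p) * (\<rho> * V1 powr (1 + p) + \<sigma> * V2 powr (1 + p)) - G1 * (\<rho>0 * m) powr p"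
    using assms by (intro bound) (auto simp: m_def)
  have bY: "Y powr (1 + p) \<le> (\<theta>\<^sup>2) powr (1 + p) * (\<rho> * V2 powr (1 + p) + \<sigma> * V1 powr (1 + p)) - G2 * (\<rho>0 * m) powr p"
    using assms by (intro bound) (auto simp: m_def max.commute)
  have "(\<rho> * V1 powr (1 + p) + \<sigma> * V2 powr (1 + p)) + (\<rho> * V2 powr (1 + p) + \<sigma> * V1 powr (1 + p)) = (\<rho> + \<sigma>) * Q"
    by (simp add: Q_def algebra_simps)
  then have "(\<theta>\<^sup>2) powr (1 + p) * (\<rho> * V1 powr (1 + p) + \<sigma> * V2 powr (1 + p)) + 
      (\<theta>\<^sup>2) powr (1 + p) * (\<rho> * V2 powr (1 + p) + \<sigma> * V1 powr (1 + p)) = (\<theta>\<^sup>2) powr (1 + p) * Q"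
    using sum by (simp only: distrib_left[symmetric] mult_1)
  with bX bY have 1: "X powr (1 + p) + Y powr (1 + p) \<le> (\<theta>\<^sup>2) powr (1 + p) * Q - (G1 + G2) * (\<rho>0 * m) powr p"
    by (simp only: distrib_right)
  have "\<delta> * m \<le> G1 + G2" using G by (auto simp: m_def)
  then have "(G1 + G2) * (\<rho>0 * m) powr p \<ge> (\<delta> * m) * (\<rho>0 * m) powr p" by (intro mult_right_mono) auto
  also have "(\<delta> * m) * (\<rho>0 * m) powr p = \<delta> * \<rho>0 powr p * m powr (1 + p)"
    using m \<rho>0 by (simp add: powr_mult powr_add)
  finally have 2: "\<delta> * \<rho>0 powr p * m powr (1 + p) \<le> (G1 + G2) * (\<rho>0 * m) powr p" .
  have "Q \<le> m powr (1 + p) + m powr (1 + p)"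
    unfolding Q_def using V m p by (intro add_mono powr_mono2) auto
  then have "\<delta> * \<rho>0 powr p * (Q / 2) \<le> \<delta> * \<rho>0 powr p * m powr (1 + p)"
    using \<delta> by (intro mult_left_mono) auto
  with 1 2 show ?thesis unfolding Q_def[symmetric] by (simp add: algebra_simps)
qed

section \<open>Chains of auxiliary vertices\<close>

fun chain :: "complex \<Rightarrow> (nat \<Rightarrow> real) \<Rightarrow> complex \<Rightarrow> nat \<Rightarrow> complex" where
  "chain z f lam 0 = z"
| "chain z f lam (Suc j) = -1 / (chain z f lam j + lam + 1 - of_real (f j))"

definition join :: "complex \<Rightarrow> complex \<Rightarrow> complex \<Rightarrow> real \<Rightarrow> complex" where
  "join lam a b t = -1 / (a + b + lam - of_real t)"

lemma Im_neg_inverse: "Im (-1 / w) = Im w / (cmod w)\<^sup>2"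
  by (simp add: Im_divide cmod_power2)

lemma Im_neg_inverse_pos: "0 < Im w \<Longrightarrow> 0 < Im (-1 / w)"
  unfolding Im_neg_inverse by (intro divide_pos_pos) (auto simp: complex_eq_iff)

lemma chain_pos:
  assumes "0 < Im z" "0 \<le> Im lam"
  shows "0 < Im (chain z f lam j)"
proof (induction j)
  case (Suc j)
  then have "0 < Im (chain z f lam j + lam + 1 - of_real (f j))" using assms by simp
  then show ?case unfolding chain.simps by (rule Im_neg_inverse_pos)
qed (use assms in simp)

lemma join_pos: "0 < Im a \<Longrightarrow> 0 < Im b \<Longrightarrow> 0 \<le> Im lam \<Longrightarrow> 0 < Im (join lam a b t)"
  unfolding join_def by (intro Im_neg_inverse_pos) simp

lemma phi0_eq_chain: "phi0 j z lam = chain z (\<lambda>_. 0) lam j"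
  by (induction j) auto

text \<open>The product of the factors \<open>cnj w / w\<close> of \<open>cay_inversion\<close> for
  w = \<open>phi0 i z lam + lam + 1\<close>, rewritten through -1/w =
  \<open>phi0 (Suc i) z lam\<close>.\<close>

definition turn :: "complex \<Rightarrow> complex \<Rightarrow> nat \<Rightarrow> complex" where
  "turn z lam j = (\<Prod>i<j. phi0 (Suc i) z lam / cnj (phi0 (Suc i) z lam))"

lemma cmod_turn:
  assumes "0 < Im z" "0 \<le> Im lam"
  shows "cmod (turn z lam j) = 1"
proof -
  have "phi0 i z lam \<noteq> 0" for i using chain_pos[OF assms, of "\<lambda>_. 0" i] by (auto simp: phi0_eq_chain)
  then show ?thesis unfolding turn_def prod_norm[symmetric] by (simp add: norm_divide del: phi0.simps)
qed

lemma cnj_neg_inverse_ratio: "w \<noteq> 0 \<Longrightarrow> cnj w / w = (-1/w) / cnj (-1/w)"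
  by (simp add: field_simps)

lemma chain_weight:
  assumes z: "0 < Im z" and zt: "0 < Im \<zeta>" and lam: "0 \<le> Im lam" and c: "0 < c"
    and low: "\<And>i. i < j \<Longrightarrow> c \<le> Im (phi0 i \<zeta> lam)"
  shows "sw (phi0 j \<zeta> lam) (chain z f lam j) \<le> (\<Prod>i<j. (1 + \<bar>f i\<bar> / c)\<^sup>2) * sw \<zeta> z"
    and "cmod (cay (phi0 j \<zeta> lam) (chain z f lam j) - turn \<zeta> lam j * cay \<zeta> z)
       \<le> (\<Sum>i<j. 2 * (\<bar>f i\<bar> + Im lam) / c)"
proof -
  have "sw (phi0 j \<zeta> lam) (chain z f lam j) \<le> (\<Prod>i<j. (1 + \<bar>f i\<bar> / c)\<^sup>2) * sw \<zeta> z
    \<and> cmod (cay (phi0 j \<zeta> lam) (chain z f lam j) - turn \<zeta> lam j * cay \<zeta> z)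
       \<le> (\<Sum>i<j. 2 * (\<bar>f i\<bar> + Im lam) / c)"
    using low
  proof (induction j)
    case 0 show ?case by (simp add: turn_def)
  next
    case (Suc j)
    define a where "a = phi0 j \<zeta> lam"
    define x where "x = chain z f lam j"
    define s where "s = lam + 1"
    have a: "0 < Im a" unfolding a_def phi0_eq_chain by (rule chain_pos[OF zt lam])
    have x: "0 < Im x" unfolding x_def by (rule chain_pos[OF z lam])
    have s: "0 \<le> Im s" "Im s = Im lam" using lam by (auto simp: s_def)
    have ca: "c \<le> Im a" using Suc.prems[of j] by (simp add: a_def)
    have as: "0 < Im (a + s)" "0 < Im (x + s - of_real (f j))" using a x s by auto
    have IH: "sw a x \<le> (\<Prod>i<j. (1 + \<bar>f i\<bar> / c)\<^sup>2) * sw \<zeta> z"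
      "cmod (cay a x - turn \<zeta> lam j * cay \<zeta> z) \<le> (\<Sum>i<j. 2 * (\<bar>f i\<bar> + Im lam) / c)"
      using Suc by (auto simp: a_def x_def)
    have pa: "phi0 (Suc j) \<zeta> lam = -1 / (a + s)" by (simp add: a_def s_def add.assoc)
    have px: "chain z f lam (Suc j) = -1 / (x + s - of_real (f j))" by (simp add: x_def s_def algebra_simps)
    have nz: "a + s \<noteq> 0" using as by force
    have "sw (phi0 (Suc j) \<zeta> lam) (chain z f lam (Suc j)) = sw (a + s) (x + s - of_real (f j))"
      unfolding pa px using as by (rule sw_inversion)
    also have "\<dots> \<le> (1 + \<bar>f j\<bar> / Im a)\<^sup>2 * sw a x" by (rule sw_translate[OF a x s(1)])
    also have "\<dots> \<le> (1 + \<bar>f j\<bar> / c)\<^sup>2 * sw a x"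
      using ca c a sw_ge_4[OF a x] by (intro mult_right_mono power_mono add_mono divide_left_mono) auto
    also have "\<dots> \<le> (1 + \<bar>f j\<bar> / c)\<^sup>2 * ((\<Prod>i<j. (1 + \<bar>f i\<bar> / c)\<^sup>2) * sw \<zeta> z)"
      using IH by (intro mult_left_mono) auto
    finally have 1: "sw (phi0 (Suc j) \<zeta> lam) (chain z f lam (Suc j)) \<le> (\<Prod>i<Suc j. (1 + \<bar>f i\<bar> / c)\<^sup>2) * sw \<zeta> z"
      by (simp only: prod.lessThan_Suc mult_ac)
    define \<omega> where "\<omega> = cnj (a + s) / (a + s)"
    have \<omega>: "cmod \<omega> = 1" using nz by (simp add: \<omega>_def norm_divide del: complex_cnj_add)
    have tu: "turn \<zeta> lam (Suc j) = \<omega> * turn \<zeta> lam j"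
      unfolding turn_def prod.lessThan_Suc pa \<omega>_def cnj_neg_inverse_ratio[OF nz] by (rule mult.commute)
    have "cay (phi0 (Suc j) \<zeta> lam) (chain z f lam (Suc j)) - turn \<zeta> lam (Suc j) * cay \<zeta> z
       = \<omega> * ((cay (a + s) (x + s - of_real (f j)) - cay a x) + (cay a x - turn \<zeta> lam j * cay \<zeta> z))"
      unfolding pa px tu cay_inversion[OF as] \<omega>_def[symmetric] by (simp add: algebra_simps)
    then have "cmod (cay (phi0 (Suc j) \<zeta> lam) (chain z f lam (Suc j)) - turn \<zeta> lam (Suc j) * cay \<zeta> z)
        = cmod ((cay (a + s) (x + s - of_real (f j)) - cay a x) + (cay a x - turn \<zeta> lam j * cay \<zeta> z))"
      by (simp only: norm_mult \<omega> mult_1)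
    also have "\<dots> \<le> cmod (cay (a + s) (x + s - of_real (f j)) - cay a x) + cmod (cay a x - turn \<zeta> lam j * cay \<zeta> z)"
      by (rule norm_triangle_ineq)
    also have "\<dots> \<le> 2 * (\<bar>f j\<bar> + Im lam) / Im a + (\<Sum>i<j. 2 * (\<bar>f i\<bar> + Im lam) / c)"
      using cay_translate[OF a x s(1), of "f j"] IH s by (intro add_mono) auto
    also have "2 * (\<bar>f j\<bar> + Im lam) / Im a \<le> 2 * (\<bar>f j\<bar> + Im lam) / c"
      using ca c a lam by (intro divide_left_mono) auto
    finally show ?case using 1 by (simp del: phi0.simps chain.simps)
  qed
  then show "sw (phi0 j \<zeta> lam) (chain z f lam j) \<le> (\<Prod>i<j. (1 + \<bar>f i\<bar> / c)\<^sup>2) * sw \<zeta> z"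
    and "cmod (cay (phi0 j \<zeta> lam) (chain z f lam j) - turn \<zeta> lam j * cay \<zeta> z)
       \<le> (\<Sum>i<j. 2 * (\<bar>f i\<bar> + Im lam) / c)" by auto
qed

definition Phi :: "nat \<Rightarrow> nat \<Rightarrow> complex \<Rightarrow> complex \<Rightarrow> complex \<Rightarrow> (nat \<Rightarrow> real) \<Rightarrow> complex" where
  "Phi m n lam z1 z2 Q = join lam (chain z1 Q lam n) (chain z2 (\<lambda>i. Q (n + i)) lam m) (Q (n + m))"

text \<open>Each potential contributes the squared factor of \<open>sw_translate\<close>; this
  square is why moments of order 2(1+p) are needed.\<close>

definition theta :: "real \<Rightarrow> nat \<Rightarrow> (nat \<Rightarrow> real) \<Rightarrow> real" where
  "theta c M Q = (\<Prod>i<M. (1 + \<bar>Q i\<bar> / c)\<^sup>2)"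

text \<open>The single constant c controls both the potential factors, through the imaginary parts
  along the chain, and the size of the rotation mismatch. Only c, not lam, enters the contraction
  constants, which makes them uniform up to the real axis.\<close>

definition nondeg :: "nat \<Rightarrow> nat \<Rightarrow> real \<Rightarrow> complex \<Rightarrow> complex \<Rightarrow> bool" where
  "nondeg m n c lam z \<longleftrightarrow> 0 < Im z \<and> 0 < Im lam \<and> phiz m n z lam = z \<and>
     (\<forall>i\<le>m+n. c \<le> Im (phi0 i z lam)) \<and> c \<le> cmod ((turn z lam n)\<^sup>2 - (turn z lam m)\<^sup>2)"

lemma Phi_pos: "0 < Im z1 \<Longrightarrow> 0 < Im z2 \<Longrightarrow> 0 \<le> Im lam \<Longrightarrow> 0 < Im (Phi m n lam z1 z2 Q)"
  unfolding Phi_def by (intro join_pos chain_pos)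

text \<open>The way from one child to its parent principal vertex meets only the potentials of its
  own edge and of that vertex; the other factors are at least 1 and may be added.\<close>

lemma prod_ge_1_split:
  fixes g :: "nat \<Rightarrow> real"
  assumes "\<And>i. 1 \<le> g i"
  shows "(\<Prod>i<n. g i) * g (n + m) \<le> (\<Prod>i<m+n+1. g i)"
    and "(\<Prod>i<m. g (n + i)) * g (n + m) \<le> (\<Prod>i<m+n+1. g i)"
    and "1 \<le> (\<Prod>i<n. g i)" "1 \<le> (\<Prod>i<m. g (n + i))"
    and "(\<Prod>i<n. g i) \<le> (\<Prod>i<m+n+1. g i)"
    and "(\<Prod>i<m. g (n + i)) \<le> (\<Prod>i<m+n+1. g i)"
proof -
  have *: "(\<Prod>i<m+n+1. g i) = (\<Prod>i<n. g i) * (\<Prod>i<m. g (n + i)) * g (n + m)"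
  proof -
    have "(\<Prod>i<n+m. g i) = (\<Prod>i<n. g i) * (\<Prod>i<m. g (n + i))"
      by (induction m) auto
    then show ?thesis by (simp add: add.commute)
  qed
  show a: "1 \<le> (\<Prod>i<n. g i)" "1 \<le> (\<Prod>i<m. g (n + i))" by (auto intro: prod_ge_1 assms)
  have g: "1 \<le> g (n+m)" by (rule assms)
  define A B x where "A = (\<Prod>i<n. g i)" and "B = (\<Prod>i<m. g (n + i))" and "x = g (n+m)"
  have AB: "1 \<le> A" "1 \<le> B" "1 \<le> x" using a g by (auto simp: A_def B_def x_def)
  have "A * x * 1 \<le> A * x * B" "B * x * 1 \<le> B * x * A" using AB by (auto intro!: mult_left_mono)
  then show 1: "A * x \<le> (\<Prod>i<m+n+1. g i)" and 2: "B * x \<le> (\<Prod>i<m+n+1. g i)"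
    unfolding * A_def[symmetric] B_def[symmetric] x_def[symmetric] by (simp_all add: mult_ac)
  have "A * 1 \<le> A * x" "B * 1 \<le> B * x" using AB by (auto intro!: mult_left_mono)
  then show "A \<le> (\<Prod>i<m+n+1. g i)" "B \<le> (\<Prod>i<m+n+1. g i)" using 1 2 by auto
qed

section \<open>The contraction estimate\<close>

lemma theta_ge_1: "0 < c \<Longrightarrow> 1 \<le> theta c M Q"
  unfolding theta_def by (intro prod_ge_1) auto

lemma nondegD:
  assumes "nondeg m n c lam z"
  shows "0 < Im z" "0 < Im lam" "phiz m n z lam = z" "i \<le> m + n \<Longrightarrow> c \<le> Im (phi0 i z lam)"
    "c \<le> cmod ((turn z lam n)\<^sup>2 - (turn z lam m)\<^sup>2)"
  using assms by (auto simp: nondeg_def)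

text \<open>The fixed point equation makes -1/z the sum of A, B and lam, and its imaginary part is
  at most 1/\<open>Im z\<close>, hence at most 1/c. As \<open>Im A\<close> and \<open>Im B\<close>
  are at least c, each share is at least c^2.\<close>

lemma nondeg_weights:
  assumes nd: "nondeg m n c lam z" and c: "0 < c"
    and r: "\<rho> = Im (phi0 n z lam) / (Im (phi0 n z lam) + Im (phi0 m z lam))"
    and s: "\<sigma> = Im (phi0 m z lam) / (Im (phi0 n z lam) + Im (phi0 m z lam))"
  shows "c\<^sup>2 \<le> \<rho>" "c\<^sup>2 \<le> \<sigma>" "\<rho> + \<sigma> = 1"
proof -
  define A where "A = Im (phi0 n z lam)"
  define B where "B = Im (phi0 m z lam)"
  have AB: "c \<le> A" "c \<le> B" using nondegD(4)[OF nd] by (auto simp: A_def B_def)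
  have z: "0 < Im z" "c \<le> Im z" using nondegD[OF nd] nondegD(4)[OF nd, of 0] by auto
  define w where "w = phi0 n z lam + phi0 m z lam + lam"
  have w: "0 < Im w" using AB c nondegD(2)[OF nd] by (simp add: w_def A_def B_def)
  have "z = -1 / w" using nondegD(3)[OF nd] by (simp add: phiz_def w_def)
  then have "w * z = -1" using w by (cases "w = 0") auto
  then have "w = -1 / z" using z nonzero_eq_divide_eq[of z w "-1"] by force
  then have "Im w = Im z / (cmod z)\<^sup>2" using Im_neg_inverse by metis
  also have "\<dots> \<le> Im z / (Im z)\<^sup>2"
    using z abs_Im_le_cmod[of z] by (intro divide_left_mono power_mono) (auto intro!: mult_pos_pos)
  also have "\<dots> = 1 / Im z" using z by (simp add: power2_eq_square)
  also have "\<dots> \<le> 1 / c" using z c by (intro divide_left_mono) auto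
  finally have "A + B \<le> 1 / c" using nondegD(2)[OF nd] by (simp add: w_def A_def B_def)
  then have AB': "(A + B) * c \<le> 1" using c by (simp add: field_simps)
  have sum0: "0 < A + B" using AB c by simp
  have "c\<^sup>2 * (A + B) \<le> c * 1" using AB' c by (simp add: power2_eq_square mult.assoc mult.commute mult_left_mono)
  then have "c\<^sup>2 * (A + B) \<le> A" "c\<^sup>2 * (A + B) \<le> B" using AB by auto
  then show "c\<^sup>2 \<le> \<rho>" "c\<^sup>2 \<le> \<sigma>"
    using sum0 unfolding r s A_def[symmetric] B_def[symmetric] by (simp_all add: field_simps)
  show "\<rho> + \<sigma> = 1"
    using sum0 unfolding r s A_def[symmetric] B_def[symmetric] by (simp add: add_divide_distrib[symmetric])
qed

text \<open>The form with the defect pays \<open>theta\<close> outside the bracket and again when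
  \<open>sw A a\<close> is compared with \<open>sw z z1\<close>, hence a square later on. The form
  without it keeps the factors of the two edges apart and pays \<open>theta\<close> once, which is
  what the moment assumption can afford.\<close>

lemma Phi_weight:
  assumes nd: "nondeg m n c lam z" and c: "0 < c" and z1: "0 < Im z1" and z2: "0 < Im z2"
    and V: "sw z z1 \<le> K" "sw z z2 \<le> K"
    and M: "M = m + n + 1"
    and A: "A = phi0 n z lam" and B: "B = phi0 m z lam"
    and a: "a = chain z1 Q lam n" and b: "b = chain z2 (\<lambda>i. Q (n + i)) lam m"
    and r: "\<rho> = Im A / (Im A + Im B)" and s: "\<sigma> = Im B / (Im A + Im B)"
  shows "sw z (Phi m n lam z1 z2 Q) \<le> theta c M Q * (\<rho> * sw A a + \<sigma> * sw B b
      - \<rho> * \<sigma> / (4 * (theta c M Q * K)) * (cmod (sw A a * (1 - cay A a) - sw B b * (1 - cay B b)))\<^sup>2)"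
    and "sw z (Phi m n lam z1 z2 Q) \<le> theta c M Q * (\<rho> * sw z z1 + \<sigma> * sw z z2)"
    and "sw A a \<le> theta c M Q * sw z z1" "sw B b \<le> theta c M Q * sw z z2"
    and "0 < Im A" "0 < Im B" "0 < Im a" "0 < Im b"
proof -
  note D = nondegD[OF nd]
  have lam: "0 \<le> Im lam" using D by simp
  show pos: "0 < Im A" "0 < Im B" "0 < Im a" "0 < Im b"
    unfolding A B a b phi0_eq_chain using D z1 z2 by (auto intro: chain_pos)
  define g where "g i = (1 + \<bar>Q i\<bar> / c)\<^sup>2" for i
  have g1: "1 \<le> g i" for i unfolding g_def using c by simp
  have th: "theta c M Q = (\<Prod>i<m+n+1. g i)" by (simp add: theta_def g_def M)
  note sp = prod_ge_1_split[of g, OF g1, folded th]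
  have Z: "0 < Im z" using D by simp
  have wa: "sw A a \<le> (\<Prod>i<n. g i) * sw z z1"
    unfolding A a g_def using z1 Z lam c D(4) by (intro chain_weight) auto
  have wb: "sw B b \<le> (\<Prod>i<m. g (n + i)) * sw z z2"
    unfolding B b g_def using z2 Z lam c D(4) by (intro chain_weight) auto
  have sz: "4 \<le> sw z z1" "4 \<le> sw z z2" using sw_ge_4 Z z1 z2 by auto
  have sAB: "4 \<le> sw A a" "4 \<le> sw B b" using sw_ge_4 pos by auto
  have th1: "1 \<le> theta c M Q" by (rule theta_ge_1[OF c])
  show t1: "sw A a \<le> theta c M Q * sw z z1"
  proof -
    have "(\<Prod>i<n. g i) * sw z z1 \<le> theta c M Q * sw z z1" using sz sp(5)[where n=n and m=m] by (intro mult_right_mono) (auto simp: th)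
    with wa show ?thesis by simp
  qed
  show t2: "sw B b \<le> theta c M Q * sw z z2"
  proof -
    have "(\<Prod>i<m. g (n + i)) * sw z z2 \<le> theta c M Q * sw z z2" using sz sp(6)[where n=n and m=m] by (intro mult_right_mono) (auto simp: th)
    with wb show ?thesis by simp
  qed
  define R where "R = \<rho> * sw A a + \<sigma> * sw B b
      - \<rho> * \<sigma> / (4 * (theta c M Q * K)) * (cmod (sw A a * (1 - cay A a) - sw B b * (1 - cay B b)))\<^sup>2"
  have "theta c M Q * sw z z1 \<le> theta c M Q * K" "theta c M Q * sw z z2 \<le> theta c M Q * K"
    using V th1 by (auto intro!: mult_left_mono)
  then have R: "sw (A + B) (a + b) \<le> R"
    unfolding R_def using t1 t2 by (intro sw_add[OF pos]) (auto simp: r s)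
  have zf: "z = -1 / (A + B + lam)" using D(3) by (simp add: phiz_def A B)
  have P: "Phi m n lam z1 z2 Q = -1 / (a + b + lam - of_real (Q (n + m)))"
    by (simp add: Phi_def join_def a b)
  have pos2: "0 < Im (A + B + lam)" "0 < Im (a + b + lam - of_real (Q (n + m)))" using pos lam by auto
  have AB: "0 < Im (A + B)" "0 < Im (a + b)" using pos by auto
  have cAB: "c \<le> Im (A + B)" using D(4)[of n] pos by (simp add: A)
  have "sw z (Phi m n lam z1 z2 Q) = sw (A + B + lam) (a + b + lam - of_real (Q (n + m)))"
    unfolding P by (subst zf) (rule sw_inversion[OF pos2])
  also have "\<dots> \<le> (1 + \<bar>Q (n + m)\<bar> / Im (A + B))\<^sup>2 * sw (A + B) (a + b)"
    by (rule sw_translate[OF AB lam])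
  also have "\<dots> \<le> g (n + m) * sw (A + B) (a + b)"
    unfolding g_def using cAB c sw_ge_4[OF AB] 
    by (intro mult_right_mono power_mono add_mono divide_left_mono) auto
  finally have main: "sw z (Phi m n lam z1 z2 Q) \<le> g (n + m) * sw (A + B) (a + b)" .
  have gth: "g (n + m) \<le> theta c M Q"
  proof -
    have "1 * g (n + m) \<le> (\<Prod>i<n. g i) * g (n + m)" using sp(3)[where n=n] g1[of "n + m"] by (intro mult_right_mono) auto
    with sp(1)[where n=n and m=m] show ?thesis by (simp add: th)
  qed
  have "g (n + m) * sw (A + B) (a + b) \<le> theta c M Q * R"
    using gth R sw_ge_4[OF AB] th1 by (intro mult_mono) auto
  with main show "sw z (Phi m n lam z1 z2 Q) \<le> theta c M Q * R" by simp
  have \<rho>\<sigma>: "0 \<le> \<rho>" "0 \<le> \<sigma>" using pos by (auto simp: r s)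
  have Kp: "0 < K" using V sz by linarith
  have "sw (A + B) (a + b) \<le> \<rho> * sw A a + \<sigma> * sw B b"
    using R \<rho>\<sigma> th1 Kp unfolding R_def by (smt (verit) divide_nonneg_nonneg mult_nonneg_nonneg zero_le_power2)
  also have "\<dots> \<le> \<rho> * ((\<Prod>i<n. g i) * sw z z1) + \<sigma> * ((\<Prod>i<m. g (n + i)) * sw z z2)"
    using wa wb \<rho>\<sigma> by (intro add_mono mult_left_mono) auto
  finally have "g (n + m) * sw (A + B) (a + b) 
      \<le> g (n + m) * (\<rho> * ((\<Prod>i<n. g i) * sw z z1) + \<sigma> * ((\<Prod>i<m. g (n + i)) * sw z z2))"
    using g1[of "n+m"] by (intro mult_left_mono) auto
  also have "\<dots> = \<rho> * (((\<Prod>i<n. g i) * g (n + m)) * sw z z1) + \<sigma> * (((\<Prod>i<m. g (n + i)) * g (n + m)) * sw z z2)"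
    by (simp add: algebra_simps)
  also have "\<dots> \<le> \<rho> * (theta c M Q * sw z z1) + \<sigma> * (theta c M Q * sw z z2)"
    using sp(1,2)[where n=n and m=m] sz \<rho>\<sigma> by (intro add_mono mult_left_mono mult_right_mono) (auto simp: th)
  finally show "sw z (Phi m n lam z1 z2 Q) \<le> theta c M Q * (\<rho> * sw z z1 + \<sigma> * sw z z2)"
    using main by (simp add: algebra_simps)
qed

definition swap_sum :: "nat \<Rightarrow> nat \<Rightarrow> real \<Rightarrow> complex \<Rightarrow> complex \<Rightarrow> complex \<Rightarrow> complex \<Rightarrow> (nat \<Rightarrow> real) \<Rightarrow> real" where
  "swap_sum m n p lam z z1 z2 Q = sw z (Phi m n lam z1 z2 Q) powr (1 + p) + sw z (Phi m n lam z2 z1 Q) powr (1 + p)"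

definition swap_contracts :: "nat \<Rightarrow> nat \<Rightarrow> real \<Rightarrow> real \<Rightarrow> real \<Rightarrow> real \<Rightarrow> complex \<Rightarrow> complex \<Rightarrow> bool" where
  "swap_contracts m n p \<delta> \<kappa> C lam z \<longleftrightarrow> (\<forall>z1 z2 Q. (\<forall>i<m+n+1. \<bar>Q i\<bar> \<le> \<kappa>) \<and> 0 < Im z1 \<and> 0 < Im z2 \<longrightarrow>
     swap_sum m n p lam z z1 z2 Q \<le> (1 - \<delta>) * (sw z z1 powr (1 + p) + sw z z2 powr (1 + p)) + C)"

text \<open>No gain is claimed, but the bound holds for potentials of any size. It serves large
  potentials, and also pairs whose weights are both moderate.\<close>

lemma Phi_swap_crude:
  assumes nd: "nondeg m n c lam z" and c: "0 < c" and z1: "0 < Im z1" and z2: "0 < Im z2" and p: "0 < p"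
  shows "swap_sum m n p lam z z1 z2 Q
    \<le> theta c (m + n + 1) Q powr (1 + p) * (sw z z1 powr (1 + p) + sw z z2 powr (1 + p))"
proof -
  define \<rho> where "\<rho> = Im (phi0 n z lam) / (Im (phi0 n z lam) + Im (phi0 m z lam))"
  define \<sigma> where "\<sigma> = Im (phi0 m z lam) / (Im (phi0 n z lam) + Im (phi0 m z lam))"
  define T where "T = theta c (m + n + 1) Q"
  note w = nondeg_weights[OF nd c \<rho>_def \<sigma>_def]
  have \<rho>\<sigma>: "0 < \<rho>" "0 < \<sigma>" using w c by (smt (verit) zero_less_power)+
  have Z: "0 < Im z" "0 \<le> Im lam" using nondegD[OF nd] by auto
  have T: "1 \<le> T" unfolding T_def by (rule theta_ge_1[OF c])
  have s: "4 \<le> sw z z1" "4 \<le> sw z z2" using sw_ge_4 Z z1 z2 by auto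
  have *: "sw z (Phi m n lam x y Q) powr (1 + p) 
     \<le> T powr (1 + p) * (\<rho> * sw z x powr (1 + p) + \<sigma> * sw z y powr (1 + p))"
    if "0 < Im x" "0 < Im y" for x y
  proof -
    have sx: "4 \<le> sw z x" "4 \<le> sw z y" using that Z sw_ge_4 by auto
    have "sw z (Phi m n lam x y Q) \<le> T * (\<rho> * sw z x + \<sigma> * sw z y)"
      unfolding T_def
      by (rule Phi_weight(2)[OF nd c that, of "max (sw z x) (sw z y)"]) (auto simp: \<rho>_def \<sigma>_def)
    moreover have "4 \<le> sw z (Phi m n lam x y Q)" using that Z by (intro sw_ge_4 Phi_pos)
    ultimately have "sw z (Phi m n lam x y Q) powr (1 + p) \<le> (T * (\<rho> * sw z x + \<sigma> * sw z y)) powr (1 + p)"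
      using p by (intro powr_mono2) auto
    also have "\<dots> = T powr (1 + p) * (\<rho> * sw z x + \<sigma> * sw z y) powr (1 + p)"
      by (rule powr_mult)
    also have "\<dots> \<le> T powr (1 + p) * (\<rho> * sw z x powr (1 + p) + \<sigma> * sw z y powr (1 + p))"
      using sx \<rho>\<sigma> w p by (intro mult_left_mono powr_convex_combination) auto
    finally show ?thesis .
  qed
  have "swap_sum m n p lam z z1 z2 Q
     \<le> T powr (1 + p) * ((\<rho> + \<sigma>) * (sw z z1 powr (1 + p) + sw z z2 powr (1 + p)))"
    unfolding swap_sum_def using *[OF z1 z2] *[OF z2 z1] by (simp add: algebra_simps)
  then show ?thesis using w by (simp add: T_def)
qed

lemma Phi_swap_contraction:
  assumes c: "0 < c" and p: "0 < p"
  shows "\<exists>\<delta>>0. \<exists>\<kappa>>0. \<exists>C\<ge>0. \<delta> < 1 \<and>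
    (\<forall>lam z. nondeg m n c lam z \<and> Im lam \<le> \<kappa> \<longrightarrow> swap_contracts m n p \<delta> \<kappa> C lam z)"
proof -
  define M where "M = m + n + 1"
  \<comment> \<open>\<open>rotation_mismatch\<close> tolerates \<open>11 * t + 2 * \<tau>\<close> up
    to c^3/2000; the choices here and \<tau> = c^3/8000 share this equally. Then \<delta>1 times the
    larger weight is the threshold of \<open>weighted_pair_le_near_equality\<close> with c^2 as
    lower bound of the weights.\<close>
  define t where "t = min 1 (c ^ 3 / 44000)"
  define \<delta>1 where "\<delta>1 = (c\<^sup>2)\<^sup>2 * t\<^sup>2"
  \<comment> \<open>The gain is \<open>\<delta>1 * (c\<^sup>2) powr p / 2\<close>; half of it is
    left to the potentials, whose factor \<kappa> keeps below
    \<open>1 + \<delta>1 * (c\<^sup>2) powr p / 4\<close>.\<close>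
  define \<delta> where "\<delta> = min (1/2) (\<delta>1 * (c\<^sup>2) powr p / 4)"
  have t: "0 < t" "t \<le> 1" "t \<le> c ^ 3 / 44000" using c by (auto simp: t_def)
  have \<delta>1: "0 < \<delta>1" using c t by (simp add: \<delta>1_def)
  have \<delta>: "0 < \<delta>" "\<delta> < 1" "\<delta> \<le> \<delta>1 * (c\<^sup>2) powr p / 4" using \<delta>1 c by (auto simp: \<delta>_def)
  \<comment> \<open>The largest value of \<open>theta\<close> when all M potentials are at most
    \<kappa>. It tends to 1 with \<kappa>, and \<kappa> also bounds \<open>Im lam\<close>, so that
    the rotation errors are small as well.\<close>
  define h where "h \<kappa> = (1 + \<kappa> / c) ^ (2 * M)" for \<kappa>
  define C where "C = 2 * (2 * (4000 / c ^ 3)) powr (1 + p)"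
  have "\<forall>\<^sub>F \<kappa> in at_right 0. h \<kappa> < 1 + t \<and> ((h \<kappa>)\<^sup>2) powr (1 + p) < 1 + \<delta>1 * (c\<^sup>2) powr p / 4
      \<and> real M * (4 * \<kappa> / c) < c ^ 3 / 8000"
  proof (intro eventually_conj)
    have "(h \<longlongrightarrow> (1 + 0 / c) ^ (2 * M)) (at_right 0)" unfolding h_def using c by (intro tendsto_intros) auto
    then have h: "(h \<longlongrightarrow> 1) (at_right 0)" by simp
    show "\<forall>\<^sub>F \<kappa> in at_right 0. h \<kappa> < 1 + t" using h t by (intro order_tendstoD(2)[OF h]) auto
    have "((\<lambda>\<kappa>. ((h \<kappa>)\<^sup>2) powr (1 + p)) \<longlongrightarrow> (1\<^sup>2) powr (1 + p)) (at_right 0)"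
      by (intro tendsto_intros h) auto
    then show "\<forall>\<^sub>F \<kappa> in at_right 0. ((h \<kappa>)\<^sup>2) powr (1 + p) < 1 + \<delta>1 * (c\<^sup>2) powr p / 4"
      using \<delta>1 c by (intro order_tendstoD(2)) auto
    have "((\<lambda>\<kappa>. real M * (4 * \<kappa> / c)) \<longlongrightarrow> real M * (4 * 0 / c)) (at_right 0)" using c by (intro tendsto_intros) auto
    then show "\<forall>\<^sub>F \<kappa> in at_right 0. real M * (4 * \<kappa> / c) < c ^ 3 / 8000"
      using c by (intro order_tendstoD(2)) auto
  qed
  then have "\<forall>\<^sub>F \<kappa> in at_right 0. 0 < \<kappa> \<and> h \<kappa> < 1 + t \<and> ((h \<kappa>)\<^sup>2) powr (1 + p) < 1 + \<delta>1 * (c\<^sup>2) powr p / 4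
      \<and> real M * (4 * \<kappa> / c) < c ^ 3 / 8000"
    using eventually_at_right_less[of "0::real"] by eventually_elim auto
  then obtain \<kappa> where \<kappa>: "0 < \<kappa>" "h \<kappa> < 1 + t" "((h \<kappa>)\<^sup>2) powr (1 + p) < 1 + \<delta>1 * (c\<^sup>2) powr p / 4"
      "real M * (4 * \<kappa> / c) < c ^ 3 / 8000"
    using eventually_happens'[of "at_right (0::real)"] by (auto simp: trivial_limit_at_right_real)
  have main: "swap_sum m n p lam z z1 z2 Q
       \<le> (1 - \<delta>) * (sw z z1 powr (1 + p) + sw z z2 powr (1 + p)) + C"
    if nd: "nondeg m n c lam z" and il: "Im lam \<le> \<kappa>" and Q: "\<forall>i<M. \<bar>Q i\<bar> \<le> \<kappa>"
      and z1: "0 < Im z1" and z2: "0 < Im z2" for lam z z1 z2 Q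
  proof -
    note D = nondegD[OF nd]
    define V1 V2 where "V1 = sw z z1" and "V2 = sw z z2"
    define K where "K = max V1 V2"
    have V: "4 \<le> V1" "4 \<le> V2" unfolding V1_def V2_def using sw_ge_4 D z1 z2 by auto
    have K: "V1 \<le> K" "V2 \<le> K" "0 < K" using V by (auto simp: K_def)
    define T where "T = theta c M Q"
    have T1: "1 \<le> T" unfolding T_def by (rule theta_ge_1[OF c])
    have Th: "T \<le> h \<kappa>"
    proof -
      have "T \<le> (\<Prod>i<M. (1 + \<kappa> / c)\<^sup>2)" unfolding T_def theta_def
        using Q c by (intro prod_mono) (auto intro!: power_mono divide_right_mono)
      also have "\<dots> = h \<kappa>" by (simp add: h_def power_mult)
      finally show ?thesis .
    qed
    have T2: "T \<le> 1 + t" using Th \<kappa> by simp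
    have T3: "(T\<^sup>2) powr (1 + p) \<le> 1 + \<delta>1 * (c\<^sup>2) powr p / 4"
    proof -
      have "(T\<^sup>2) powr (1 + p) \<le> ((h \<kappa>)\<^sup>2) powr (1 + p)"
        using T1 Th p by (intro powr_mono2 power_mono) auto
      then show ?thesis using \<kappa> by simp
    qed
    show ?thesis
    \<comment> \<open>Below the size required by \<open>rotation_mismatch\<close> no gain is
      available, but there the crude bound with \<open>theta\<close> at most 2 is a constant,
      absorbed in C.\<close>
    proof (cases "K < 4000 / c ^ 3")
      case True
      have T2': "T powr (1 + p) \<le> 2 powr (1 + p)" using T1 T2 t p by (intro powr_mono2) auto
      have "swap_sum m n p lam z z1 z2 Q
         \<le> T powr (1 + p) * (V1 powr (1 + p) + V2 powr (1 + p))"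
        unfolding T_def V1_def V2_def M_def by (rule Phi_swap_crude[OF nd c z1 z2 p])
      also have "\<dots> \<le> 2 powr (1 + p) * ((4000 / c ^ 3) powr (1 + p) + (4000 / c ^ 3) powr (1 + p))"
        using K True V p by (intro mult_mono[OF T2'] add_mono powr_mono2) auto
      also have "\<dots> = C" using c unfolding C_def by (subst powr_mult) auto
      also have "C \<le> (1 - \<delta>) * (V1 powr (1 + p) + V2 powr (1 + p)) + C"
        using \<delta> by (intro le_add_same_cancel2[THEN iffD2] mult_nonneg_nonneg) auto
      finally show ?thesis unfolding V1_def V2_def .
    next
      case False
      define A B where "A = phi0 n z lam" and "B = phi0 m z lam"
      define \<rho> where "\<rho> = Im A / (Im A + Im B)"
      define \<sigma> where "\<sigma> = Im B / (Im A + Im B)"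
      note w = nondeg_weights[OF nd c \<rho>_def[unfolded A_def B_def] \<sigma>_def[unfolded A_def B_def]]
      define chA chB where "chA x = chain x Q lam n" and "chB x = chain x (\<lambda>i. Q (n + i)) lam m" for x
      define W where "W x y = cmod (sw A (chA x) * (1 - cay A (chA x)) - sw B (chB y) * (1 - cay B (chB y)))" for x y
      \<comment> \<open>The whole loss against T^2 times the average of the initial weights: the
        slack of the chain estimates counts along with the defect, because the gain is measured by
        the weights before the chains.\<close>
      define G where "G x y = T * (\<rho> * (T * sw z x - sw A (chA x)) + \<sigma> * (T * sw z y - sw B (chB y)) + \<rho> * \<sigma> / (4 * (T * K)) * (W x y)\<^sup>2)" for x y
      have pw: "sw z (Phi m n lam x y Q) \<le> T\<^sup>2 * (\<rho> * sw z x + \<sigma> * sw z y) - G x y"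
        "sw A (chA x) \<le> T * sw z x" "sw B (chB y) \<le> T * sw z y" "0 < Im A" "0 < Im B" "0 < Im (chA x)" "0 < Im (chB y)"
        if "0 < Im x" "0 < Im y" "sw z x \<le> K" "sw z y \<le> K" for x y
      proof -
        note P = Phi_weight[OF nd c that M_def A_def B_def chA_def chB_def \<rho>_def \<sigma>_def, folded T_def, folded W_def]
        show "sw z (Phi m n lam x y Q) \<le> T\<^sup>2 * (\<rho> * sw z x + \<sigma> * sw z y) - G x y"
          using P(1) unfolding G_def by (simp add: power2_eq_square algebra_simps)
      qed (use Phi_weight[OF nd c that M_def A_def B_def chA_def chB_def \<rho>_def \<sigma>_def, folded T_def] in auto)
      have zz: "sw z z1 \<le> K" "sw z z2 \<le> K" using K by (auto simp: V1_def V2_def)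
      note p12 = pw[OF z1 z2 zz] and p21 = pw[OF z2 z1 zz(2,1)]
      have G0: "0 \<le> G x y" if "0 < Im x" "0 < Im y" "sw z x \<le> K" "sw z y \<le> K" for x y
        unfolding G_def using pw[OF that] T1 K w c by (intro mult_nonneg_nonneg add_nonneg_nonneg divide_nonneg_nonneg) 
          (auto intro: order_trans[OF zero_le_power2])
      define \<mu> \<nu> where "\<mu> = turn z lam n" and "\<nu> = turn z lam m"
      have tau: "cmod (cay A (chA x) - \<mu> * cay z x) \<le> c ^ 3 / 8000" "cmod (cay B (chB x) - \<nu> * cay z x) \<le> c ^ 3 / 8000"
        if "0 < Im x" for x
      proof -
        have *: "(\<Sum>i<j. 2 * (\<bar>f i\<bar> + Im lam) / c) \<le> c ^ 3 / 8000" if "j \<le> M" "\<forall>i<j. \<bar>f i\<bar> \<le> \<kappa>" for j f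
        proof -
          have "(\<Sum>i<j. 2 * (\<bar>f i\<bar> + Im lam) / c) \<le> (\<Sum>i<j. 4 * \<kappa> / c)"
            using that il c by (intro sum_mono divide_right_mono) auto
          also have "\<dots> = real j * (4 * \<kappa> / c)" by simp
          also have "\<dots> \<le> real M * (4 * \<kappa> / c)" using that \<kappa> c by (intro mult_right_mono) auto
          finally show ?thesis using \<kappa> by simp
        qed
        have "cmod (cay A (chA x) - \<mu> * cay z x) \<le> (\<Sum>i<n. 2 * (\<bar>Q i\<bar> + Im lam) / c)"
          unfolding A_def chA_def \<mu>_def using that D c by (intro chain_weight(2)) auto
        also have "\<dots> \<le> c ^ 3 / 8000" using Q by (intro *) (auto simp: M_def)
        finally show "cmod (cay A (chA x) - \<mu> * cay z x) \<le> c ^ 3 / 8000" .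
        have "cmod (cay B (chB x) - \<nu> * cay z x) \<le> (\<Sum>i<m. 2 * (\<bar>Q (n + i)\<bar> + Im lam) / c)"
          unfolding B_def chB_def \<nu>_def using that D c by (intro chain_weight(2)) auto
        also have "\<dots> \<le> c ^ 3 / 8000" using Q by (intro *) (auto simp: M_def)
        finally show "cmod (cay B (chB x) - \<nu> * cay z x) \<le> c ^ 3 / 8000" .
      qed
      have near: "cmod (sw z x * (1 - cay A (chA x)) - sw z y * (1 - cay B (chB y))) \<le> 11 * t * K"
        if xy: "0 < Im x" "0 < Im y" "sw z x \<le> K" "sw z y \<le> K" and sm: "G x y < \<delta>1 * K" for x y
        by (rule weighted_pair_le_near_equality[of "c\<^sup>2" \<rho> \<sigma> T t K _ _ "sw A (chA x)" "sw B (chB y)"])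
           (use pw[OF xy] c w T1 T2 t K xy sm cmod_cay_le_1 sw_ge_4[of z x] sw_ge_4[of z y] D
            in \<open>auto simp: G_def W_def \<delta>1_def\<close>)
      \<comment> \<open>If both orders lost little, both near-equalities would hold for the same
        pair, against the rotation mismatch. Nothing decides which order gains, hence the
        disjunction.\<close>
      have gain: "\<delta>1 * K \<le> G z1 z2 \<or> \<delta>1 * K \<le> G z2 z1"
      proof (rule ccontr)
        assume "\<not> ?thesis"
        then have sm: "G z1 z2 < \<delta>1 * K" "G z2 z1 < \<delta>1 * K" by auto
        note n1 = near[OF z1 z2 zz sm(1)] and n2 = near[OF z2 z1 zz(2,1) sm(2)]
        show False
          by (rule rotation_mismatch[of \<mu> \<nu> c V1 V2 "cay z z1" "cay z z2" "11 * t" "c ^ 3 / 8000"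
                "cay A (chA z1)" "cay A (chA z2)" "cay B (chB z1)" "cay B (chB z2)"])
             (use n1 n2 False V D c t z1 z2 tau cmod_cay_le_1 cmod_cay cmod_turn in 
               \<open>auto simp: \<mu>_def \<nu>_def K_def V1_def V2_def\<close>)
      qed
      have "swap_sum m n p lam z z1 z2 Q
         \<le> ((T\<^sup>2) powr (1 + p) - \<delta>1 * (c\<^sup>2) powr p / 2) * (V1 powr (1 + p) + V2 powr (1 + p))"
        unfolding swap_sum_def
      proof (rule swapped_pair_contraction[OF _ w p])
        show "sw z (Phi m n lam z1 z2 Q) \<le> T\<^sup>2 * (\<rho> * V1 + \<sigma> * V2) - G z1 z2" using p12 by (simp add: V1_def V2_def)
        show "sw z (Phi m n lam z2 z1 Q) \<le> T\<^sup>2 * (\<rho> * V2 + \<sigma> * V1) - G z2 z1" using p21 by (simp add: V1_def V2_def)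
        show "\<delta>1 * max V1 V2 \<le> G z1 z2 \<or> \<delta>1 * max V1 V2 \<le> G z2 z1" using gain by (simp add: K_def)
        show "0 \<le> G z1 z2" "0 \<le> G z2 z1" using G0 z1 z2 zz by auto
        show "0 \<le> sw z (Phi m n lam z1 z2 Q)" "0 \<le> sw z (Phi m n lam z2 z1 Q)"
          using sw_ge_4[OF D(1) Phi_pos] z1 z2 D(2) by (smt (verit))+
      qed (use c V T1 \<delta>1 in auto)
      also have "\<dots> \<le> (1 - \<delta>) * (V1 powr (1 + p) + V2 powr (1 + p))"
        using T3 \<delta> by (intro mult_right_mono) auto
      also have "\<dots> \<le> (1 - \<delta>) * (V1 powr (1 + p) + V2 powr (1 + p)) + C" by (simp add: C_def)
      finally show ?thesis unfolding V1_def V2_def .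
    qed
  qed
  show ?thesis
    by (rule exI[of _ \<delta>], intro conjI \<delta>(1), rule exI[of _ \<kappa>], intro conjI \<kappa>(1), rule exI[of _ C])
       (use main \<delta> in \<open>auto simp: C_def M_def swap_contracts_def\<close>)
qed

section \<open>Chebyshev polynomials and resonances\<close>

text \<open>This is U_(j-1)(x/2), the Chebyshev polynomial of the second kind: sin(j a)/sin a at x =
  2 cos a. It gives the entries of powers of the transfer matrix of one free chain step, with x =
  lam + 1.\<close>

fun cheb :: "nat \<Rightarrow> 'a::comm_ring_1 \<Rightarrow> 'a" where
  "cheb 0 x = 0"
| "cheb (Suc 0) x = 1"
| "cheb (Suc (Suc j)) x = x * cheb (Suc j) x - cheb j x"

fun cheb_poly :: "nat \<Rightarrow> real poly" where
  "cheb_poly 0 = 0"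
| "cheb_poly (Suc 0) = 1"
| "cheb_poly (Suc (Suc j)) = [:0, 1:] * cheb_poly (Suc j) - cheb_poly j"

lemma poly_cheb_poly: "poly (cheb_poly j) x = cheb j x"
  by (induction j rule: cheb_poly.induct) auto

lemma cheb_of_real: "cheb j (of_real x :: 'a :: {comm_ring_1, real_algebra_1}) = of_real (cheb j x)"
  by (induction j rule: cheb_poly.induct) auto

text \<open>x = 2 serves as the test point for nonvanishing: there the polynomial conditions become
  arithmetic in m, n and r.\<close>

lemma cheb_2: "cheb j (2::real) = real j"
  by (induction j rule: cheb_poly.induct) auto

text \<open>The determinant of a power of the unimodular transfer matrix.\<close>

lemma cheb_invariant: "(cheb (Suc j) x)\<^sup>2 - x * cheb j x * cheb (Suc j) x + (cheb j x)\<^sup>2 = 1"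
  by (induction j) (auto simp: power2_eq_square algebra_simps)

lemma continuous_on_cheb: "continuous_on S (cheb j :: 'a :: real_normed_field \<Rightarrow> 'a)"
proof (induction j rule: cheb_poly.induct)
  case 1
  have "cheb 0 = (\<lambda>x::'a. 0)" by auto
  then show ?case by simp
next
  case 2
  have "cheb (Suc 0) = (\<lambda>x::'a. 1)" by auto
  then show ?case by simp
next
  case (3 j)
  have "cheb (Suc (Suc j)) = (\<lambda>x::'a. x * cheb (Suc j) x - cheb j x)" by auto
  then show ?case using 3 by (auto intro!: continuous_intros)
qed

section \<open>Chain denominators and the cubic fixed point equation\<close>

definition cheb_den :: "nat \<Rightarrow> complex \<Rightarrow> complex \<Rightarrow> complex" where
  "cheb_den j z lam = cheb j (lam + 1) * z + cheb (Suc j) (lam + 1)"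

lemma cheb_den_0: "cheb_den 0 z lam = 1"
  by (simp add: cheb_den_def)

lemma cheb_den_rec: "cheb_den (Suc (Suc j)) z lam = (lam + 1) * cheb_den (Suc j) z lam - cheb_den j z lam"
  by (simp add: cheb_den_def algebra_simps)

lemma phi0_pos: "0 < Im z \<Longrightarrow> 0 \<le> Im lam \<Longrightarrow> 0 < Im (phi0 j z lam)"
  unfolding phi0_eq_chain by (rule chain_pos)

text \<open>Free chains are Moebius maps of z, and \<open>cheb_den j\<close> is the denominator
  after j steps; the numerator after j + 1 steps is \<open>- cheb_den j\<close>. Both sides thus
  express the same ratio of consecutive denominators.\<close>

lemma cheb_den_Suc:
  assumes "\<And>i. i \<le> j \<Longrightarrow> phi0 i z lam + lam + 1 \<noteq> 0"
  shows "cheb_den (Suc j) z lam = cheb_den j z lam * (phi0 j z lam + lam + 1)"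
  using assms
proof (induction j)
  case 0 show ?case by (simp add: cheb_den_def algebra_simps)
next
  case (Suc j)
  have "cheb_den (Suc (Suc j)) z lam = (lam + 1) * cheb_den (Suc j) z lam - cheb_den j z lam"
    by (rule cheb_den_rec)
  also have "cheb_den j z lam = - cheb_den (Suc j) z lam * phi0 (Suc j) z lam"
    using Suc by simp
  finally show ?case by (simp add: algebra_simps del: phi0.simps)
qed

lemma cheb_den_eq_prod:
  assumes "\<And>i. phi0 i z lam + lam + 1 \<noteq> 0"
  shows "cheb_den j z lam = (\<Prod>i<j. phi0 i z lam + lam + 1)"
  by (induction j) (use assms in \<open>auto simp: cheb_den_0 cheb_den_Suc\<close>)

lemma phi0_denom_nz: "0 < Im z \<Longrightarrow> 0 \<le> Im lam \<Longrightarrow> phi0 i z lam + lam + 1 \<noteq> 0"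
  using phi0_pos[of z lam i] by (auto simp: complex_eq_iff)

lemma cheb_den_nz:
  assumes "0 < Im z" "0 \<le> Im lam"
  shows "cheb_den j z lam \<noteq> 0"
  using cheb_den_eq_prod[of z lam j] phi0_denom_nz[OF assms] by simp

lemma phi0_times_cheb_den:
  assumes "0 < Im z" "0 \<le> Im lam"
  shows "phi0 j z lam * cheb_den j z lam = cheb_den (Suc j) z lam - (lam + 1) * cheb_den j z lam"
  using cheb_den_Suc[of j z lam] phi0_denom_nz[OF assms] by (simp add: algebra_simps)

text \<open>Each chain denominator is linear in z, so clearing the two of them leaves an equation of
  degree at most 3 however long the chains are. Here x stands for lam + 1; the ring is generic so
  that the leading coefficient can be taken at complex energies for limits and at real ones for
  counting zeros.\<close>

definition fix_coeff3 :: "nat \<Rightarrow> nat \<Rightarrow> 'a \<Rightarrow> 'a::comm_ring_1" where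
  "fix_coeff3 m n x = cheb (Suc n) x * cheb m x + cheb (Suc m) x * cheb n x - (x + 1) * (cheb n x * cheb m x)"
definition fix_coeff2 :: "nat \<Rightarrow> nat \<Rightarrow> 'a \<Rightarrow> 'a::comm_ring_1" where
  "fix_coeff2 m n x = 2 * cheb (Suc n) x * cheb (Suc m) x + cheb (Suc (Suc n)) x * cheb m x + cheb (Suc (Suc m)) x * cheb n x
     - (x + 1) * (cheb n x * cheb (Suc m) x + cheb (Suc n) x * cheb m x) + cheb n x * cheb m x"
definition fix_coeff1 :: "nat \<Rightarrow> nat \<Rightarrow> 'a \<Rightarrow> 'a::comm_ring_1" where
  "fix_coeff1 m n x = cheb (Suc (Suc n)) x * cheb (Suc m) x + cheb (Suc (Suc m)) x * cheb (Suc n) x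
     - (x + 1) * (cheb (Suc n) x * cheb (Suc m) x) + cheb n x * cheb (Suc m) x + cheb (Suc n) x * cheb m x"
definition fix_coeff0 :: "nat \<Rightarrow> nat \<Rightarrow> 'a \<Rightarrow> 'a::comm_ring_1" where
  "fix_coeff0 m n x = cheb (Suc n) x * cheb (Suc m) x"

definition fix_cubic :: "nat \<Rightarrow> nat \<Rightarrow> complex \<Rightarrow> complex \<Rightarrow> complex" where
  "fix_cubic m n x z = fix_coeff3 m n x * z ^ 3 + fix_coeff2 m n x * z ^ 2 + fix_coeff1 m n x * z + fix_coeff0 m n x"

lemma fixed_point_cubic:
  assumes z: "0 < Im z" and lam: "0 \<le> Im lam" and fp: "phiz m n z lam = z"
  shows "fix_cubic m n (lam + 1) z = 0"
proof -
  define N M where "N = cheb_den n z lam" and "M = cheb_den m z lam"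
  have nz: "N \<noteq> 0" "M \<noteq> 0" "z \<noteq> 0" using cheb_den_nz z lam by (auto simp: N_def M_def)
  define w where "w = phi0 n z lam + phi0 m z lam + lam"
  have "0 < Im w" unfolding w_def using phi0_pos[OF z lam, of n] phi0_pos[OF z lam, of m] lam by simp
  then have "w \<noteq> 0" by force
  moreover have "z = -1 / w" using fp by (simp add: phiz_def w_def)
  ultimately have "z * w + 1 = 0" by simp
  then have "0 = (z * w + 1) * (N * M)" by simp
  also have "\<dots> = z * ((phi0 n z lam * N) * M + (phi0 m z lam * M) * N + lam * (N * M)) + N * M"
    by (simp add: w_def algebra_simps)
  also have "\<dots> = z * ((cheb_den (Suc n) z lam - (lam + 1) * N) * M + (cheb_den (Suc m) z lam - (lam + 1) * M) * N + lam * (N * M)) + N * M"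
    using phi0_times_cheb_den[OF z lam] by (simp add: N_def M_def)
  also have "\<dots> = fix_cubic m n (lam + 1) z"
    unfolding fix_cubic_def N_def M_def cheb_den_def fix_coeff3_def fix_coeff2_def fix_coeff1_def fix_coeff0_def
    by (simp add: power3_eq_cube power2_eq_square algebra_simps)
  finally show ?thesis by simp
qed

section \<open>Accumulated rotations at real energies\<close>

lemma phi0_add: "phi0 (i + j) z lam = phi0 j (phi0 i z lam) lam"
  by (induction j) auto

lemma turn_add: "turn z lam (i + j) = turn z lam i * turn (phi0 i z lam) lam j"
  unfolding turn_def
  by (induction j) (auto simp: phi0_add[symmetric] mult.assoc simp del: phi0.simps)

text \<open>The denominators of the single steps multiply to \<open>cheb_den\<close>, so the
  accumulated rotation is the phase of one function linear in z.\<close>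

lemma turn_eq_cheb_den:
  assumes "0 < Im z" "0 \<le> Im lam"
  shows "turn z lam j = cnj (cheb_den j z lam) / cheb_den j z lam"
proof -
  have "cheb_den j z lam = (\<Prod>i<j. phi0 i z lam + lam + 1)"
    using phi0_denom_nz[OF assms] by (rule cheb_den_eq_prod)
  moreover have "phi0 (Suc i) z lam / cnj (phi0 (Suc i) z lam) = cnj (phi0 i z lam + lam + 1) / (phi0 i z lam + lam + 1)" for i
    unfolding cnj_neg_inverse_ratio[OF phi0_denom_nz[OF assms]] by simp
  ultimately show ?thesis unfolding turn_def by (simp add: prod_dividef del: complex_cnj_add phi0.simps)
qed

text \<open>The outer factor \<open>cheb r x\<close> absorbs the case in which it vanishes and the
  elimination, which cancels it, is impossible. With m the shorter chain, r is the difference of the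
  two lengths.\<close>

definition resonance :: "nat \<Rightarrow> nat \<Rightarrow> 'a \<Rightarrow> 'a::comm_ring_1" where
  "resonance m r x = cheb r x * ((cheb (Suc r) x + cheb r x) *
     (cheb r x * cheb (Suc r) x * (cheb m x + cheb (Suc m) x) - cheb (Suc m) x
       + (cheb r x)\<^sup>2 * (cheb (Suc m) x - (x + 1) * cheb m x))
     + (cheb (Suc m) x * cheb (Suc r) x - cheb m x * cheb r x))"

text \<open>If the two accumulated rotations agree up to sign, then \<open>cheb_den r B\<close> is purely imaginary;
  the real and imaginary parts of the fixed point equation are then two polynomial equations for
  \<open>(cheb r x * Im B)\<^sup>2\<close>, and eliminating this unknown leaves the resonance polynomial.\<close>
lemma turn_eq_imp_resonance:
  assumes z: "0 < Im z" and fp: "phiz m (m + r) z (of_real t) = z"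
    and eq: "(turn z (of_real t) (m + r))\<^sup>2 = (turn z (of_real t) m)\<^sup>2"
  shows "resonance m r (t + 1) = 0"
proof (cases "cheb r (t + 1) = 0")
  case True then show ?thesis by (simp add: resonance_def)
next
  case False
  define x where "x = t + 1"
  define sr where "sr = cheb r x"
  define sr1 where "sr1 = cheb (Suc r) x"
  define sm where "sm = cheb m x"
  define sj where "sj = cheb (Suc m) x"
  have srnz: "sr \<noteq> 0" using False by (simp add: sr_def x_def)
  define B where "B = phi0 m z t"
  define A where "A = phi0 (m + r) z t"
  have B: "0 < Im B" unfolding B_def by (rule phi0_pos) (use z in auto)
  have cx: "cheb j (complex_of_real t + 1) = of_real (cheb j x)" for j
    using cheb_of_real[of j x, where 'a=complex] by (simp add: x_def)
  define D where "D = cheb_den r B t"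
  have D: "D = of_real sr * B + of_real sr1"
    by (simp add: D_def cheb_den_def cx sr_def sr1_def del: cheb.simps)
  have Dnz: "D \<noteq> 0" unfolding D_def by (rule cheb_den_nz) (use B in auto)
  have tB: "turn B t r = cnj D / D" unfolding D_def by (rule turn_eq_cheb_den) (use B in auto)
  have "turn z t m \<noteq> 0" using cmod_turn[of z t m] z by auto
  \<comment> \<open>The rotation of the common m steps cancels, leaving that of the r extra steps
    started at B. Its square being 1, D is real or imaginary, and \<open>Im D\<close> is a nonzero
    multiple of \<open>Im B\<close>.\<close>
  then have "(turn B t r)\<^sup>2 = 1" using eq unfolding turn_add B_def[symmetric] by (simp add: power_mult_distrib)
  then have "(cnj D)\<^sup>2 = D\<^sup>2" using Dnz by (simp add: tB power_divide)
  then have "Re D * Im D = 0" by (auto simp: complex_eq_iff power2_eq_square)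
  then have ReD: "sr * Re B + sr1 = 0" using B srnz by (simp add: D)
  define \<tau> where "\<tau> = Im B"
  have \<tau>: "0 < \<tau>" using B by (simp add: \<tau>_def)
  have AD: "A * D = cheb_den (Suc r) B t - (t + 1) * D"
    using phi0_times_cheb_den[of B t r] B by (simp add: A_def phi0_add B_def[symmetric] D_def)
  have cd: "cheb_den (Suc r) B t = of_real sr1 * B + (of_real x * of_real sr1 - of_real sr)"
    unfolding cheb_den_def cx by (simp add: sr_def sr1_def)
  have AD': "A * D = of_real (sr1 - x * sr) * B - of_real sr"
  proof -
    have "A * D = of_real sr1 * B + (of_real x * of_real sr1 - of_real sr) - of_real x * D"
      using AD unfolding cd by (simp add: x_def)
    also have "\<dots> = of_real (sr1 - x * sr) * B - of_real sr" unfolding D by (simp add: algebra_simps)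
    finally show ?thesis .
  qed
  have Dim: "D = \<i> * of_real (sr * \<tau>)" using ReD by (simp add: complex_eq_iff D \<tau>_def)
  have eqs: "sr * \<tau> * Re A = (sr1 - x * sr) * \<tau>" "- (sr * \<tau>) * Im A = (sr1 - x * sr) * Re B - sr"
    using arg_cong[OF AD', of Im] arg_cong[OF AD', of Re] by (simp_all add: Dim \<tau>_def mult_ac)
  have ReA: "sr * Re A = sr1 - x * sr" using eqs(1) \<tau> by simp
  have ReAB: "Re A + Re B = - x"
  proof -
    have "sr * (Re A + Re B) = sr * (- x)" using ReA ReD by (simp add: algebra_simps)
    then show ?thesis using mult_left_cancel[OF srnz] by blast
  qed
  have ImA: "sr\<^sup>2 * \<tau> * Im A = 1"
  proof -
    have "sr\<^sup>2 * \<tau> * Im A = - sr * (- (sr * \<tau>) * Im A)" by (simp add: power2_eq_square)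
    also have "\<dots> = - (sr1 - x * sr) * (sr * Re B) + sr\<^sup>2" unfolding eqs(2) by (simp add: power2_eq_square algebra_simps)
    also have "sr * Re B = - sr1" using ReD by simp
    also have "- (sr1 - x * sr) * (- sr1) + sr\<^sup>2 = 1"
      using cheb_invariant[of r x] by (simp add: sr_def sr1_def power2_eq_square algebra_simps)
    finally show ?thesis .
  qed
  \<comment> \<open>Joining at the principal vertex lacks the 1 that a chain step adds; with it
    subtracted, the join is one more chain step from y. So B is reached from y by m + 1 steps, an
    equation in A and B alone.\<close>
  define y where "y = A + B - 1"
  have y: "0 < Im y" unfolding y_def A_def B_def using phi0_pos[of z t] z by (simp add: add_pos_pos)
  have "z = -1 / (A + B + t)" using fp by (simp add: phiz_def A_def B_def)
  then have "z = phi0 1 y t" by (simp add: y_def)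
  then have "B = phi0 (Suc m) y t" using phi0_add[of 1 m y t] by (simp add: B_def)
  then have "B * cheb_den (Suc m) y t = cheb_den (Suc (Suc m)) y t - (t + 1) * cheb_den (Suc m) y t"
    using phi0_times_cheb_den[of y t "Suc m"] y by simp
  also have "\<dots> = - cheb_den m y t" unfolding cheb_den_rec by simp
  finally have E: "B * cheb_den (Suc m) y t + cheb_den m y t = 0" by simp
  have dm: "cheb_den m y t = of_real sm * y + of_real sj" by (simp add: cheb_den_def cx sm_def sj_def del: cheb.simps)
  have dj: "cheb_den (Suc m) y t = of_real sj * y + of_real (x * sj - sm)"
    unfolding cheb_den_def cx by (simp add: sm_def sj_def)
  define Y where "Y = Im y"
  have Re_y: "Re y = - x - 1" using ReAB by (simp add: y_def)
  have Im_y: "Y = Im A + \<tau>" by (simp add: Y_def y_def \<tau>_def)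
  have YT: "sr\<^sup>2 * \<tau> * Y = 1 + (sr * \<tau>)\<^sup>2" using ImA unfolding Im_y by (simp add: power2_eq_square algebra_simps)
  define u where "u = sm + sj"
  have dj': "cheb_den (Suc m) y t = Complex (- u) (sj * Y)" 
    unfolding dj by (simp add: complex_eq_iff Re_y Y_def u_def algebra_simps)
  have dm': "cheb_den m y t = Complex (sj - (x + 1) * sm) (sm * Y)"
    unfolding dm by (simp add: complex_eq_iff Re_y Y_def algebra_simps)
  have E1: "- Re B * u - \<tau> * sj * Y + (sj - (x + 1) * sm) = 0"
    using arg_cong[OF E, of Re] unfolding dj' dm' by (simp add: \<tau>_def algebra_simps)
  have E2: "Re B * sj * Y - \<tau> * u + sm * Y = 0"
    using arg_cong[OF E, of Im] unfolding dj' dm' by (simp add: \<tau>_def algebra_simps)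
  define T where "T = (sr * \<tau>)\<^sup>2"
  have Bs: "sr * Re B = - sr1" using ReD by simp
  have F2: "(sm * sr - sr1 * sj) * (1 + T) = T * u * sr"
  proof -
    have "0 = sr * (sr\<^sup>2 * \<tau>) * (Re B * sj * Y - \<tau> * u + sm * Y)" using E2 by simp
    also have "\<dots> = ((sr * Re B) * sj + sm * sr) * (sr\<^sup>2 * \<tau> * Y) - sr * u * (sr * \<tau>)\<^sup>2"
      by (simp add: power2_eq_square algebra_simps)
    finally show ?thesis unfolding YT Bs T_def by (simp add: algebra_simps)
  qed
  have F1: "sr * sr1 * u - sj * (1 + T) + sr\<^sup>2 * (sj - (x + 1) * sm) = 0"
  proof -
    have "0 = sr\<^sup>2 * (- Re B * u - \<tau> * sj * Y + (sj - (x + 1) * sm))" using E1 by simp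
    also have "\<dots> = - sr * (sr * Re B) * u - sj * (sr\<^sup>2 * \<tau> * Y) + sr\<^sup>2 * (sj - (x + 1) * sm)"
      by (simp add: power2_eq_square algebra_simps)
    finally show ?thesis unfolding YT Bs T_def by (simp add: algebra_simps)
  qed
  \<comment> \<open>In F2 the terms \<open>T * sm * sr\<close> cancel. Since F1 contains T only
    through \<open>sj * T\<close>, multiplying F1 by \<open>sr1 + sr\<close> and inserting this
    eliminates T without dividing by a quantity that might vanish.\<close>
  have TT: "sj * T * (sr1 + sr) = - (sj * sr1 - sm * sr)"
    using F2 by (simp add: u_def algebra_simps)
  have "0 = (sr1 + sr) * (sr * sr1 * u - sj * (1 + T) + sr\<^sup>2 * (sj - (x + 1) * sm))" using F1 by simp
  also have "\<dots> = (sr1 + sr) * (sr * sr1 * u - sj + sr\<^sup>2 * (sj - (x + 1) * sm)) - sj * T * (sr1 + sr)"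
    by (simp add: algebra_simps)
  finally have "(sr1 + sr) * (sr * sr1 * u - sj + sr\<^sup>2 * (sj - (x + 1) * sm)) + (sj * sr1 - sm * sr) = 0"
    unfolding TT by simp
  then show ?thesis unfolding resonance_def x_def[symmetric] sr_def[symmetric] sr1_def[symmetric] sm_def[symmetric] sj_def[symmetric] u_def[symmetric]
    by simp
qed

section \<open>Finiteness of the exceptional energies\<close>

lemma finite_poly_shift_roots:
  fixes P :: "real poly"
  assumes "poly P 2 \<noteq> 0"
  shows "finite {t. poly P (t + 1) = 0}"
proof -
  have "P \<noteq> 0" using assms by auto
  then have "finite {x. poly P x = 0}" by (rule poly_roots_finite)
  then have "finite ((\<lambda>x. x - 1) ` {x. poly P x = 0})" by simp
  moreover have "{t. poly P (t + 1) = 0} \<subseteq> (\<lambda>x. x - 1) ` {x. poly P x = 0}"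
    by (auto intro!: image_eqI[of _ _ "_ + 1"])
  ultimately show ?thesis by (rule finite_subset[rotated])
qed

lemma finite_fix_coeff3_roots:
  assumes "m \<noteq> n"
  shows "finite {t::real. fix_coeff3 m n (t + 1) = 0}"
proof -
  define P where "P = cheb_poly (Suc n) * cheb_poly m + cheb_poly (Suc m) * cheb_poly n - [:1, 1:] * (cheb_poly n * cheb_poly m)"
  have P: "poly P x = fix_coeff3 m n x" for x
    by (simp add: P_def poly_cheb_poly fix_coeff3_def algebra_simps del: cheb_poly.simps cheb.simps)
  have "fix_coeff3 m n (2::real) = real m + real n - real m * real n"
    unfolding fix_coeff3_def cheb_2 by (simp add: algebra_simps)
  also have "\<dots> \<noteq> 0"
  proof
    assume "real m + real n - real m * real n = 0"
    then have "m + n = m * n" by (simp flip: of_nat_add of_nat_mult)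
    \<comment> \<open>Each of m, n divides the product and one summand, hence also the other
      summand.\<close>
    then have "m dvd n" "n dvd m" 
      by (metis dvd_add_right_iff dvd_triv_left dvd_refl, metis dvd_add_left_iff dvd_triv_right dvd_refl)
    then show False using assms by (simp add: dvd_antisym)
  qed
  finally show ?thesis using finite_poly_shift_roots[of P] by (simp add: P)
qed

lemma finite_resonance_roots:
  assumes "0 < r"
  shows "finite {t::real. resonance m r (t + 1) = 0}"
proof -
  define P where "P = cheb_poly r * ((cheb_poly (Suc r) + cheb_poly r) *
     (cheb_poly r * cheb_poly (Suc r) * (cheb_poly m + cheb_poly (Suc m)) - cheb_poly (Suc m)
       + (cheb_poly r)\<^sup>2 * (cheb_poly (Suc m) - [:1, 1:] * cheb_poly m))
     + (cheb_poly (Suc m) * cheb_poly (Suc r) - cheb_poly m * cheb_poly r))"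
  have P: "poly P x = resonance m r x" for x
    by (simp add: P_def poly_cheb_poly resonance_def algebra_simps del: cheb_poly.simps cheb.simps)
  define R M where "R = real r" and "M = real m"
  have RM: "1 \<le> R" "0 \<le> M" using assms by (auto simp: R_def M_def)
  have R2: "1 < 2 * R\<^sup>2 + R" using RM one_le_power[of R 2] by linarith
  have "resonance m r (2::real) = R * ((2 * R + 1) * (2 * R\<^sup>2 + R - 1 + M * (2 * R - 1)) + M + R + 1)"
    unfolding resonance_def cheb_2 R_def[symmetric] M_def[symmetric]
    by (simp add: R_def[symmetric] M_def[symmetric] power2_eq_square algebra_simps)
  also have "\<dots> > 0"
    using RM R2 by (intro mult_pos_pos add_pos_nonneg add_nonneg_pos mult_nonneg_nonneg add_nonneg_nonneg) auto
  finally show ?thesis using finite_poly_shift_roots[of P] by (simp add: P)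
qed

section \<open>The fixed point and its boundary values\<close>

lemma bounded_sequence_limit:
  fixes f :: "nat \<Rightarrow> 'a::heine_borel"
  assumes "bounded (range f)"
    and uniq: "\<And>r l. strict_mono r \<Longrightarrow> (f \<circ> r) \<longlonglongrightarrow> l \<Longrightarrow> l = L"
  shows "f \<longlonglongrightarrow> L"
proof (rule ccontr)
  assume "\<not> f \<longlonglongrightarrow> L"
  then obtain e where e: "e > 0" "\<not> (\<forall>\<^sub>F n in sequentially. dist (f n) L < e)"
    by (auto simp: tendsto_iff)
  then have "\<exists>\<^sub>F n in sequentially. \<not> dist (f n) L < e" by (simp add: frequently_def)
  then have "infinite {n. \<not> dist (f n) L < e}"
    by (simp add: cofinite_eq_sequentially[symmetric] frequently_cofinite)
  then obtain r where r: "strict_mono (r :: nat \<Rightarrow> nat)" "\<And>n. r n \<in> {n. \<not> dist (f n) L < e}"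
    using infinite_enumerate by blast
  have "bounded (range (f \<circ> r))" using assms(1) by (rule bounded_subset) auto
  then obtain l s where s: "strict_mono s" "((f \<circ> r) \<circ> s) \<longlonglongrightarrow> l"
    using bounded_imp_convergent_subsequence by blast
  have "(f \<circ> (r \<circ> s)) \<longlonglongrightarrow> l" using s(2) by (simp add: o_assoc)
  then have "l = L" using uniq[of "r \<circ> s" l] r s by (simp add: strict_mono_o)
  then have "\<forall>\<^sub>F n in sequentially. dist ((f \<circ> r \<circ> s) n) L < e" using s(2) e by (simp add: tendsto_iff)
  then obtain n where "dist (f (r (s n))) L < e" by (auto simp: eventually_sequentially)
  then show False using r(2)[of "s n"] by simp
qed

section \<open>The fixed point at energies in the upper half plane\<close>

lemma norm_neg_inverse_le: "0 < e \<Longrightarrow> e \<le> Im w \<Longrightarrow> cmod (-1 / w) \<le> 1 / e"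
  using abs_Im_le_cmod[of w] by (simp add: norm_divide frac_le)

lemma Im_neg_inverse_nonneg: "0 \<le> Im w \<Longrightarrow> 0 \<le> Im (-1 / w)"
  unfolding Im_neg_inverse by simp

lemma phi0_nonneg:
  assumes "0 \<le> Im z" "0 < Im lam"
  shows "0 \<le> Im (phi0 j z lam)"
proof (induction j)
  case (Suc j)
  then show ?case unfolding phi0.simps using assms by (intro Im_neg_inverse_nonneg) simp
qed (use assms in simp)

lemma phi0_continuous_on:
  assumes "0 < Im lam"
  shows "continuous_on {z. 0 \<le> Im z} (\<lambda>z. phi0 j z lam)"
proof (induction j)
  case (Suc j)
  have "phi0 j z lam + lam + 1 \<noteq> 0" if "0 \<le> Im z" for z
    using phi0_nonneg[OF that assms, of j] assms by (auto simp: complex_eq_iff)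
  then show ?case unfolding phi0.simps using Suc by (intro continuous_intros) auto
qed simp

lemma phiz_bounds:
  assumes z: "0 \<le> Im z" and lam: "0 < Im lam"
  shows "cmod (phiz m n z lam) \<le> 1 / Im lam" "0 < Im (phiz m n z lam)"
proof -
  have w: "Im lam \<le> Im (phi0 n z lam + phi0 m z lam + lam)"
    using phi0_nonneg[OF assms] by (simp add: add_nonneg_nonneg)
  show "cmod (phiz m n z lam) \<le> 1 / Im lam" unfolding phiz_def by (rule norm_neg_inverse_le[OF lam w])
  show "0 < Im (phiz m n z lam)" unfolding phiz_def using w lam by (intro Im_neg_inverse_pos) linarith
qed

text \<open>\<open>Im lam\<close> bounds the denominator below on the closed half plane, so the half
  disc of radius \<open>1 / Im lam\<close> is compact, convex and invariant, and Brouwer's theorem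
  applies. Since the map sends the closed half plane into the open one, the fixed point is not
  real.\<close>

lemma fixed_point_exists:
  assumes lam: "0 < Im lam"
  obtains z where "0 < Im z" "phiz m n z lam = z"
proof -
  define S where "S = cball 0 (1 / Im lam) \<inter> {z. 0 \<le> Im z}"
  have "closed {z. 0 \<le> Im z}" by (simp add: closed_halfspace_Im_ge)
  then have "compact S" unfolding S_def by (intro compact_Int_closed compact_cball)
  moreover have "convex S" unfolding S_def by (intro convex_Int convex_cball convex_halfspace_Im_ge)
  moreover have "0 \<in> S" using lam by (simp add: S_def)
  then have "S \<noteq> {}" by blast
  moreover have "continuous_on S (\<lambda>z. phiz m n z lam)"
  proof -
    have "phi0 n z lam + phi0 m z lam + lam \<noteq> 0" if "0 \<le> Im z" for z
      using phi0_nonneg[OF that lam, of n] phi0_nonneg[OF that lam, of m] lam by (auto simp: complex_eq_iff)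
    moreover have "continuous_on S (\<lambda>z. phi0 j z lam)" for j
      by (rule continuous_on_subset[OF phi0_continuous_on[OF lam]]) (auto simp: S_def)
    ultimately show ?thesis unfolding phiz_def by (intro continuous_intros) (auto simp: S_def)
  qed
  moreover have "(\<lambda>z. phiz m n z lam) \<in> S \<rightarrow> S"
    using phiz_bounds[OF _ lam] by (auto simp: S_def intro: less_imp_le)
  ultimately obtain z where z: "z \<in> S" "phiz m n z lam = z" using brouwer by blast
  then have "0 < Im z" using phiz_bounds(2)[of z lam m n] lam by (auto simp: S_def)
  with z show ?thesis using that by blast
qed

lemma sw_translate_strict:
  assumes a: "0 < Im a" and z: "0 < Im z" and s: "0 < Im s" and ne: "z \<noteq> a"
  shows "sw (a + s) (z + s) < sw a z"
proof -
  have lt: "Im z * Im a < (Im z + Im s) * (Im a + Im s)"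
    using a z s by (intro mult_strict_mono) auto
  have "(cmod (z - a))\<^sup>2 / ((Im z + Im s) * (Im a + Im s)) < (cmod (z - a))\<^sup>2 / (Im z * Im a)"
    using lt a z ne s by (intro divide_strict_left_mono) (auto intro!: mult_pos_pos add_pos_pos)
  then show ?thesis using a z s by (subst (1 2) sw_eq_dist) auto
qed

text \<open>Chains and the weighted average do not increase \<open>sw z w\<close>, while the final
  translation by lam strictly decreases it unless the two sums \<open>a + b\<close> and
  \<open>A + B\<close> already agree.\<close>

lemma fixed_point_unique:
  assumes z: "0 < Im z" "phiz m n z lam = z" and w: "0 < Im w" "phiz m n w lam = w" and lam: "0 < Im lam"
  shows "w = z"
proof -
  define c where "c = Min ((\<lambda>i. Im (phi0 i z lam)) ` {..m+n})"
  have l0: "0 \<le> Im lam" using lam by simp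
  have c: "0 < c" unfolding c_def using phi0_pos[OF z(1) l0] by (subst Min_gr_iff) auto
  have low: "c \<le> Im (phi0 i z lam)" if "i \<le> m + n" for i unfolding c_def using that by (intro Min_le) auto
  define A B a b where "A = phi0 n z lam" and "B = phi0 m z lam" and "a = phi0 n w lam" and "b = phi0 m w lam"
  have pos: "0 < Im A" "0 < Im B" "0 < Im a" "0 < Im b"
    unfolding A_def B_def a_def b_def using phi0_pos z w l0 by auto
  have A: "sw A a \<le> sw z w" 
    using chain_weight(1)[of w z lam c n "\<lambda>_. 0"] z w l0 c low by (simp add: A_def a_def phi0_eq_chain)
  have B: "sw B b \<le> sw z w" 
    using chain_weight(1)[of w z lam c m "\<lambda>_. 0"] z w l0 c low by (simp add: B_def b_def phi0_eq_chain)
  have szw: "4 \<le> sw z w" using sw_ge_4 z w by simp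
  define \<rho> \<sigma> where "\<rho> = Im A / (Im A + Im B)" and "\<sigma> = Im B / (Im A + Im B)"
  have \<rho>\<sigma>: "0 \<le> \<rho>" "0 \<le> \<sigma>" "\<rho> + \<sigma> = 1" using pos by (auto simp: \<rho>_def \<sigma>_def add_divide_distrib[symmetric])
  have "sw (A + B) (a + b) \<le> \<rho> * sw A a + \<sigma> * sw B b - \<rho> * \<sigma> / (4 * sw z w) * (cmod (sw A a * (1 - cay A a) - sw B b * (1 - cay B b)))\<^sup>2"
    by (rule sw_add[OF pos A B \<rho>_def \<sigma>_def])
  also have "\<dots> \<le> \<rho> * sw A a + \<sigma> * sw B b" using \<rho>\<sigma> szw by simp
  also have "\<dots> \<le> \<rho> * sw z w + \<sigma> * sw z w" using A B \<rho>\<sigma> by (intro add_mono mult_left_mono) auto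
  also have "\<dots> = sw z w" using \<rho>\<sigma> by (simp add: distrib_right[symmetric])
  finally have le: "sw (A + B) (a + b) \<le> sw z w" .
  have zf: "z = -1 / (A + B + lam)" using z by (simp add: phiz_def A_def B_def)
  have wf: "w = -1 / (a + b + lam)" using w by (simp add: phiz_def a_def b_def)
  show ?thesis
  proof (cases "a + b = A + B")
    case True then show ?thesis using zf wf by simp
  next
    case False
    have "sw z w = sw (A + B + lam) (a + b + lam)"
      by (subst zf, subst wf, rule sw_inversion) (use pos lam in auto)
    also have "\<dots> < sw (A + B) (a + b)" using pos lam False by (intro sw_translate_strict) auto
    finally show ?thesis using le by simp
  qed
qed

lemma zfix:
  assumes "0 < Im lam"
  shows "0 < Im (zfix m n lam)" "phiz m n (zfix m n lam) lam = zfix m n lam"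
proof -
  obtain z where z: "0 < Im z" "phiz m n z lam = z" using fixed_point_exists[OF assms] by blast
  have "0 < Im (zfix m n lam) \<and> phiz m n (zfix m n lam) lam = zfix m n lam"
    unfolding zfix_def by (rule theI', rule ex1I[of _ z]) (use z fixed_point_unique[OF z _ _ assms] in blast)+
  then show "0 < Im (zfix m n lam)" "phiz m n (zfix m n lam) lam = zfix m n lam" by auto
qed

lemma zfix_unique: "0 < Im lam \<Longrightarrow> 0 < Im z \<Longrightarrow> phiz m n z lam = z \<Longrightarrow> zfix m n lam = z"
  using fixed_point_unique zfix by metis

lemma cmod_zfix_le: "0 < Im lam \<Longrightarrow> cmod (zfix m n lam) \<le> 1 / Im lam"
  using phiz_bounds(1)[of "zfix m n lam" lam m n] zfix[of lam m n] by simp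

lemma tendsto_phi0:
  assumes f: "(f \<longlongrightarrow> z) F" and g: "(g \<longlongrightarrow> lam) F"
    and nz: "\<And>i. i < j \<Longrightarrow> phi0 i z lam + lam + 1 \<noteq> 0"
  shows "((\<lambda>x. phi0 j (f x) (g x)) \<longlongrightarrow> phi0 j z lam) F"
  using nz
proof (induction j)
  case (Suc j)
  then show ?case unfolding phi0.simps using g by (intro tendsto_intros) auto
qed (use f in simp)

lemma tendsto_phiz:
  assumes f: "(f \<longlongrightarrow> z) F" and g: "(g \<longlongrightarrow> lam) F"
    and z: "0 < Im z \<and> 0 \<le> Im lam \<or> 0 \<le> Im z \<and> 0 < Im lam"
  shows "((\<lambda>x. phiz m n (f x) (g x)) \<longlongrightarrow> phiz m n z lam) F"
proof -
  have p: "0 \<le> Im (phi0 i z lam)" "0 < Im (phi0 i z lam) \<or> 0 < Im lam" for i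
    using z phi0_pos[of z lam i] phi0_nonneg[of z lam i] by auto
  have nz: "phi0 i z lam + lam + 1 \<noteq> 0" for i using p[of i] z by (auto simp: complex_eq_iff)
  have nz': "phi0 n z lam + phi0 m z lam + lam \<noteq> 0" using p[of n] p[of m] z by (auto simp: complex_eq_iff)
  show ?thesis unfolding phiz_def using nz' by (intro tendsto_intros tendsto_phi0 f g nz) auto
qed

text \<open>A cluster point of fixed points is a priori only in the closed half plane. It solves the
  limit equation, which puts it into the open one, and there uniqueness identifies it.\<close>

lemma continuous_on_zfix: "continuous_on {lam. 0 < Im lam} (zfix m n)"
proof -
  have "(\<lambda>k. zfix m n (X k)) \<longlonglongrightarrow> zfix m n lam" 
    if X: "X \<longlonglongrightarrow> lam" "\<And>k. 0 < Im (X k)" and lam: "0 < Im lam" for X lam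
  proof (rule bounded_sequence_limit)
    have "(\<lambda>k. 1 / Im (X k)) \<longlonglongrightarrow> 1 / Im lam" using X lam by (intro tendsto_intros) auto
    then have "bounded (range (\<lambda>k. 1 / Im (X k)))" by (rule convergent_imp_bounded)
    then obtain K where "\<And>k. norm (1 / Im (X k)) \<le> K" by (auto simp: bounded_iff)
    then have "cmod (zfix m n (X k)) \<le> K" for k using cmod_zfix_le[OF X(2)[of k], of m n] X(2)[of k]
      by (smt (verit) divide_nonneg_nonneg real_norm_def)
    then show "bounded (range (\<lambda>k. zfix m n (X k)))" by (auto simp: bounded_iff)
  next
    fix r :: "nat \<Rightarrow> nat" and l
    assume r: "strict_mono r" and l: "((\<lambda>k. zfix m n (X k)) \<circ> r) \<longlonglongrightarrow> l"
    then have l: "(\<lambda>k. zfix m n (X (r k))) \<longlonglongrightarrow> l" by (simp add: o_def)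
    have Xr: "(\<lambda>k. X (r k)) \<longlonglongrightarrow> lam" using LIMSEQ_subseq_LIMSEQ[OF X(1) r] by (simp add: o_def)
    have l0: "0 \<le> Im l" using tendsto_Im[OF l] by (rule LIMSEQ_le_const) (auto intro!: less_imp_le zfix X)
    have "(\<lambda>k. phiz m n (zfix m n (X (r k))) (X (r k))) \<longlonglongrightarrow> phiz m n l lam"
      using l0 lam by (intro tendsto_phiz l Xr) auto
    then have "(\<lambda>k. zfix m n (X (r k))) \<longlonglongrightarrow> phiz m n l lam" using zfix[OF X(2)] by simp
    then have e: "phiz m n l lam = l" using l LIMSEQ_unique by blast
    then have "0 < Im l" using phiz_bounds(2)[OF l0 lam, of m n] by simp
    then show "l = zfix m n lam" using zfix_unique[OF lam _ e] by simp
  qed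
  then show ?thesis unfolding continuous_on_sequentially by (auto simp: o_def)
qed

section \<open>Boundary values of the fixed point at real energies\<close>

lemma cubic_root_bound:
  fixes z :: complex
  assumes "c3 * z ^ 3 + c2 * z ^ 2 + c1 * z + c0 = 0" "c3 \<noteq> 0"
  shows "cmod z \<le> 1 + (cmod c2 + cmod c1 + cmod c0) / cmod c3"
proof (cases "cmod z \<le> 1")
  case True
  moreover have "0 \<le> (cmod c2 + cmod c1 + cmod c0) / cmod c3" by simp
  ultimately show ?thesis by linarith
next
  case False
  then have z: "1 < cmod z" by simp
  have "c3 * z ^ 3 = - (c2 * z ^ 2 + c1 * z + c0)" using assms(1) by (simp add: algebra_simps eq_neg_iff_add_eq_0)
  then have "cmod c3 * cmod z ^ 3 = cmod (c2 * z ^ 2 + c1 * z + c0)"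
    by (metis norm_minus_cancel norm_mult norm_power)
  also have "\<dots> \<le> cmod (c2 * z ^ 2) + cmod (c1 * z) + cmod c0"
    by (meson add_mono_thms_linordered_semiring(3) norm_triangle_ineq order_trans)
  also have "\<dots> \<le> cmod c2 * cmod z ^ 2 + cmod c1 * cmod z ^ 2 + cmod c0 * cmod z ^ 2"
  proof -
    have "cmod z * 1 \<le> cmod z * cmod z" using z by (intro mult_left_mono) auto
    then have "cmod z \<le> cmod z ^ 2" "1 \<le> cmod z ^ 2" using z by (auto simp: power2_eq_square)
    then have "cmod c1 * cmod z \<le> cmod c1 * cmod z ^ 2" "cmod c0 * 1 \<le> cmod c0 * cmod z ^ 2"
      by (intro mult_left_mono; simp)+
    then show ?thesis by (simp add: norm_mult norm_power)
  qed
  finally have "(cmod c3 * cmod z) * cmod z ^ 2 \<le> (cmod c2 + cmod c1 + cmod c0) * cmod z ^ 2"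
    by (simp add: power2_eq_square power3_eq_cube algebra_simps)
  then have "cmod c3 * cmod z \<le> cmod c2 + cmod c1 + cmod c0"
    by (rule mult_right_le_imp_le) (use z in auto)
  then have "cmod z \<le> (cmod c2 + cmod c1 + cmod c0) / cmod c3" using assms(2) by (simp add: field_simps)
  then show ?thesis by simp
qed

lemma tendsto_cheb: "(f \<longlongrightarrow> (x::complex)) F \<Longrightarrow> ((\<lambda>y. cheb j (f y)) \<longlongrightarrow> cheb j x) F"
  using continuous_on_tendsto_compose[OF continuous_on_cheb[of UNIV j]] by auto

lemma tendsto_fix_coeff:
  assumes "(f \<longlongrightarrow> (x::complex)) F"
  shows "((\<lambda>y. fix_coeff3 m n (f y)) \<longlongrightarrow> fix_coeff3 m n x) F"
    "((\<lambda>y. fix_coeff2 m n (f y)) \<longlongrightarrow> fix_coeff2 m n x) F"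
    "((\<lambda>y. fix_coeff1 m n (f y)) \<longlongrightarrow> fix_coeff1 m n x) F"
    "((\<lambda>y. fix_coeff0 m n (f y)) \<longlongrightarrow> fix_coeff0 m n x) F"
  unfolding fix_coeff3_def fix_coeff2_def fix_coeff1_def fix_coeff0_def
  by (intro tendsto_intros tendsto_cheb assms)+

lemma zfix_boundary_cluster:
  assumes X: "X \<longlonglongrightarrow> of_real t" "\<And>k. 0 < Im (X k)" and l: "(\<lambda>k. zfix m n (X k)) \<longlonglongrightarrow> l"
  shows "fix_cubic m n (of_real t + 1) l = 0"
proof -
  have X1: "(\<lambda>k. X k + 1) \<longlonglongrightarrow> of_real t + 1" using X by (intro tendsto_intros)
  have "(\<lambda>k. fix_cubic m n (X k + 1) (zfix m n (X k))) \<longlonglongrightarrow> fix_cubic m n (of_real t + 1) l"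
    unfolding fix_cubic_def by (intro tendsto_intros tendsto_fix_coeff X1 l)
  moreover have "fix_cubic m n (X k + 1) (zfix m n (X k)) = 0" for k
    using zfix[OF X(2)[of k], of m n] X(2)[of k] by (intro fixed_point_cubic) auto
  ultimately show ?thesis by (simp add: LIMSEQ_const_iff)
qed

lemma at_upper_half_plane_nontrivial: "at (complex_of_real t) within {lam. 0 < Im lam} \<noteq> bot"
proof -
  have "(\<lambda>k. complex_of_real t + \<i> * of_real (1 / Suc k)) \<longlonglongrightarrow> of_real t + \<i> * of_real 0"
    by (intro tendsto_intros LIMSEQ_Suc lim_1_over_n)
  then have "(\<lambda>k. complex_of_real t + \<i> * of_real (1 / Suc k)) \<longlonglongrightarrow> of_real t" by simp
  moreover have "complex_of_real t + \<i> * of_real (1 / Suc k) \<in> {lam. 0 < Im lam} - {of_real t}" for k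
    by (auto simp: complex_eq_iff)
  ultimately show ?thesis unfolding trivial_limit_within islimpt_sequential by metis
qed

lemma cubic_roots_finite:
  assumes "c3 \<noteq> (0::complex)"
  shows "finite {z. c3 * z ^ 3 + c2 * z ^ 2 + c1 * z + c0 = 0}"
proof -
  have "finite {z. poly [:c0, c1, c2, c3:] z = 0}" using assms by (intro poly_roots_finite) auto
  moreover have "poly [:c0, c1, c2, c3:] z = c3 * z ^ 3 + c2 * z ^ 2 + c1 * z + c0" for z
    by (simp add: power2_eq_square power3_eq_cube algebra_simps)
  ultimately show ?thesis by (simp only:)
qed

text \<open>All boundary cluster values of \<open>zfix\<close> solve one cubic equation, hence are finitely many; since the
  image of a small half disc is connected, there is only one of them.\<close>
lemma zfix_tendsto_boundary:
  assumes c3: "fix_coeff3 m n (t + 1) \<noteq> (0::real)"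
  shows "\<exists>l. (zfix m n \<longlongrightarrow> l) (at (of_real t) within {lam. 0 < Im lam})"
proof -
  define T where "T = complex_of_real t"
  define F where "F = at T within {lam. 0 < Im lam}"
  have F: "F \<noteq> bot" unfolding F_def T_def by (rule at_upper_half_plane_nontrivial)
  have c3': "fix_coeff3 m n (T + 1) \<noteq> 0"
  proof -
    have "cheb j (T + 1) = of_real (cheb j (t + 1))" for j
      using cheb_of_real[of j "t + 1", where 'a=complex] by (simp add: T_def)
    then have "fix_coeff3 m n (T + 1) = of_real (fix_coeff3 m n (t + 1))" by (simp add: fix_coeff3_def T_def)
    then show ?thesis using c3 by simp
  qed
  have lim: "((\<lambda>lam. lam + 1) \<longlongrightarrow> T + 1) F" unfolding F_def by (intro tendsto_intros)
  \<comment> \<open>The bound \<open>1 / Im lam\<close> is useless near the real axis. The root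
    bound of the cubic replaces it and is continuous as long as the leading coefficient does not
    vanish.\<close>
  define bd where "bd lam = 1 + (cmod (fix_coeff2 m n (lam + 1)) + cmod (fix_coeff1 m n (lam + 1)) + cmod (fix_coeff0 m n (lam + 1))) 
     / cmod (fix_coeff3 m n (lam + 1))" for lam
  have "(bd \<longlongrightarrow> bd T) F" unfolding bd_def using c3' by (intro tendsto_intros tendsto_fix_coeff lim) auto
  then have "\<forall>\<^sub>F lam in F. bd lam < bd T + 1" by (rule order_tendstoD) simp
  moreover have "\<forall>\<^sub>F lam in F. fix_coeff3 m n (lam + 1) \<noteq> 0"
    using tendsto_imp_eventually_ne[OF tendsto_fix_coeff(1)[OF lim] c3'] .
  moreover have "\<forall>\<^sub>F lam in F. 0 < Im lam" unfolding F_def by (auto simp: eventually_at_filter)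
  ultimately have "\<forall>\<^sub>F lam in F. cmod (zfix m n lam) \<le> bd T + 1"
  proof eventually_elim
    case (elim lam)
    have "fix_cubic m n (lam + 1) (zfix m n lam) = 0"
      using zfix[OF elim(3), of m n] elim by (intro fixed_point_cubic) auto
    from cubic_root_bound[OF this[unfolded fix_cubic_def] elim(2)] have "cmod (zfix m n lam) \<le> bd lam" by (simp add: bd_def)
    with elim show ?case by simp
  qed
  then obtain d0 where d0: "0 < d0" "\<And>lam. 0 < Im lam \<Longrightarrow> dist lam T < d0 \<Longrightarrow> cmod (zfix m n lam) \<le> bd T + 1"
    unfolding F_def eventually_at by (force simp: T_def)
  define R where "R = {z. fix_cubic m n (T + 1) z = 0}"
  have Rfin: "finite R" unfolding R_def fix_cubic_def by (rule cubic_roots_finite[OF c3'])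
  have cluster: "\<exists>r l. strict_mono (r :: nat \<Rightarrow> nat) \<and> (\<lambda>k. zfix m n (X (r k))) \<longlonglongrightarrow> l \<and> l \<in> R"
    if X: "X \<longlonglongrightarrow> T" "\<And>k. 0 < Im (X k)" "\<And>k. dist (X k) T < d0" for X
  proof -
    have "bounded (range (\<lambda>k. zfix m n (X k)))" using d0(2) X by (auto simp: bounded_iff)
    then obtain l r where r: "strict_mono (r :: nat \<Rightarrow> nat)" "((\<lambda>k. zfix m n (X k)) \<circ> r) \<longlonglongrightarrow> l"
      using bounded_imp_convergent_subsequence by blast
    have "(X \<circ> r) \<longlonglongrightarrow> of_real t" using LIMSEQ_subseq_LIMSEQ[OF X(1) r(1)] by (simp add: T_def)
    then have "l \<in> R" unfolding R_def mem_Collect_eq T_def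
      by (rule zfix_boundary_cluster) (use X r in \<open>auto simp: o_def\<close>)
    then show ?thesis using r by (auto simp: o_def)
  qed
  define X0 where "X0 k = T + \<i> * of_real (d0 / 2 / Suc k)" for k
  have X0: "X0 \<longlonglongrightarrow> T" "\<And>k. 0 < Im (X0 k)" "\<And>k. dist (X0 k) T < d0"
  proof -
    have "(\<lambda>k. T + \<i> * of_real (d0 / 2 * (1 / Suc k))) \<longlonglongrightarrow> T + \<i> * of_real (d0 / 2 * 0)"
      by (intro tendsto_intros LIMSEQ_Suc lim_1_over_n)
    then show "X0 \<longlonglongrightarrow> T" unfolding X0_def by simp
    show "0 < Im (X0 k)" for k using d0 by (simp add: X0_def T_def)
    show "dist (X0 k) T < d0" for k
    proof -
      have "X0 k - T = \<i> * of_real (d0 / 2 / Suc k)" by (simp add: X0_def)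
      then have "dist (X0 k) T = \<bar>d0 / 2 / Suc k\<bar>" 
        unfolding dist_norm by (simp only: norm_mult norm_of_real) simp
      also have "\<dots> = d0 / 2 / Suc k" using d0 by simp
      also have "\<dots> \<le> d0 / 2 / 1" using d0 by (intro divide_left_mono) auto
      also have "\<dots> < d0" using d0 by simp
      finally show ?thesis .
    qed
  qed
  from cluster[OF X0] obtain r0 l where r0: "strict_mono (r0 :: nat \<Rightarrow> nat)" and l: "(\<lambda>k. zfix m n (X0 (r0 k))) \<longlonglongrightarrow> l" "l \<in> R"
    by blast
  obtain s where s: "0 < s" "\<And>x. x \<in> R \<Longrightarrow> x \<noteq> l \<Longrightarrow> s \<le> dist l x"
    using finite_set_avoid[OF Rfin, of l] by auto
  have "(zfix m n \<longlongrightarrow> l) F"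
  proof (rule tendstoI)
    fix e0 :: real assume "0 < e0"
    \<comment> \<open>Being smaller than the distance s from l to the other roots, e gives a circle
      about l without cluster values; near T the function \<open>zfix\<close> therefore omits this
      circle.\<close>
    define e where "e = min e0 (s / 2)"
    have e: "0 < e" "e < s" "e \<le> e0" using s \<open>0 < e0\<close> by (auto simp: e_def)
    have "\<exists>d>0. d \<le> d0 \<and> (\<forall>lam. 0 < Im lam \<and> dist lam T < d \<longrightarrow> dist (zfix m n lam) l \<noteq> e)"
    proof (rule ccontr)
      assume "\<not> ?thesis"
      then have no: "\<exists>lam. 0 < Im lam \<and> dist lam T < d \<and> dist (zfix m n lam) l = e" if "0 < d" "d \<le> d0" for d
        using that by blast
      have *: "\<exists>lam. 0 < Im lam \<and> dist lam T < d0 / Suc k \<and> dist (zfix m n lam) l = e" for k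
        using d0(1) divide_left_mono[of 1 "real (Suc k)" d0] by (intro no) auto
      obtain X where X: "\<And>k. 0 < Im (X k)" "\<And>k. dist (X k) T < d0 / Suc k" "\<And>k. dist (zfix m n (X k)) l = e"
        using * by metis
      have "(\<lambda>k. d0 * (1 / Suc k)) \<longlonglongrightarrow> d0 * 0" by (intro tendsto_intros LIMSEQ_Suc lim_1_over_n)
      then have "(\<lambda>k. d0 / Suc k) \<longlonglongrightarrow> 0" by simp
      then have "(\<lambda>k. dist (X k) T) \<longlonglongrightarrow> 0"
        by (rule tendsto_sandwich[OF _ _ tendsto_const, rotated 2]) (use X(2) in \<open>auto intro!: always_eventually less_imp_le\<close>)
      then have "X \<longlonglongrightarrow> T" using tendsto_dist_iff by blast
      moreover have "dist (X k) T < d0" for k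
      proof -
        have "d0 / Suc k \<le> d0 / 1" using d0 by (intro divide_left_mono) auto
        then show ?thesis using X(2)[of k] by simp
      qed
      ultimately obtain r l' where r: "(\<lambda>k. zfix m n (X (r k))) \<longlonglongrightarrow> l'" "l' \<in> R"
        using cluster X(1) by blast
      have "(\<lambda>k. dist (zfix m n (X (r k))) l) \<longlonglongrightarrow> dist l' l" by (intro tendsto_intros r)
      then have "dist l' l = e" using X(3) by (simp add: LIMSEQ_const_iff)
      then show False using s(2)[OF r(2)] e by (auto simp: dist_commute)
    qed
    then obtain d where d: "0 < d" "\<And>lam. 0 < Im lam \<Longrightarrow> dist lam T < d \<Longrightarrow> dist (zfix m n lam) l \<noteq> e" by blast
    define D where "D = {lam. 0 < Im lam} \<inter> ball T d"
    have "convex D" unfolding D_def by (intro convex_Int convex_ball convex_halfspace_Im_gt)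
    then have "connected D" by (rule convex_connected)
    moreover have "continuous_on D (zfix m n)" by (rule continuous_on_subset[OF continuous_on_zfix]) (auto simp: D_def)
    ultimately have conn: "connected (zfix m n ` D)" by (rule connected_continuous_image[rotated])
    have sub: "zfix m n ` D \<subseteq> ball l e \<union> - cball l e"
      using d(2) by (force simp: D_def dist_commute)
    have "\<forall>\<^sub>F k in sequentially. dist (zfix m n (X0 (r0 k))) l < e" using l(1) e by (simp add: tendsto_iff)
    moreover have "\<forall>\<^sub>F k in sequentially. dist (X0 (r0 k)) T < d"
      using LIMSEQ_subseq_LIMSEQ[OF X0(1) r0] d by (simp add: tendsto_iff o_def)
    ultimately have "\<forall>\<^sub>F k in sequentially. dist (zfix m n (X0 (r0 k))) l < e \<and> dist (X0 (r0 k)) T < d"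
      by (rule eventually_conj)
    then obtain k where k: "dist (zfix m n (X0 (r0 k))) l < e" "dist (X0 (r0 k)) T < d" by (auto simp: eventually_sequentially)
    then have "X0 (r0 k) \<in> D" using X0 by (auto simp: D_def dist_commute)
    then have ne: "ball l e \<inter> zfix m n ` D \<noteq> {}" using k by (auto simp: dist_commute)
    have "- cball l e \<inter> zfix m n ` D = {}"
      using connectedD[OF conn, of "ball l e" "- cball l e"] sub ne
      by (simp add: open_Compl) (use ball_subset_cball[of l e] in blast)
    then have "dist (zfix m n lam) l < e0" if "0 < Im lam" "dist lam T < d" for lam
      using sub that e by (force simp: D_def dist_commute)
    then show "\<forall>\<^sub>F lam in F. dist (zfix m n lam) l < e0"
      unfolding F_def eventually_at using d by auto
  qed
  then show ?thesis unfolding F_def T_def by blast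
qed

section \<open>Uniform nondegeneracy\<close>

lemma phiz_commute: "phiz m n z lam = phiz n m z lam"
  by (simp add: phiz_def add.commute)

lemma turn_squares_ne:
  assumes mn: "m \<noteq> n" and z: "0 < Im z" and fp: "phiz m n z (of_real t) = z"
    and res: "resonance (min m n) (max m n - min m n) (t + 1) \<noteq> 0"
  shows "(turn z (of_real t) n)\<^sup>2 \<noteq> (turn z (of_real t) m)\<^sup>2"
proof
  assume eq: "(turn z (of_real t) n)\<^sup>2 = (turn z (of_real t) m)\<^sup>2"
  define k r where "k = min m n" and "r = max m n - min m n"
  have "phiz k (k + r) z (of_real t) = z"
    using fp phiz_commute[of m n] by (auto simp: k_def r_def min_def max_def)
  moreover have "(turn z (of_real t) (k + r))\<^sup>2 = (turn z (of_real t) k)\<^sup>2"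
    using eq by (auto simp: k_def r_def min_def max_def)
  ultimately have "resonance k r (t + 1) = 0" using turn_eq_imp_resonance[OF z] by blast
  then show False using res by (simp add: k_def r_def)
qed

text \<open>On the first set the cubic degenerates and the boundary value of \<open>zfix\<close> is
  not controlled; off the second the two rotations have different squares.\<close>

definition exceptional :: "nat \<Rightarrow> nat \<Rightarrow> real set" where
  "exceptional m n = {t. fix_coeff3 m n (t + 1) = 0} \<union>
     {t. resonance (min m n) (max m n - min m n) (t + 1) = 0}"

lemma finite_exceptional:
  assumes "m \<noteq> n" shows "finite (exceptional m n)"
proof -
  have "0 < max m n - min m n" using assms by (auto simp: max_def min_def)
  then show ?thesis unfolding exceptional_def 
    using finite_fix_coeff3_roots[OF assms] finite_resonance_roots by blast
qed

lemma nondeg_mono: "nondeg m n c lam z \<Longrightarrow> c' \<le> c \<Longrightarrow> nondeg m n c' lam z"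
  by (force simp: nondeg_def)

text \<open>Away from the exceptional set \<open>zfix\<close> has a boundary value, by t in
  \<open>F0\<close> it lies in the open half plane, and it still solves the fixed point equation.
  Every quantity bounded in \<open>nondeg\<close> then has a positive limit, and half the smallest
  limit works nearby.\<close>

lemma nondeg_near_boundary:
  assumes mn: "m \<noteq> n" and t: "t \<in> F0 m n" "t \<notin> exceptional m n"
  shows "\<exists>c>0. \<forall>\<^sub>F lam in at (of_real t) within {lam. 0 < Im lam}. nondeg m n c lam (zfix m n lam)"
proof -
  define T where "T = complex_of_real t"
  define F where "F = at T within {lam. 0 < Im lam}"
  have F: "F \<noteq> bot" unfolding F_def T_def by (rule at_upper_half_plane_nontrivial)
  obtain l where l: "(zfix m n \<longlongrightarrow> l) F"
    using zfix_tendsto_boundary[of m n t] t unfolding F_def T_def exceptional_def by auto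
  have "zlam m n T = l" unfolding zlam_def using tendsto_Lim[OF F l] by (simp add: T_def F_def)
  then have Il: "0 < Im l" using t by (simp add: F0_def T_def)
  have T: "0 \<le> Im T" by (simp add: T_def)
  have id: "((\<lambda>lam. lam) \<longlongrightarrow> T) F" unfolding F_def by (rule tendsto_ident_at)
  have nz: "phi0 i l T + T + 1 \<noteq> 0" for i using phi0_denom_nz[OF Il T] .
  have p: "((\<lambda>lam. phi0 i (zfix m n lam) lam) \<longlongrightarrow> phi0 i l T) F" for i
    by (rule tendsto_phi0[OF l id nz])
  have evpos: "\<forall>\<^sub>F lam in F. 0 < Im lam" unfolding F_def by (auto simp: eventually_at_filter)
  have "((\<lambda>lam. phiz m n (zfix m n lam) lam) \<longlongrightarrow> phiz m n l T) F"
    using Il T by (intro tendsto_phiz l id) auto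
  then have "(zfix m n \<longlongrightarrow> phiz m n l T) F"
    by (rule Lim_transform_eventually) (use evpos in \<open>eventually_elim, simp add: zfix\<close>)
  then have fp: "phiz m n l T = l" using tendsto_unique[OF F _ l] by blast
  have turn: "((\<lambda>lam. turn (zfix m n lam) lam j) \<longlongrightarrow> turn l T j) F" for j
    unfolding turn_def using phi0_pos[OF Il T]
    by (intro tendsto_intros p) (metis complex_cnj_zero_iff less_irrefl zero_complex.simps(2))
  define v where "v = cmod ((turn l T n)\<^sup>2 - (turn l T m)\<^sup>2)"
  have v: "0 < v" unfolding v_def T_def
    using turn_squares_ne[OF mn Il fp[unfolded T_def]] t by (auto simp: exceptional_def)
  have vlim: "((\<lambda>lam. cmod ((turn (zfix m n lam) lam n)\<^sup>2 - (turn (zfix m n lam) lam m)\<^sup>2)) \<longlongrightarrow> v) F"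
    unfolding v_def by (intro tendsto_intros turn)
  define I where "I = insert v ((\<lambda>i. Im (phi0 i l T)) ` {..m+n})"
  define c where "c = Min I / 2"
  have I: "finite I" "I \<noteq> {}" by (auto simp: I_def)
  have Ile: "2 * c \<le> x" if "x \<in> I" for x using Min_le[OF I(1) that] by (simp add: c_def)
  have c2: "2 * c \<le> v" "\<And>i. i \<le> m + n \<Longrightarrow> 2 * c \<le> Im (phi0 i l T)"
    by (intro Ile; simp add: I_def)+
  have "0 < x" if "x \<in> I" for x using that v phi0_pos[OF Il T] by (auto simp: I_def)
  then have c: "0 < c" using Min_in[OF I] by (simp add: c_def)
  have "\<forall>\<^sub>F lam in F. \<forall>i\<in>{..m+n}. c < Im (phi0 i (zfix m n lam) lam)"
  proof (intro eventually_ball_finite ballI)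
    fix i assume "i \<in> {..m+n}"
    then have "c < Im (phi0 i l T)" using c2(2)[of i] c by simp
    then show "\<forall>\<^sub>F lam in F. c < Im (phi0 i (zfix m n lam) lam)"
      using tendsto_Im[OF p] by (rule order_tendstoD(1)[rotated])
  qed simp
  moreover have "\<forall>\<^sub>F lam in F. c < cmod ((turn (zfix m n lam) lam n)\<^sup>2 - (turn (zfix m n lam) lam m)\<^sup>2)"
    using vlim by (rule order_tendstoD(1)) (use c2 c in simp)
  ultimately have "\<forall>\<^sub>F lam in F. nondeg m n c lam (zfix m n lam)"
    using evpos
  proof eventually_elim
    case (elim lam)
    then show ?case using zfix[OF elim(3), of m n] by (auto simp: nondeg_def less_imp_le)
  qed
  then show ?thesis using c unfolding F_def T_def by blast
qed

lemma nondeg_uniform: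
  assumes mn: "m \<noteq> n" and ab: "{a..b} \<subseteq> F0 m n - exceptional m n"
  shows "\<exists>c>0. \<exists>\<epsilon>>0. \<forall>lam\<in>Rset {a..b} \<epsilon>. nondeg m n c lam (zfix m n lam)"
proof (rule ccontr)
  assume no: "\<not> ?thesis"
  \<comment> \<open>One null sequence serves as the candidate for both c and \<epsilon>, so that a
    counterexample at every stage contradicts the local constant at a limit energy.\<close>
  define e where "e k = 1 / real (Suc k)" for k
  have e: "0 < e k" for k by (simp add: e_def)
  have "\<exists>lam. lam \<in> Rset {a..b} (e k) \<and> \<not> nondeg m n (e k) lam (zfix m n lam)" for k
    using no e by blast
  then obtain X where X: "\<And>k. X k \<in> Rset {a..b} (e k)" "\<And>k. \<not> nondeg m n (e k) (X k) (zfix m n (X k))"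
    by metis
  have XR: "Re (X k) \<in> {a..b}" "0 < Im (X k)" "Im (X k) \<le> e k" for k using X(1)[of k] by (auto simp: Rset_def)
  have elim: "e \<longlonglongrightarrow> 0" unfolding e_def by (rule LIMSEQ_Suc[OF lim_1_over_n])
  have "seq_compact {a..b}" by (simp add: compact_imp_seq_compact)
  then obtain t r where t: "t \<in> {a..b}" and r: "strict_mono (r :: nat \<Rightarrow> nat)" and lim: "((\<lambda>k. Re (X k)) \<circ> r) \<longlonglongrightarrow> t"
    using XR(1) by (force elim: seq_compactE)
  obtain c where c: "0 < c" "\<forall>\<^sub>F lam in at (of_real t) within {lam. 0 < Im lam}. nondeg m n c lam (zfix m n lam)"
    using nondeg_near_boundary[OF mn, of t] t ab by blast
  have er: "(\<lambda>k. e (r k)) \<longlonglongrightarrow> 0" using LIMSEQ_subseq_LIMSEQ[OF elim r] by (simp add: o_def)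
  have "(\<lambda>k. Im (X (r k))) \<longlonglongrightarrow> 0"
    by (rule tendsto_sandwich[OF _ _ tendsto_const er]) (use XR in \<open>auto intro!: always_eventually less_imp_le\<close>)
  then have "(\<lambda>k. X (r k)) \<longlonglongrightarrow> of_real t"
    using lim by (auto simp: tendsto_complex_iff o_def)
  moreover have "\<forall>\<^sub>F k in sequentially. X (r k) \<in> {lam. 0 < Im lam} \<and> X (r k) \<noteq> of_real t"
    using XR(2) by (intro always_eventually) (metis Im_complex_of_real less_irrefl mem_Collect_eq)
  ultimately have "filterlim (\<lambda>k. X (r k)) (at (of_real t) within {lam. 0 < Im lam}) sequentially"
    by (auto simp: filterlim_at)
  then have "\<forall>\<^sub>F k in sequentially. nondeg m n c (X (r k)) (zfix m n (X (r k)))"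
    by (rule eventually_compose_filterlim[OF c(2)])
  moreover have "\<forall>\<^sub>F k in sequentially. e (r k) < c" using er c(1) by (rule order_tendstoD(2))
  ultimately have "\<forall>\<^sub>F k in sequentially. False"
    by eventually_elim (use X(2) nondeg_mono in \<open>meson less_imp_le\<close>)
  then show False by simp
qed

section \<open>The forward Green function\<close>

text \<open>Auxiliary vertices are counted from the far end of their edge, so a step away from the
  root enters the edge at its largest index. On an edge without inserted vertices that index is 0,
  the next principal vertex.\<close>

definition kids :: "nat \<Rightarrow> nat \<Rightarrow> vtx \<Rightarrow> vtx set" where
  "kids m n y = (case y of (u, 0) \<Rightarrow> {(u @ [True], m), (u @ [False], n)} | (u, Suc j) \<Rightarrow> {(u, j)})"

text \<open>The distance to the root: each edge into a prefix of u has one step more than it has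
  inserted vertices, and the index counts the steps still missing. It is integer valued to avoid
  truncated subtraction.\<close>

definition tdepth :: "nat \<Rightarrow> nat \<Rightarrow> vtx \<Rightarrow> int" where
  "tdepth m n y = (\<Sum>b\<leftarrow>fst y. int (Suc (elen m n b))) - int (snd y)"

text \<open>For v empty the index must be 0, because the auxiliary vertices labelled by w itself lie
  on the edge leading to w.\<close>

definition below :: "nat \<Rightarrow> nat \<Rightarrow> bool list \<Rightarrow> vtx set" where
  "below m n w = {(w @ v, i) | v i. (w @ v, i) \<in> Tset m n \<and> (v = [] \<longrightarrow> i = 0)}"

lemma finite_kids: "finite (kids m n y)"
  by (cases y; cases "snd y") (auto simp: kids_def)

lemma kids_simps: 
  "kids m n (u, 0) = {(u @ [True], m), (u @ [False], n)}" "kids m n (u, Suc j) = {(u, j)}"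
  by (simp_all add: kids_def)

lemma tpar_kid: "y \<in> Tset m n \<Longrightarrow> c \<in> kids m n y \<Longrightarrow> tpar m n c = y \<and> c \<in> Tset m n"
  by (cases y; cases "snd y") (auto simp: kids_def tpar_def elen_def Tset_def split: if_splits)

lemma kid_tpar: "c \<in> Tset m n \<Longrightarrow> fst c \<noteq> [] \<Longrightarrow> c \<in> kids m n (tpar m n c)"
proof (cases c)
  case (Pair u i)
  assume c: "c \<in> Tset m n" "fst c \<noteq> []"
  then have u: "u \<noteq> []" using Pair by simp
  show ?thesis
  proof (cases "i < elen m n (last u)")
    case True then show ?thesis using Pair u by (simp add: tpar_def kids_def)
  next
    case False
    then have "i = elen m n (last u)" using c Pair by (cases "i = 0") (auto simp: Tset_def)
    moreover have "u = butlast u @ [last u]" using u by simp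
    ultimately show ?thesis using Pair u False
      by (cases "last u") (simp_all add: tpar_def kids_def elen_def)
  qed
qed

lemma tdepth_tpar: 
  assumes "c \<in> Tset m n" "fst c \<noteq> []"
  shows "tdepth m n (tpar m n c) = tdepth m n c - 1"
proof -
  obtain u i where c: "c = (u, i)" by (cases c)
  have u: "u = butlast u @ [last u]" "u \<noteq> []" using assms c by auto
  have s: "(\<Sum>b\<leftarrow>u. int (Suc (elen m n b))) = (\<Sum>b\<leftarrow>butlast u. int (Suc (elen m n b))) + int (Suc (elen m n (last u)))"
    by (subst u(1)) simp
  show ?thesis
  proof (cases "i < elen m n (last u)")
    case True then show ?thesis using c u by (simp add: tpar_def tdepth_def)
  next
    case False
    then have "i = elen m n (last u)" using assms c by (cases "i = 0") (auto simp: Tset_def)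
    then show ?thesis using c u s by (simp add: tpar_def tdepth_def)
  qed
qed

lemma tdepth_kid: "y \<in> Tset m n \<Longrightarrow> c \<in> kids m n y \<Longrightarrow> tdepth m n c = tdepth m n y + 1"
  by (cases y; cases "snd y") (auto simp: kids_def tdepth_def elen_def)

lemma tpar_funpow: "u \<noteq> [] \<Longrightarrow> i + k \<le> elen m n (last u) \<Longrightarrow> (tpar m n ^^ k) (u, i) = (u, i + k)"
  by (induction k) (auto simp: tpar_def)

lemma Tsub_eq_below:
  assumes w: "w \<noteq> []"
  shows "Tsub m n (w, 0) = below m n w"
proof (intro equalityI subsetI)
  fix y assume "y \<in> Tsub m n (w, 0)"
  then obtain j where "y \<in> Tset m n" "(tpar m n ^^ j) y = (w, 0)" by (auto simp: Tsub_def)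
  then show "y \<in> below m n w"
  proof (induction j arbitrary: y)
    case 0 then show ?case by (auto simp: below_def)
  next
    case (Suc j)
    obtain u i where y: "y = (u, i)" by (cases y)
    have root: "(tpar m n ^^ k) ([], 0) = ([], 0)" for k by (induction k) (auto simp: tpar_def)
    have u: "u \<noteq> []"
    proof
      assume "u = []"
      then have "y = ([], 0)" using Suc.prems y by (auto simp: Tset_def)
      then show False using Suc.prems(2) root[of "Suc j"] w by simp
    qed
    have "tpar m n y \<in> Tset m n" using Suc.prems(1) y u by (auto simp: tpar_def Tset_def)
    moreover have "(tpar m n ^^ j) (tpar m n y) = (w, 0)" using Suc.prems(2) by (simp add: funpow_swap1)
    ultimately have "tpar m n y \<in> below m n w" by (rule Suc.IH)
    then obtain v i' where v: "tpar m n y = (w @ v, i')" "v = [] \<longrightarrow> i' = 0" by (auto simp: below_def)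
    show ?case
    proof (cases "i < elen m n (last u)")
      case True then show ?thesis using v y u Suc.prems(1) by (auto simp: tpar_def below_def)
    next
      case False
      then have "butlast u = w @ v" using v y u by (simp add: tpar_def)
      then have "u = w @ (v @ [last u])" using u by (metis append.assoc append_butlast_last_id)
      then have "y = (w @ (v @ [last u]), i)" using y by simp
      then show ?thesis using Suc.prems(1) unfolding below_def by blast
    qed
  qed
next
  fix y assume "y \<in> below m n w"
  then obtain v i where y: "y = (w @ v, i)" "y \<in> Tset m n" "v = [] \<longrightarrow> i = 0" by (auto simp: below_def)
  have "\<exists>j. (tpar m n ^^ j) (w @ v, i) = (w, 0)" using y(2,3) unfolding y(1)
  proof (induction v arbitrary: i rule: rev_induct)
    case Nil then show ?case by (auto intro!: exI[of _ 0])
  next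
    case (snoc b v)
    have i: "i \<le> elen m n b" using snoc.prems by (cases "i = 0") (auto simp: Tset_def)
    have "(w @ v, 0) \<in> Tset m n" by (auto simp: Tset_def)
    then obtain j where j: "(tpar m n ^^ j) (w @ v, 0) = (w, 0)" using snoc.IH[of 0] by auto
    have 1: "(tpar m n ^^ (elen m n b - i)) (w @ v @ [b], i) = (w @ v @ [b], elen m n b)"
      using tpar_funpow[of "w @ v @ [b]" i "elen m n b - i" m n] i by simp
    have 2: "tpar m n (w @ v @ [b], elen m n b) = (w @ v, 0)" by (simp add: tpar_def butlast_append)
    have "(tpar m n ^^ (j + (Suc (elen m n b - i)))) (w @ v @ [b], i) = (w, 0)"
      unfolding funpow_add by (simp add: 1 2 j)
    then show ?case by blast
  qed
  then show "y \<in> Tsub m n (w, 0)" using y by (auto simp: Tsub_def)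
qed

lemma below_Tset: "y \<in> below m n w \<Longrightarrow> y \<in> Tset m n"
  by (auto simp: below_def)

lemma below_root: "(w, 0) \<in> below m n w"
  by (auto simp: below_def Tset_def)

lemma kids_below: "y \<in> below m n w \<Longrightarrow> c \<in> kids m n y \<Longrightarrow> c \<in> below m n w"
proof -
  assume y: "y \<in> below m n w" and c: "c \<in> kids m n y"
  then obtain v i where v: "y = (w @ v, i)" "v = [] \<longrightarrow> i = 0" by (auto simp: below_def)
  have "c \<in> Tset m n" using tpar_kid below_Tset y c by blast
  then show ?thesis using c v by (cases i) (auto simp: kids_def below_def)
qed

lemma tpar_below: "y \<in> below m n w \<Longrightarrow> y \<noteq> (w, 0) \<Longrightarrow> tpar m n y \<in> below m n w"
proof -
  assume y: "y \<in> below m n w" "y \<noteq> (w, 0)"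
  then obtain v i where v: "y = (w @ v, i)" "v = [] \<longrightarrow> i = 0" "y \<in> Tset m n" by (auto simp: below_def)
  have ne: "v \<noteq> []" using v y by auto
  then have "last (w @ v) = last v" "butlast (w @ v) = w @ butlast v" by (auto simp: butlast_append)
  then show ?thesis using v ne by (auto simp: tpar_def below_def Tset_def)
qed

fun tlevel :: "nat \<Rightarrow> nat \<Rightarrow> bool list \<Rightarrow> nat \<Rightarrow> vtx set" where
  "tlevel m n w 0 = {(w, 0)}"
| "tlevel m n w (Suc j) = (\<Union>y\<in>tlevel m n w j. kids m n y)"

lemma finite_tlevel: "finite (tlevel m n w j)"
  by (induction j) (auto intro: finite_kids)

lemma tlevel_below: "y \<in> tlevel m n w j \<Longrightarrow> y \<in> below m n w"
  by (induction j arbitrary: y) (auto intro: below_root kids_below)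

lemma tdepth_tlevel: "y \<in> tlevel m n w j \<Longrightarrow> tdepth m n y = tdepth m n (w, 0) + int j"
proof (induction j arbitrary: y)
  case (Suc j)
  then obtain z where z: "z \<in> tlevel m n w j" "y \<in> kids m n z" by auto
  then show ?case using Suc.IH[OF z(1)] tdepth_kid[OF below_Tset[OF tlevel_below[OF z(1)]] z(2)] by simp
qed simp

lemma ex_tlevel: 
  assumes "w \<noteq> []" "y \<in> below m n w" shows "\<exists>j. y \<in> tlevel m n w j"
proof -
  have "y \<in> Tsub m n (w, 0)" using assms Tsub_eq_below by simp
  then obtain j where "(tpar m n ^^ j) y = (w, 0)" by (auto simp: Tsub_def)
  then show ?thesis using assms(2)
  proof (induction j arbitrary: y)
    case 0 then have "y \<in> tlevel m n w 0" by simp then show ?case by blast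
  next
    case (Suc j)
    show ?case
    proof (cases "y = (w, 0)")
      case True then have "y \<in> tlevel m n w 0" by simp then show ?thesis by blast
    next
      case False
      have "(tpar m n ^^ j) (tpar m n y) = (w, 0)" using Suc.prems by (simp add: funpow_swap1)
      then obtain i where "tpar m n y \<in> tlevel m n w i" using Suc.IH tpar_below[OF Suc.prems(2) False] by blast
      moreover have "y \<in> kids m n (tpar m n y)"
        using kid_tpar below_Tset[OF Suc.prems(2)] Suc.prems(2) assms(1) by (auto simp: below_def)
      ultimately have "y \<in> tlevel m n w (Suc i)" by auto
      then show ?thesis by blast
    qed
  qed
qed

lemma tlevel_disjoint: "i \<noteq> j \<Longrightarrow> tlevel m n w i \<inter> tlevel m n w j = {}"
proof (rule ccontr)
  assume ij: "i \<noteq> j" and "tlevel m n w i \<inter> tlevel m n w j \<noteq> {}"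
  then obtain y where "y \<in> tlevel m n w i" "y \<in> tlevel m n w j" by blast
  from this[THEN tdepth_tlevel] ij show False by simp
qed

lemma sum_tlevel_Suc:
  fixes f :: "vtx \<Rightarrow> 'a::comm_monoid_add"
  shows "sum f (tlevel m n w (Suc j)) = (\<Sum>y\<in>tlevel m n w j. sum f (kids m n y))"
proof -
  have "kids m n y \<inter> kids m n y' = {}" if "y \<in> tlevel m n w j" "y' \<in> tlevel m n w j" "y \<noteq> y'" for y y'
    using that tpar_kid[of y m n] tpar_kid[of y' m n] below_Tset tlevel_below by (metis disjoint_iff)
  then show ?thesis unfolding tlevel.simps
    by (intro sum.UNION_disjoint) (auto intro: finite_tlevel finite_kids)
qed

lemma sum_tlevels:
  fixes f :: "vtx \<Rightarrow> 'a::comm_monoid_add"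
  shows "(\<Sum>y\<in>(\<Union>j<N. tlevel m n w j). f y) = (\<Sum>j<N. \<Sum>y\<in>tlevel m n w j. f y)"
  by (rule sum.UNION_disjoint) (use tlevel_disjoint finite_tlevel in blast)+

section \<open>Riccati recursion and square summable solutions\<close>

definition tpot :: "real \<Rightarrow> (vtx \<Rightarrow> real) \<Rightarrow> vtx \<Rightarrow> real" where
  "tpot k q y = k * q y - (if snd y = 0 then 0 else 1)"

text \<open>Subtracting 3 cancels the degree of a principal vertex and leaves -1 at an auxiliary
  vertex, whose degree is 2. This -1 is the correction in \<open>tpot\<close> and the source of the
  \<open>+ 1\<close> in each chain step. The root is excluded, as it has degree 2 and no
  parent.\<close>

lemma Hop_below:
  assumes y: "y \<in> Tset m n" "fst y \<noteq> []"
  shows "Hop m n k q psi y = - psi (tpar m n y) - (\<Sum>c\<in>kids m n y. psi c) + of_real (tpot k q y) * psi y"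
proof -
  obtain u i where ui: "y = (u, i)" by (cases y)
  have tp: "tpar m n y \<in> Tset m n" using y ui by (auto simp: tpar_def Tset_def)
  have dp: "tdepth m n (tpar m n y) = tdepth m n y - 1" using tdepth_tpar y by blast
  have kd: "tdepth m n c = tdepth m n y + 1" if "c \<in> kids m n y" for c using tdepth_kid y that by blast
  have adj: "{y'. tadj m n y y'} = insert (tpar m n y) (kids m n y)"
  proof (intro equalityI subsetI)
    fix c assume "c \<in> {y'. tadj m n y y'}"
    then have c: "c \<in> Tset m n" "y \<noteq> c" "tpar m n y = c \<or> tpar m n c = y" by (auto simp: tadj_def)
    have "c \<in> kids m n y" if "tpar m n c = y"
    proof -
      have "fst c \<noteq> []" using that y by (auto simp: tpar_def split: prod.splits)
      then show ?thesis using kid_tpar[OF c(1)] that by simp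
    qed
    then show "c \<in> insert (tpar m n y) (kids m n y)" using c by auto
  next
    fix c assume c: "c \<in> insert (tpar m n y) (kids m n y)"
    have "tpar m n y \<noteq> y" using dp by force
    moreover have "c \<noteq> y" if "c \<in> kids m n y" using kd[OF that] by auto
    ultimately have ne: "tpar m n y \<noteq> y" "c \<in> kids m n y \<longrightarrow> c \<noteq> y" by blast+
    show "c \<in> {y'. tadj m n y y'}"
    proof (cases "c = tpar m n y")
      case True then show ?thesis using ne tp y(1) unfolding tadj_def by simp
    next
      case False
      then have "c \<in> kids m n y" using c by simp
      then show ?thesis using ne y(1) tpar_kid[OF y(1), of c] unfolding tadj_def by simp
    qed
  qed
  have nk: "tpar m n y \<notin> kids m n y" using kd[of "tpar m n y"] dp by linarith
  have "(\<Sum>y'\<in>{y'. tadj m n y y'}. psi y - psi y') = 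
     (psi y - psi (tpar m n y)) + (of_nat (card (kids m n y)) * psi y - (\<Sum>c\<in>kids m n y. psi c))"
    unfolding adj using nk finite_kids[of m n y] by (simp add: sum_subtractf algebra_simps)
  moreover have "card (kids m n y) = (if snd y = 0 then 2 else 1)"
    using ui by (cases i) (auto simp: kids_def)
  ultimately show ?thesis unfolding Hop_def tpot_def by (simp add: algebra_simps)
qed

text \<open>The recursion is imposed vertex by vertex, auxiliary vertices included. The sign
  condition is not strict because solutions arise as limits; \<open>Im lam > 0\<close> still keeps
  the denominators away from 0.\<close>

definition green_rec :: "nat \<Rightarrow> nat \<Rightarrow> real \<Rightarrow> (vtx \<Rightarrow> real) \<Rightarrow> complex \<Rightarrow> bool list \<Rightarrow> (vtx \<Rightarrow> complex) \<Rightarrow> bool" where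
  "green_rec m n k q lam w g \<longleftrightarrow> (\<forall>y\<in>below m n w. 0 \<le> Im (g y) \<and>
     g y = -1 / ((\<Sum>c\<in>kids m n y. g c) + lam - of_real (tpot k q y)))"

definition green_sol :: "nat \<Rightarrow> nat \<Rightarrow> real \<Rightarrow> (vtx \<Rightarrow> real) \<Rightarrow> complex \<Rightarrow> bool list \<Rightarrow> (vtx \<Rightarrow> complex) \<Rightarrow> bool" where
  "green_sol m n k q lam w psi \<longleftrightarrow> (\<forall>y. y \<notin> below m n w \<longrightarrow> psi y = 0) \<and>
      (\<lambda>y. (cmod (psi y))\<^sup>2) summable_on below m n w \<and>
      (\<forall>y\<in>below m n w. - psi (tpar m n y) - (\<Sum>c\<in>kids m n y. psi c) + of_real (tpot k q y) * psi y - lam * psi y = (if y = (w, 0) then 1 else 0))"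

lemma greenF_eq:
  assumes "w \<noteq> []"
  shows "greenF m n k q (w, 0) lam = (THE g. \<exists>psi. green_sol m n k q lam w psi \<and> g = psi (w, 0))"
proof -
  have "Hop m n k q psi y = - psi (tpar m n y) - (\<Sum>c\<in>kids m n y. psi c) + of_real (tpot k q y) * psi y"
    if "y \<in> below m n w" for psi y
    using that assms by (intro Hop_below below_Tset[OF that]) (auto simp: below_def)
  then show ?thesis unfolding greenF_def green_sol_def Tsub_eq_below[OF assms] by (simp only: conj_assoc cong: ball_cong)
qed

text \<open>The solution is the product of the g along the path from the root of the subtree. Its
  square summability comes from the imaginary part of the recursion, which is a conservation
  law.\<close>

lemma green_sol_exists:
  assumes w: "w \<noteq> []" and lam: "0 < Im lam" and g: "green_rec m n k q lam w g"
  shows "\<exists>psi. green_sol m n k q lam w psi \<and> psi (w, 0) = g (w, 0)"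
proof -
  define x where "x = (w, 0::nat)"
  define ht where "ht y = nat (tdepth m n y - tdepth m n x)" for y
  define psi where "psi y = (if y \<in> below m n w then (\<Prod>i\<le>ht y. g ((tpar m n ^^ i) y)) else 0)" for y
  define W where "W y = (\<Sum>c\<in>kids m n y. g c) + lam - of_real (tpot k q y)" for y
  have xb: "x \<in> below m n w" by (simp add: x_def below_root)
  have gW: "g y = -1 / W y" "0 \<le> Im (g y)" if "y \<in> below m n w" for y
    using g that unfolding green_rec_def W_def by blast+
  have ImW: "Im (W y) = (\<Sum>c\<in>kids m n y. Im (g c)) + Im lam" if "y \<in> below m n w" for y
    by (simp add: W_def)
  have kn: "0 \<le> (\<Sum>c\<in>kids m n y. Im (g c))" if "y \<in> below m n w" for y
    using gW(2) kids_below[OF that] by (intro sum_nonneg) auto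
  have Wp: "0 < Im (W y)" if "y \<in> below m n w" for y using ImW[OF that] kn[OF that] lam by simp
  have Wg: "W y * g y = -1" if "y \<in> below m n w" for y 
  proof -
    have "W y \<noteq> 0" using Wp[OF that] by force
    then show ?thesis using gW(1)[OF that] by simp
  qed
  have psix: "psi x = g x" using xb by (simp add: psi_def ht_def)
  have psik: "psi c = g c * psi y" if y: "y \<in> below m n w" and c: "c \<in> kids m n y" for c y
  proof -
    obtain j where j: "y \<in> tlevel m n w j" using ex_tlevel[OF w y] by blast
    have "ht y = j" using tdepth_tlevel[OF j] by (simp add: ht_def x_def)
    moreover have "ht c = Suc j" using tdepth_tlevel[OF j] tdepth_kid[OF below_Tset[OF y] c] by (simp add: ht_def x_def nat_add_distrib)
    moreover have "(\<Prod>i\<le>Suc j. g ((tpar m n ^^ i) c)) = g c * (\<Prod>i\<le>j. g ((tpar m n ^^ i) y))"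
      using tpar_kid[OF below_Tset[OF y] c] by (simp add: prod.atMost_Suc_shift funpow_swap1 del: prod.atMost_Suc)
    ultimately show ?thesis using y kids_below[OF y c] by (simp add: psi_def)
  qed
  \<comment> \<open>psi without its last factor. Since \<open>W y * g y = -1\<close>, the equation
    at y produces h y; its value 1 at x is the delta on the right-hand side, and elsewhere it
    cancels the term of the parent.\<close>
  define h where "h y = (if y = x then 1 else psi (tpar m n y))" for y
  have tk: "tpar m n y \<in> below m n w \<and> y \<in> kids m n (tpar m n y)" if "y \<in> below m n w" "y \<noteq> x" for y
    using that tpar_below[of y m n w] kid_tpar[OF below_Tset[OF that(1)]] w by (auto simp: x_def below_def)
  have psih: "psi y = g y * h y" if "y \<in> below m n w" for y
    using psix psik tk[OF that] by (auto simp: h_def)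
  have hk: "h c = psi y" if y: "y \<in> below m n w" and c: "c \<in> kids m n y" for c y
  proof -
    have "tdepth m n c = tdepth m n y + 1" using tdepth_kid below_Tset y c by blast
    moreover obtain j where "y \<in> tlevel m n w j" using ex_tlevel[OF w y] by blast
    ultimately have "c \<noteq> x" using tdepth_tlevel[of y m n w j] by (auto simp: x_def)
    then show ?thesis using tpar_kid[OF below_Tset[OF y] c] by (simp add: h_def)
  qed
  have eq: "- psi (tpar m n y) - (\<Sum>c\<in>kids m n y. psi c) + of_real (tpot k q y) * psi y - lam * psi y = (if y = (w, 0) then 1 else 0)"
    if y: "y \<in> below m n w" for y
  proof -
    have "(\<Sum>c\<in>kids m n y. psi c) = (\<Sum>c\<in>kids m n y. g c) * psi y"
      unfolding sum_distrib_right by (intro sum.cong psik y) auto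
    then have "- (\<Sum>c\<in>kids m n y. psi c) + of_real (tpot k q y) * psi y - lam * psi y = - (W y * psi y)"
      by (simp add: W_def algebra_simps)
    also have "\<dots> = h y" unfolding psih[OF y] using Wg[OF y] by (simp add: mult.assoc[symmetric])
    finally have e: "- (\<Sum>c\<in>kids m n y. psi c) + of_real (tpot k q y) * psi y - lam * psi y = h y" .
    have px: "psi (tpar m n x) = 0"
    proof -
      have "tdepth m n (tpar m n x) = tdepth m n x - 1" using tdepth_tpar[OF below_Tset[OF xb]] w by (simp add: x_def)
      moreover have "tdepth m n z \<ge> tdepth m n x" if "z \<in> below m n w" for z
      proof -
        from ex_tlevel[OF w that] obtain j where j: "z \<in> tlevel m n w j" ..
        show ?thesis using tdepth_tlevel[OF j] by (simp add: x_def)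
      qed
      ultimately have "tpar m n x \<notin> below m n w" by (metis diff_less less_irrefl not_less zle_diff1_eq)
      then show ?thesis by (simp add: psi_def)
    qed
    show ?thesis using e px by (cases "y = x") (auto simp: h_def x_def algebra_simps)
  qed
  have Img: "Im (g y) = (cmod (g y))\<^sup>2 * ((\<Sum>c\<in>kids m n y. Im (g c)) + Im lam)" if y: "y \<in> below m n w" for y
  proof -
    have "Im (g y) = Im (W y) / (cmod (W y))\<^sup>2" using gW(1)[OF y] Im_neg_inverse by metis
    also have "(cmod (W y))\<^sup>2 = 1 / (cmod (g y))\<^sup>2" using gW(1)[OF y] by (simp add: norm_divide power_divide)
    finally show ?thesis using ImW[OF y] by simp
  qed
  \<comment> \<open>By \<open>Img\<close> the flux through one level equals the dissipated mass of
    that level plus the flux through the next. The remaining flux is nonnegative, so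
    \<open>Im lam\<close> times the squared norm of psi is at most \<open>Im (g x)\<close>.\<close>
  have bal: "Im lam * (\<Sum>j<N. \<Sum>y\<in>tlevel m n w j. (cmod (psi y))\<^sup>2) + (\<Sum>y\<in>tlevel m n w N. (cmod (h y))\<^sup>2 * Im (g y)) = Im (g x)" for N
  proof (induction N)
    case 0 show ?case by (simp add: h_def x_def)
  next
    case (Suc N)
    have "(\<Sum>y\<in>tlevel m n w N. (cmod (h y))\<^sup>2 * Im (g y)) 
        = (\<Sum>y\<in>tlevel m n w N. Im lam * (cmod (psi y))\<^sup>2 + (\<Sum>c\<in>kids m n y. (cmod (h c))\<^sup>2 * Im (g c)))"
    proof (intro sum.cong refl)
      fix y assume "y \<in> tlevel m n w N"
      then have y: "y \<in> below m n w" by (rule tlevel_below)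
      have "(\<Sum>c\<in>kids m n y. (cmod (h c))\<^sup>2 * Im (g c)) = (cmod (psi y))\<^sup>2 * (\<Sum>c\<in>kids m n y. Im (g c))"
        unfolding sum_distrib_left using hk[OF y] by (intro sum.cong) auto
      moreover have "(cmod (h y))\<^sup>2 * Im (g y) = (cmod (psi y))\<^sup>2 * ((\<Sum>c\<in>kids m n y. Im (g c)) + Im lam)"
        unfolding psih[OF y] by (subst Img[OF y]) (simp add: norm_mult power_mult_distrib)
      ultimately show "(cmod (h y))\<^sup>2 * Im (g y) = Im lam * (cmod (psi y))\<^sup>2 + (\<Sum>c\<in>kids m n y. (cmod (h c))\<^sup>2 * Im (g c))"
        by (simp add: algebra_simps)
    qed
    then show ?case using Suc unfolding sum_tlevel_Suc sum.lessThan_Suc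
      by (simp add: sum.distrib sum_distrib_left algebra_simps)
  qed
  have bnd: "(\<Sum>j<N. \<Sum>y\<in>tlevel m n w j. (cmod (psi y))\<^sup>2) \<le> Im (g x) / Im lam" for N
  proof -
    have "0 \<le> (\<Sum>y\<in>tlevel m n w N. (cmod (h y))\<^sup>2 * Im (g y))"
      using gW(2) tlevel_below by (intro sum_nonneg mult_nonneg_nonneg) auto
    then show ?thesis using bal[of N] lam by (simp add: field_simps)
  qed
  have "(\<lambda>y. (cmod (psi y))\<^sup>2) summable_on below m n w"
  proof (rule nonneg_bdd_above_summable_on)
    show "bdd_above (sum (\<lambda>y. (cmod (psi y))\<^sup>2) ` {F. F \<subseteq> below m n w \<and> finite F})"
    proof (intro bdd_aboveI2[where M="Im (g x) / Im lam"])
      fix F assume "F \<in> {F. F \<subseteq> below m n w \<and> finite F}"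
      then have F: "F \<subseteq> below m n w" "finite F" by auto
      have "\<exists>N. F \<subseteq> (\<Union>j<N. tlevel m n w j)" using F(2,1)
      proof (induction F rule: finite_induct)
        case (insert y F)
        then obtain N where N: "F \<subseteq> (\<Union>j<N. tlevel m n w j)" by auto
        have "y \<in> below m n w" using insert.prems by simp
        from ex_tlevel[OF w this] obtain j where j: "y \<in> tlevel m n w j" ..
        have "(\<Union>j<N. tlevel m n w j) \<subseteq> (\<Union>j<max N (Suc j). tlevel m n w j)" by (intro UN_mono) auto
        moreover have "y \<in> (\<Union>j<max N (Suc j). tlevel m n w j)" using j by (intro UN_I[of j]) auto
        ultimately have "insert y F \<subseteq> (\<Union>j<max N (Suc j). tlevel m n w j)"
          unfolding insert_subset using N by (intro conjI order_trans[OF N])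
        then show ?case by (rule exI)
      qed auto
      then obtain N where N: "F \<subseteq> (\<Union>j<N. tlevel m n w j)" by blast
      have "(\<Sum>y\<in>F. (cmod (psi y))\<^sup>2) \<le> (\<Sum>y\<in>(\<Union>j<N. tlevel m n w j). (cmod (psi y))\<^sup>2)"
        using N by (intro sum_mono2) (auto intro: finite_tlevel)
      also have "\<dots> = (\<Sum>j<N. \<Sum>y\<in>tlevel m n w j. (cmod (psi y))\<^sup>2)"
        by (rule sum_tlevels)
      also have "\<dots> \<le> Im (g x) / Im lam" by (rule bnd)
      finally show "(\<Sum>y\<in>F. (cmod (psi y))\<^sup>2) \<le> Im (g x) / Im lam" .
    qed
  qed simp
  moreover have "\<forall>y. y \<notin> below m n w \<longrightarrow> psi y = 0" by (simp add: psi_def)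
  ultimately have "green_sol m n k q lam w psi" unfolding green_sol_def using eq by blast
  then show ?thesis using psix by (auto simp: x_def)
qed

text \<open>The current \<open>J y = Im (cnj (d (tpar y)) * d y)\<close> through the edge above \<open>y\<close> satisfies
  \<open>J y = Im lam * |d y|\<^sup>2 + (sum of J over the children of y)\<close>.\<close>
lemma green_sol_unique:
  assumes w: "w \<noteq> []" and lam: "0 < Im lam" 
    and s1: "green_sol m n k q lam w psi1" and s2: "green_sol m n k q lam w psi2"
  shows "psi1 (w, 0) = psi2 (w, 0)"
proof (rule ccontr)
  assume ne: "psi1 (w, 0) \<noteq> psi2 (w, 0)"
  define d where "d y = psi1 y - psi2 y" for y
  have out: "d y = 0" if "y \<notin> below m n w" for y
  proof -
    have "psi1 y = 0" "psi2 y = 0" using s1 s2 that unfolding green_sol_def by blast+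
    then show ?thesis by (simp add: d_def)
  qed
  have eq: "- d (tpar m n y) - (\<Sum>c\<in>kids m n y. d c) + of_real (tpot k q y) * d y - lam * d y = 0" if y: "y \<in> below m n w" for y
  proof -
    have "- psi1 (tpar m n y) - (\<Sum>c\<in>kids m n y. psi1 c) + of_real (tpot k q y) * psi1 y - lam * psi1 y
      = - psi2 (tpar m n y) - (\<Sum>c\<in>kids m n y. psi2 c) + of_real (tpot k q y) * psi2 y - lam * psi2 y"
      using s1 s2 y unfolding green_sol_def by metis
    then show ?thesis by (simp add: d_def sum_subtractf algebra_simps)
  qed
  have summ: "(\<lambda>y. (cmod (d y))\<^sup>2) summable_on below m n w"
  proof (rule summable_on_comparison_test)
    show "(\<lambda>y. 2 * (cmod (psi1 y))\<^sup>2 + 2 * (cmod (psi2 y))\<^sup>2) summable_on below m n w"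
      using s1 s2 by (intro summable_on_add summable_on_cmult_right) (unfold green_sol_def, blast+)
    fix y
    have "(cmod (d y))\<^sup>2 \<le> (cmod (psi1 y) + cmod (psi2 y))\<^sup>2"
      unfolding d_def by (intro power_mono norm_triangle_ineq4) auto
    also have "\<dots> \<le> 2 * (cmod (psi1 y))\<^sup>2 + 2 * (cmod (psi2 y))\<^sup>2"
      using zero_le_power2[of "cmod (psi1 y) - cmod (psi2 y)"] by (simp add: power2_eq_square algebra_simps)
    finally show "(cmod (d y))\<^sup>2 \<le> 2 * (cmod (psi1 y))\<^sup>2 + 2 * (cmod (psi2 y))\<^sup>2" .
  qed auto
  define E where "E j = (\<Sum>y\<in>tlevel m n w j. (cmod (d y))\<^sup>2)" for j
  have E0: "0 \<le> E j" for j by (simp add: E_def sum_nonneg)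
  have Eb: "(\<Sum>j<N. E j) \<le> (\<Sum>\<^sub>\<infinity>y\<in>below m n w. (cmod (d y))\<^sup>2)" for N
  proof -
    have "(\<Sum>j<N. E j) = (\<Sum>y\<in>(\<Union>j<N. tlevel m n w j). (cmod (d y))\<^sup>2)"
      unfolding E_def by (rule sum_tlevels[symmetric])
    also have "\<dots> \<le> (\<Sum>\<^sub>\<infinity>y\<in>below m n w. (cmod (d y))\<^sup>2)"
    proof (rule finite_sum_le_infsum[OF summ])
      show "finite (\<Union>j<N. tlevel m n w j)" by (simp add: finite_tlevel)
      show "(\<Union>j<N. tlevel m n w j) \<subseteq> below m n w" by (rule UN_least) (use tlevel_below in blast)
    qed simp
    finally show ?thesis .
  qed
  have "summable E" by (rule summableI_nonneg_bounded[OF E0 Eb])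
  then have Elim: "E \<longlonglongrightarrow> 0" by (rule summable_LIMSEQ_zero)
  define J where "J y = Im (cnj (d (tpar m n y)) * d y)" for y
  have Jy: "J y = Im lam * (cmod (d y))\<^sup>2 + (\<Sum>c\<in>kids m n y. J c)" if y: "y \<in> below m n w" for y
  proof -
    have "(\<Sum>c\<in>kids m n y. J c) = Im (cnj (d y) * (\<Sum>c\<in>kids m n y. d c))"
      unfolding sum_distrib_left Im_sum J_def using tpar_kid[OF below_Tset[OF y]] by (intro sum.cong) auto
    also have "(\<Sum>c\<in>kids m n y. d c) = - d (tpar m n y) + of_real (tpot k q y) * d y - lam * d y"
      using eq[OF y] by (simp add: algebra_simps)
    also have "Im (cnj (d y) * (- d (tpar m n y) + of_real (tpot k q y) * d y - lam * d y)) = J y - Im lam * (cmod (d y))\<^sup>2"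
      unfolding J_def cmod_power2 by (simp add: power2_eq_square algebra_simps)
    finally show ?thesis by simp
  qed
  define S where "S N = (\<Sum>y\<in>tlevel m n w N. J y)" for N
  have SS: "S N = Im lam * E N + S (Suc N)" for N
    unfolding S_def sum_tlevel_Suc E_def sum_distrib_left sum.distrib[symmetric]
    by (intro sum.cong refl Jy tlevel_below)
  have "tpar m n (w, 0) \<notin> below m n w"
  proof
    assume "tpar m n (w, 0) \<in> below m n w"
    from ex_tlevel[OF w this] obtain j where "tpar m n (w, 0) \<in> tlevel m n w j" ..
    then show False using tdepth_tlevel[of "tpar m n (w, 0)" m n w j] tdepth_tpar[of "(w, 0)" m n] below_Tset[OF below_root] w by force
  qed
  then have S0: "S 0 = 0" by (simp add: S_def J_def out)
  have SE: "S N = - Im lam * (\<Sum>j<N. E j)" for N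
  proof (induction N)
    case (Suc N) then show ?case using SS[of N] by (simp add: algebra_simps)
  qed (simp add: S0)
  have Sb: "\<bar>S (Suc N)\<bar> \<le> E N + E (Suc N)" for N
  proof -
    have ck: "card (kids m n y) \<le> 2" for y
      by (cases y; cases "snd y") (auto simp: kids_def card_insert_if)
    have "\<bar>S (Suc N)\<bar> \<le> (\<Sum>y\<in>tlevel m n w (Suc N). \<bar>J y\<bar>)" unfolding S_def by (rule sum_abs)
    also have "\<dots> \<le> (\<Sum>y\<in>tlevel m n w (Suc N). (cmod (d (tpar m n y)))\<^sup>2 / 2 + (cmod (d y))\<^sup>2 / 2)"
    proof (intro sum_mono)
      fix y
      have "\<bar>J y\<bar> \<le> cmod (d (tpar m n y)) * cmod (d y)"
        unfolding J_def using abs_Im_le_cmod[of "cnj (d (tpar m n y)) * d y"] by (simp add: norm_mult)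
      also have "\<dots> \<le> (cmod (d (tpar m n y)))\<^sup>2 / 2 + (cmod (d y))\<^sup>2 / 2"
        using zero_le_power2[of "cmod (d (tpar m n y)) - cmod (d y)"] by (simp add: power2_eq_square algebra_simps)
      finally show "\<bar>J y\<bar> \<le> (cmod (d (tpar m n y)))\<^sup>2 / 2 + (cmod (d y))\<^sup>2 / 2" .
    qed
    also have "\<dots> = (\<Sum>y\<in>tlevel m n w (Suc N). (cmod (d (tpar m n y)))\<^sup>2 / 2) + E (Suc N) / 2"
      by (simp add: sum.distrib E_def sum_divide_distrib)
    also have "(\<Sum>y\<in>tlevel m n w (Suc N). (cmod (d (tpar m n y)))\<^sup>2 / 2) = (\<Sum>y\<in>tlevel m n w N. \<Sum>c\<in>kids m n y. (cmod (d y))\<^sup>2 / 2)"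
      unfolding sum_tlevel_Suc using tpar_kid[OF below_Tset[OF tlevel_below]] by (intro sum.cong) auto
    also have "\<dots> = (\<Sum>y\<in>tlevel m n w N. real (card (kids m n y)) * ((cmod (d y))\<^sup>2 / 2))" by simp
    also have "\<dots> \<le> (\<Sum>y\<in>tlevel m n w N. 2 * ((cmod (d y))\<^sup>2 / 2))"
      using ck by (intro sum_mono mult_right_mono) (auto simp: of_nat_le_iff[of _ 2, simplified])
    also have "\<dots> = E N" by (simp add: E_def)
    finally show ?thesis using E0[of "Suc N"] by simp
  qed
  have e0: "0 < E 0" using ne by (simp add: E_def d_def)
  have low: "Im lam * E 0 \<le> E N + E (Suc N)" for N
  proof -
    have "E 0 \<le> (\<Sum>j<Suc N. E j)" using E0 by (intro member_le_sum) auto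
    then have "Im lam * E 0 \<le> Im lam * (\<Sum>j<Suc N. E j)" using lam by (intro mult_left_mono) auto
    also have "\<dots> \<le> \<bar>S (Suc N)\<bar>" unfolding SE by simp
    finally show ?thesis using Sb[of N] by linarith
  qed
  have "(\<lambda>N. E N + E (Suc N)) \<longlonglongrightarrow> 0 + 0" by (intro tendsto_add Elim LIMSEQ_Suc)
  then have "Im lam * E 0 \<le> 0 + 0" by (rule LIMSEQ_le_const) (use low in auto)
  then show False using e0 lam by (simp add: mult_le_0_iff)
qed

lemma greenF_eq_rec:
  assumes w: "w \<noteq> []" and lam: "0 < Im lam" and g: "green_rec m n k q lam w g"
  shows "greenF m n k q (w, 0) lam = g (w, 0)"
proof -
  obtain psi where psi: "green_sol m n k q lam w psi" "psi (w, 0) = g (w, 0)"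
    using green_sol_exists[OF assms] by blast
  show ?thesis unfolding greenF_eq[OF w]
  proof (rule the_equality)
    show "\<exists>psi. green_sol m n k q lam w psi \<and> g (w, 0) = psi (w, 0)"
      by (rule exI[of _ psi]) (simp add: psi)
  next
    fix h assume "\<exists>psi. green_sol m n k q lam w psi \<and> h = psi (w, 0)"
    then obtain psi' where psi': "green_sol m n k q lam w psi'" "h = psi' (w, 0)" by (elim exE conjE)
    show "h = g (w, 0)" using green_sol_unique[OF w lam psi'(1) psi(1)] psi' psi(2) by simp
  qed
qed

section \<open>Truncated Green functions and their limit\<close>

definition tpath :: "nat \<Rightarrow> nat \<Rightarrow> bool list \<Rightarrow> nat \<Rightarrow> vtx" where
  "tpath m n u i = (if i < n then (u @ [False], Suc i) else if i < n + m then (u @ [True], Suc (i - n)) else (u, 0))"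

text \<open>The tree is cut N principal generations below u and z is inserted there.
  \<open>tpath\<close> lists the potentials in the order \<open>Phi\<close> consumes them: along
  each edge from the child upwards, starting at index 1 since index 0 is the child, bottom edge
  first and the vertex u last.\<close>

fun trunc :: "nat \<Rightarrow> nat \<Rightarrow> complex \<Rightarrow> complex \<Rightarrow> real \<Rightarrow> (vtx \<Rightarrow> real) \<Rightarrow> nat \<Rightarrow> bool list \<Rightarrow> complex" where
  "trunc m n lam z k q 0 u = z"
| "trunc m n lam z k q (Suc N) u = Phi m n lam (trunc m n lam z k q N (u @ [False])) (trunc m n lam z k q N (u @ [True]))
     (\<lambda>i. k * q (tpath m n u i))"

lemma trunc_pos: "0 < Im z \<Longrightarrow> 0 \<le> Im lam \<Longrightarrow> 0 < Im (trunc m n lam z k q N u)"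
  by (induction N arbitrary: u) (auto intro: Phi_pos)

lemma cmod_Phi_le:
  assumes "0 < Im z1" "0 < Im z2" "0 < Im lam"
  shows "cmod (Phi m n lam z1 z2 Q) \<le> 1 / Im lam"
  unfolding Phi_def join_def
  using chain_pos[OF assms(1), of lam Q n] chain_pos[OF assms(2), of lam "\<lambda>i. Q (n + i)" m] assms
  by (intro norm_neg_inverse_le) auto

lemma cmod_trunc_le:
  assumes "0 < Im z" "0 < Im lam" "cmod z \<le> 1 / Im lam"
  shows "cmod (trunc m n lam z k q N u) \<le> 1 / Im lam"
proof (cases N)
  case (Suc N')
  then show ?thesis using assms by (auto intro!: cmod_Phi_le trunc_pos)
qed (use assms in simp)

lemma chain_nonneg:
  assumes "0 \<le> Im z" "0 < Im lam"
  shows "0 \<le> Im (chain z f lam j)"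
proof (induction j)
  case (Suc j)
  then show ?case unfolding chain.simps using assms by (intro Im_neg_inverse_nonneg) simp
qed (use assms in simp)

lemma tendsto_chain:
  assumes "(f \<longlongrightarrow> z) F" "0 \<le> Im z" "0 < Im lam"
  shows "((\<lambda>x. chain (f x) g lam j) \<longlongrightarrow> chain z g lam j) F"
proof (induction j)
  case (Suc j)
  have "chain z g lam j + lam + 1 - of_real (g j) \<noteq> 0"
    using chain_nonneg[OF assms(2,3), of g j] assms(3) by (auto simp: complex_eq_iff)
  then show ?case unfolding chain.simps using Suc by (intro tendsto_intros) auto
qed (use assms in simp)

lemma tendsto_Phi:
  assumes "(f1 \<longlongrightarrow> z1) F" "(f2 \<longlongrightarrow> z2) F" "0 \<le> Im z1" "0 \<le> Im z2" "0 < Im lam"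
  shows "((\<lambda>x. Phi m n lam (f1 x) (f2 x) Q) \<longlongrightarrow> Phi m n lam z1 z2 Q) F"
proof -
  have "chain z1 Q lam n + chain z2 (\<lambda>i. Q (n + i)) lam m + lam - of_real (Q (n + m)) \<noteq> 0"
    using chain_nonneg[OF assms(3,5), of Q n] chain_nonneg[OF assms(4,5), of "\<lambda>i. Q (n + i)" m] assms(5)
    by (auto simp: complex_eq_iff)
  then show ?thesis unfolding Phi_def join_def using assms by (intro tendsto_intros tendsto_chain) auto
qed

lemma chain_cong: "(\<And>i. i < j \<Longrightarrow> f i = g i) \<Longrightarrow> chain z f lam j = chain z g lam j"
  by (induction j) auto

text \<open>Partial chains interpolate between consecutive principal vertices, where the recursion
  by \<open>Phi\<close> is known; L is indexed by words relative to w.\<close>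

lemma green_rec_from_principal:
  assumes lam: "0 < Im lam" and nn: "\<And>v. 0 \<le> Im (L v)"
    and rec: "\<And>v. L v = Phi m n lam (L (v @ [False])) (L (v @ [True])) (\<lambda>i. k * q (tpath m n (w @ v) i))"
  shows "green_rec m n k q lam w (\<lambda>y. chain (L (drop (length w) (fst y))) (\<lambda>j. k * q (fst y, Suc j)) lam (snd y))"
    (is "green_rec m n k q lam w ?g")
  unfolding green_rec_def
proof (intro ballI conjI)
  fix y assume "y \<in> below m n w"
  then obtain v i where y: "y = (w @ v, i)" by (auto simp: below_def)
  show "0 \<le> Im (?g y)" by (rule chain_nonneg[OF nn lam])
  show "?g y = -1 / ((\<Sum>c\<in>kids m n y. ?g c) + lam - of_real (tpot k q y))"
  proof (cases i)
    case (Suc j)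
    then show ?thesis by (simp add: y kids_simps tpot_def algebra_simps)
  next
    case 0
    have a: "chain (L (v @ [False])) (\<lambda>i. k * q (tpath m n (w @ v) i)) lam n = ?g (w @ v @ [False], n)"
      by (simp, intro chain_cong) (simp add: tpath_def)
    have b: "chain (L (v @ [True])) (\<lambda>i. k * q (tpath m n (w @ v) (n + i))) lam m = ?g (w @ v @ [True], m)"
      by (simp, intro chain_cong) (simp add: tpath_def)
    have "?g y = L v" using 0 y by simp
    also have "\<dots> = -1 / (?g (w @ v @ [False], n) + ?g (w @ v @ [True], m) + lam - of_real (k * q (w @ v, 0)))"
      by (subst rec) (simp only: Phi_def join_def a b, simp add: tpath_def)
    also have "\<dots> = -1 / ((\<Sum>c\<in>kids m n y. ?g c) + lam - of_real (tpot k q y))"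
      using 0 by (simp add: y kids_simps tpot_def add.commute)
    finally show ?thesis .
  qed
qed

text \<open>The truncations are bounded by \<open>1 / Im lam\<close>, and there are countably many
  words, so a diagonal subsequence converges at all principal vertices at once. Any limit solves the
  recursion, and uniqueness of the square summable solution gives the same value along every
  subsequence.\<close>

lemma trunc_tendsto_greenF:
  assumes w: "w \<noteq> []" and lam: "0 < Im lam" and z: "0 < Im z" "cmod z \<le> 1 / Im lam"
  shows "(\<lambda>N. trunc m n lam z k q N w) \<longlonglongrightarrow> greenF m n k q (w, 0) lam"
    and "0 < Im (greenF m n k q (w, 0) lam)"
proof -
  have sub: "l = greenF m n k q (w, 0) lam \<and> 0 < Im l"
    if r: "strict_mono r" and l: "((\<lambda>N. trunc m n lam z k q N w) \<circ> r) \<longlonglongrightarrow> l" for r :: "nat \<Rightarrow> nat" and l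
  proof -
    \<comment> \<open>The level is lowered by the length of v so that \<open>f N v\<close> is one
      \<open>Phi\<close> step from its two children at the same N; this is exact as soon as
      \<open>r N\<close> exceeds the length.\<close>
    define f where "f N v = trunc m n lam z k q (r N - length v) (w @ v)" for N v
    have "norm (f N v) \<le> 1 / Im lam" for N v
      unfolding f_def by (rule cmod_trunc_le[OF z(1) lam z(2)])
    then obtain s where s: "strict_mono (s :: nat \<Rightarrow> nat)" "\<And>v. \<exists>l. (\<lambda>N. f (s N) v) \<longlonglongrightarrow> l"
      using function_convergent_subsequence[of UNIV f "1 / Im lam"] by (metis UNIV_I countableI_type)
    from s(2) obtain L where L: "\<And>v. (\<lambda>N. f (s N) v) \<longlonglongrightarrow> L v" by metis
    have fpos: "0 < Im (f N v)" for N v unfolding f_def using z lam by (intro trunc_pos) auto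
    have nn: "0 \<le> Im (L v)" for v
      using tendsto_Im[OF L[of v]] by (rule LIMSEQ_le_const) (use fpos less_imp_le in blast)
    have rec: "L v = Phi m n lam (L (v @ [False])) (L (v @ [True])) (\<lambda>i. k * q (tpath m n (w @ v) i))" for v
    proof -
      have "(\<lambda>N. Phi m n lam (f (s N) (v @ [False])) (f (s N) (v @ [True])) (\<lambda>i. k * q (tpath m n (w @ v) i)))
         \<longlonglongrightarrow> Phi m n lam (L (v @ [False])) (L (v @ [True])) (\<lambda>i. k * q (tpath m n (w @ v) i))"
        by (intro tendsto_Phi L nn lam)
      moreover have "\<forall>\<^sub>F N in sequentially. Phi m n lam (f (s N) (v @ [False])) (f (s N) (v @ [True])) (\<lambda>i. k * q (tpath m n (w @ v) i)) = f (s N) v"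
      proof (rule eventually_sequentiallyI[of "Suc (length v)"])
        fix N assume N: "Suc (length v) \<le> N"
        have "N \<le> r (s N)" using seq_suble[OF r, of "s N"] seq_suble[OF s(1), of N] by linarith
        then have "r (s N) - length v = Suc (r (s N) - Suc (length v))" using N by simp
        then show "Phi m n lam (f (s N) (v @ [False])) (f (s N) (v @ [True])) (\<lambda>i. k * q (tpath m n (w @ v) i)) = f (s N) v"
          unfolding f_def by simp
      qed
      ultimately have "(\<lambda>N. f (s N) v) \<longlonglongrightarrow> Phi m n lam (L (v @ [False])) (L (v @ [True])) (\<lambda>i. k * q (tpath m n (w @ v) i))"
        by (rule Lim_transform_eventually)
      then show ?thesis using L LIMSEQ_unique by blast
    qed
    have "greenF m n k q (w, 0) lam = L []"
      using greenF_eq_rec[OF w lam green_rec_from_principal[of lam L m n k q w, OF lam nn rec]] by simp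
    moreover have "(\<lambda>N. f (s N) []) \<longlonglongrightarrow> l" using LIMSEQ_subseq_LIMSEQ[OF l s(1)] by (simp add: f_def o_def)
    then have "l = L []" using L LIMSEQ_unique by blast
    \<comment> \<open>The limits are only known to lie in the closed half plane; one recursion step
      with \<open>Im lam > 0\<close> restores strictness.\<close>
    moreover have "0 < Im (L [])"
    proof -
      have "0 < Im (chain (L [False]) f lam n + chain (L [True]) g lam m + lam - of_real x)" for f g x
        using chain_nonneg[OF nn lam, of "[False]" f n] chain_nonneg[OF nn lam, of "[True]" g m] lam by simp
      then show ?thesis by (subst rec) (simp only: Phi_def join_def append_Nil, rule Im_neg_inverse_pos)
    qed
    ultimately show ?thesis by simp
  qed
  have bd: "bounded (range (\<lambda>N. trunc m n lam z k q N w))"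
    unfolding bounded_iff using cmod_trunc_le[OF z(1) lam z(2)] by (intro exI[of _ "1 / Im lam"]) blast
  show "(\<lambda>N. trunc m n lam z k q N w) \<longlonglongrightarrow> greenF m n k q (w, 0) lam"
    by (rule bounded_sequence_limit[OF bd]) (rule sub[THEN conjunct1])
  obtain l r where "strict_mono (r :: nat \<Rightarrow> nat)" "((\<lambda>N. trunc m n lam z k q N w) \<circ> r) \<longlonglongrightarrow> l"
    using bounded_imp_convergent_subsequence[OF bd] by blast
  from sub[OF this] show "0 < Im (greenF m n k q (w, 0) lam)" by metis
qed

section \<open>Laws of the truncated Green functions\<close>

lemma borel_measurable_chain:
  assumes "f \<in> borel_measurable M" "\<And>i. i < j \<Longrightarrow> (\<lambda>x. g x i) \<in> borel_measurable M"
  shows "(\<lambda>x. chain (f x) (g x) lam j) \<in> borel_measurable M"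
  using assms(2)
proof (induction j)
  case 0 then show ?case using assms(1) by simp
next
  case (Suc j)
  have 1: "(\<lambda>x. chain (f x) (g x) lam j) \<in> borel_measurable M" using Suc by auto
  have 2: "(\<lambda>x. complex_of_real (g x j)) \<in> borel_measurable M"
  proof -
    from Suc.prems[of j] have [measurable]: "(\<lambda>x. g x j) \<in> borel_measurable M" by simp
    show ?thesis by measurable
  qed
  show ?case unfolding chain.simps
    by (intro borel_measurable_divide borel_measurable_diff borel_measurable_add 1 2 borel_measurable_const)
qed

lemma borel_measurable_Phi:
  assumes "f1 \<in> borel_measurable M" "f2 \<in> borel_measurable M" "\<And>i. i < m + n + 1 \<Longrightarrow> (\<lambda>x. g x i) \<in> borel_measurable M"
  shows "(\<lambda>x. Phi m n lam (f1 x) (f2 x) (g x)) \<in> borel_measurable M"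
proof -
  have 1: "(\<lambda>x. chain (f1 x) (g x) lam n) \<in> borel_measurable M"
    by (rule borel_measurable_chain) (use assms in auto)
  have 2: "(\<lambda>x. chain (f2 x) (\<lambda>i. g x (n + i)) lam m) \<in> borel_measurable M"
    by (rule borel_measurable_chain) (use assms in auto)
  have 3: "(\<lambda>x. complex_of_real (g x (n + m))) \<in> borel_measurable M"
  proof -
    from assms(3)[of "n + m"] have [measurable]: "(\<lambda>x. g x (n + m)) \<in> borel_measurable M" by simp
    show ?thesis by measurable
  qed
  show ?thesis unfolding Phi_def join_def
    by (intro borel_measurable_divide borel_measurable_diff borel_measurable_add 1 2 3 borel_measurable_const)
qed

lemma Phi_cong: "(\<And>i. i < m + n + 1 \<Longrightarrow> Q i = Q' i) \<Longrightarrow> Phi m n lam z1 z2 Q = Phi m n lam z1 z2 Q'"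
  unfolding Phi_def by (auto intro!: arg_cong2[of _ _ _ _ "\<lambda>a b. join lam a b _"] chain_cong)

lemma below_child: "below m n (u @ [b]) \<subseteq> below m n u"
  by (fastforce simp: below_def)

lemma tpath_below: "i < m + n + 1 \<Longrightarrow> tpath m n u i \<in> below m n u"
  by (auto simp: tpath_def below_def Tset_def elen_def)

text \<open>Truncations at sibling vertices depend on disjoint sets of potentials; their
  independence rests on this.\<close>

lemma trunc_local: "(\<And>y. y \<in> below m n u \<Longrightarrow> q y = q' y) \<Longrightarrow> trunc m n lam z k q N u = trunc m n lam z k q' N u"
proof (induction N arbitrary: u)
  case (Suc N)
  have "trunc m n lam z k q N (u @ [b]) = trunc m n lam z k q' N (u @ [b])" for b
    using Suc below_child by blast
  moreover have "Phi m n lam z1 z2 (\<lambda>i. k * q (tpath m n u i)) = Phi m n lam z1 z2 (\<lambda>i. k * q' (tpath m n u i))" for z1 z2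
    using Suc.prems tpath_below by (intro Phi_cong) auto
  ultimately show ?case by simp
qed simp

lemma below_siblings_disjoint: "below m n (u @ [False]) \<inter> below m n (u @ [True]) = {}"
  by (auto simp: below_def)

lemma tpath_not_below_child: "tpath m n u i \<notin> below m n (u @ [b])"
  by (auto simp: tpath_def below_def)

lemma inj_on_tpath: "inj_on (tpath m n u) {..<m + n + 1}"
  by (auto simp: inj_on_def tpath_def split: if_splits)

text \<open>Unlike \<open>indep_var_compose\<close>, this allows the two images to have different types.\<close>
lemma (in prob_space) distr_Pair_indep_var:
  assumes ind: "indep_var S X T Y" and f: "f \<in> measurable S S'" and g: "g \<in> measurable T T'"
  shows "distr M (S' \<Otimes>\<^sub>M T') (\<lambda>x. (f (X x), g (Y x))) = distr M S' (\<lambda>x. f (X x)) \<Otimes>\<^sub>M distr M T' (\<lambda>x. g (Y x))"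
proof -
  have X: "random_variable S X" and Y: "random_variable T Y"
    and XY: "distr M S X \<Otimes>\<^sub>M distr M T Y = distr M (S \<Otimes>\<^sub>M T) (\<lambda>x. (X x, Y x))"
    using ind by (auto simp: indep_var_distribution_eq)
  interpret D: prob_space "distr (distr M T Y) T' g"
    by (intro prob_space.prob_space_distr prob_space_distr Y) (use g in simp)
  have m: "(\<lambda>(x, y). (f x, g y)) \<in> measurable (S \<Otimes>\<^sub>M T) (S' \<Otimes>\<^sub>M T')"
    unfolding case_prod_beta
    by (intro measurable_Pair measurable_compose[OF measurable_fst f] measurable_compose[OF measurable_snd g])
  have "distr M S' (\<lambda>x. f (X x)) \<Otimes>\<^sub>M distr M T' (\<lambda>x. g (Y x)) = distr (distr M S X) S' f \<Otimes>\<^sub>M distr (distr M T Y) T' g"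
    using X Y f g by (simp add: distr_distr o_def)
  also have "\<dots> = distr (distr M S X \<Otimes>\<^sub>M distr M T Y) (S' \<Otimes>\<^sub>M T') (\<lambda>(x, y). (f x, g y))"
    by (rule pair_measure_distr) (use f g D.sigma_finite_measure_axioms in auto)
  also have "\<dots> = distr M (S' \<Otimes>\<^sub>M T') (\<lambda>x. (f (X x), g (Y x)))"
    unfolding XY using X Y m by (subst distr_distr) (auto simp: o_def)
  finally show ?thesis ..
qed

locale real_prob_space = prob_space \<nu> for \<nu> :: "real measure" +
  assumes sets_nu[measurable_cong]: "sets \<nu> = sets borel"
begin

lemma borel_measurable_PiM_component:
  "y \<in> A \<Longrightarrow> (\<lambda>q. q y) \<in> borel_measurable (PiM A (\<lambda>_. \<nu>))"
  using measurable_component_singleton[of y A "\<lambda>_. \<nu>"] measurable_cong_sets[OF refl sets_nu] by blast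

lemma borel_measurable_trunc:
  "below m n u \<subseteq> A \<Longrightarrow> (\<lambda>q. trunc m n lam z k q N u) \<in> borel_measurable (PiM A (\<lambda>_. \<nu>))"
proof (induction N arbitrary: u)
  case (Suc N)
  have "(\<lambda>q. trunc m n lam z k q N (u @ [b])) \<in> borel_measurable (PiM A (\<lambda>_. \<nu>))" for b
    using Suc below_child by blast
  moreover have "(\<lambda>q. k * q (tpath m n u i)) \<in> borel_measurable (PiM A (\<lambda>_. \<nu>))" if "i < m + n + 1" for i
    using Suc.prems tpath_below[OF that] by (intro borel_measurable_times borel_measurable_const borel_measurable_PiM_component) auto
  ultimately show ?case unfolding trunc.simps by (intro borel_measurable_Phi)
qed simp

lemma prob_space_PiM_nu: "prob_space (PiM I (\<lambda>_. \<nu>))"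
  by (rule prob_space_PiM) (rule prob_space_axioms)

lemma indep_vars_PiM_coordinates:
  assumes "I \<noteq> {}"
  shows "prob_space.indep_vars (PiM I (\<lambda>_. \<nu>)) (\<lambda>_. \<nu>) (\<lambda>i q. q i) I"
proof -
  interpret P: prob_space "PiM I (\<lambda>_. \<nu>)" by (rule prob_space_PiM_nu)
  interpret PP: product_prob_space "\<lambda>_. \<nu>" I by unfold_locales
  have "distr (PiM I (\<lambda>_. \<nu>)) (PiM I (\<lambda>_. \<nu>)) (\<lambda>x. \<lambda>i\<in>I. x i) = PiM I (\<lambda>_. \<nu>)"
    using distr_PiM_reindex[of I "\<lambda>_. \<nu>" "\<lambda>i. i" I] prob_space_axioms by auto
  moreover have "PiM I (\<lambda>i. distr (PiM I (\<lambda>_. \<nu>)) \<nu> (\<lambda>x. x i)) = PiM I (\<lambda>_. \<nu>)"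
    using PP.PiM_component by (intro PiM_cong) auto
  ultimately show ?thesis
    by (subst P.indep_vars_iff_distr_eq_PiM'[OF assms]) (auto intro: measurable_component_singleton)
qed

text \<open>By self-similarity the distribution of a truncation depends on its level but not on its
  vertex, so the moment estimate can be run on this sequence of measures instead of on the infinite
  product.\<close>

primrec law :: "nat \<Rightarrow> nat \<Rightarrow> complex \<Rightarrow> complex \<Rightarrow> real \<Rightarrow> nat \<Rightarrow> complex measure" where
  "law m n lam z k 0 = return borel z"
| "law m n lam z k (Suc N) = distr ((law m n lam z k N \<Otimes>\<^sub>M law m n lam z k N) \<Otimes>\<^sub>M PiM {..<m+n+1} (\<lambda>_. \<nu>)) borel
     (\<lambda>((z1, z2), Q). Phi m n lam z1 z2 (\<lambda>i. k * Q i))"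

lemma Phi_measurable_product:
  assumes "sets L = sets borel"
  shows "(\<lambda>((z1, z2), Q). Phi m n lam z1 z2 (\<lambda>i. k * Q i)) \<in> borel_measurable ((L \<Otimes>\<^sub>M L) \<Otimes>\<^sub>M PiM {..<m+n+1} (\<lambda>_. \<nu>))"
proof -
  note [measurable_cong] = assms
  have 1: "(\<lambda>x. fst (fst x)) \<in> borel_measurable ((L \<Otimes>\<^sub>M L) \<Otimes>\<^sub>M PiM {..<m+n+1} (\<lambda>_. \<nu>))" by measurable
  have 2: "(\<lambda>x. snd (fst x)) \<in> borel_measurable ((L \<Otimes>\<^sub>M L) \<Otimes>\<^sub>M PiM {..<m+n+1} (\<lambda>_. \<nu>))" by measurable
  have 3: "(\<lambda>x. k * snd x i) \<in> borel_measurable ((L \<Otimes>\<^sub>M L) \<Otimes>\<^sub>M PiM {..<m+n+1} (\<lambda>_. \<nu>))" if "i < m + n + 1" for i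
    using that by (intro borel_measurable_times borel_measurable_const measurable_compose[OF measurable_snd borel_measurable_PiM_component]) auto
  show ?thesis unfolding case_prod_unfold by (rule borel_measurable_Phi[OF 1 2 3])
qed

text \<open>The two child subtrees and the block of \<open>tpath\<close> use pairwise disjoint
  coordinates. Independence is applied twice, between the siblings and then between the pair and the
  block.\<close>

lemma distr_trunc:
  "distr (PiM (Tset m n) (\<lambda>_. \<nu>)) borel (\<lambda>q. trunc m n lam z k q N u) = law m n lam z k N"
proof (induction N arbitrary: u)
  case 0
  interpret P: prob_space "PiM (Tset m n) (\<lambda>_. \<nu>)" by (rule prob_space_PiM_nu)
  show ?case by (simp add: P.distr_const)
next
  case (Suc N)
  define Om where "Om = PiM (Tset m n) (\<lambda>_. \<nu>)"
  define K where "K = PiM {..<m+n+1} (\<lambda>_. \<nu>)"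
  interpret P: prob_space Om unfolding Om_def by (rule prob_space_PiM_nu)
  have T: "Tset m n \<noteq> {}" by (auto simp: Tset_def)
  note ind = indep_vars_PiM_coordinates[OF T, folded Om_def]
  define X where "X b q = trunc m n lam z k q N (u @ [b])" for b q
  define A where "A b = below m n (u @ [b])" for b
  define Y where "Y q = (\<lambda>i\<in>{..<m+n+1}. q (tpath m n u i))" for q :: "vtx \<Rightarrow> real"
  have sub: "below m n v \<subseteq> Tset m n" for v using below_Tset by blast
  have Xm: "X b \<in> borel_measurable (PiM B (\<lambda>_. \<nu>))" if "A b \<subseteq> B" for b B
    using borel_measurable_trunc that unfolding X_def A_def by blast
  have Xloc: "X b q = X b (restrict q B)" if "A b \<subseteq> B" for b q B
    unfolding X_def using that by (intro trunc_local) (auto simp: A_def)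
  have "P.indep_var (PiM (A False) (\<lambda>_. \<nu>)) (\<lambda>q. restrict q (A False)) (PiM (A True) (\<lambda>_. \<nu>)) (\<lambda>q. restrict q (A True))"
    using P.indep_var_restrict[OF ind, of "A False" "A True"] below_siblings_disjoint[of m n u] sub by (simp add: A_def)
  from P.distr_Pair_indep_var[OF this Xm[OF order_refl] Xm[OF order_refl]]
  have d1: "distr Om borel (X False) \<Otimes>\<^sub>M distr Om borel (X True) = distr Om (borel \<Otimes>\<^sub>M borel) (\<lambda>q. (X False q, X True q))"
    by (simp add: Xloc[OF order_refl, symmetric])
  define B where "B = A False \<union> A True"
  define C where "C = tpath m n u ` {..<m+n+1}"
  have disj: "B \<inter> C = {}" using tpath_not_below_child by (auto simp: A_def B_def C_def)
  have CT: "C \<subseteq> Tset m n" "B \<subseteq> Tset m n"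
    unfolding A_def B_def C_def using sub tpath_below by blast+
  have i2: "P.indep_var (PiM B (\<lambda>_. \<nu>)) (\<lambda>q. restrict q B) (PiM C (\<lambda>_. \<nu>)) (\<lambda>q. restrict q C)"
    using P.indep_var_restrict[OF ind disj] CT by simp
  have m1: "(\<lambda>q. (X False q, X True q)) \<in> measurable (PiM B (\<lambda>_. \<nu>)) (borel \<Otimes>\<^sub>M borel)"
    by (intro measurable_Pair Xm) (auto simp: B_def)
  have m2: "Y \<in> measurable (PiM C (\<lambda>_. \<nu>)) K"
    unfolding Y_def K_def by (intro measurable_restrict measurable_component_singleton) (auto simp: C_def)
  have "X False q = X False (restrict q B)" "X True q = X True (restrict q B)" "Y q = Y (restrict q C)" for q
    by (intro Xloc; simp add: B_def)+ (auto simp: Y_def C_def fun_eq_iff)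
  note rr = this[symmetric]
  have d2: "distr Om (borel \<Otimes>\<^sub>M borel) (\<lambda>q. (X False q, X True q)) \<Otimes>\<^sub>M distr Om K Y
      = distr Om ((borel \<Otimes>\<^sub>M borel) \<Otimes>\<^sub>M K) (\<lambda>q. ((X False q, X True q), Y q))"
    using P.distr_Pair_indep_var[OF i2 m1 m2] unfolding rr by simp
  have d3: "distr Om K Y = K"
    unfolding Om_def K_def Y_def
    by (rule distr_PiM_reindex[of "Tset m n" "\<lambda>_. \<nu>"]) (use prob_space_axioms inj_on_tpath tpath_below sub in \<open>blast+\<close>)
  have XX: "distr Om borel (X b) = law m n lam z k N" for b
    using Suc.IH by (simp add: X_def[abs_def] Om_def)
  have sl: "sets (law m n lam z k N) = sets borel" by (cases N) auto
  have D: "(law m n lam z k N \<Otimes>\<^sub>M law m n lam z k N) \<Otimes>\<^sub>M K = distr Om ((borel \<Otimes>\<^sub>M borel) \<Otimes>\<^sub>M K) (\<lambda>q. ((X False q, X True q), Y q))"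
    using d1 d2 unfolding d3 XX by simp
  have mm: "(\<lambda>q. ((X False q, X True q), Y q)) \<in> measurable Om ((borel \<Otimes>\<^sub>M borel) \<Otimes>\<^sub>M K)"
  proof (intro measurable_Pair)
    show "X False \<in> borel_measurable Om" "X True \<in> borel_measurable Om"
      unfolding Om_def using Xm sub by (simp_all add: A_def)
    show "Y \<in> measurable Om K"
      unfolding Y_def K_def Om_def using tpath_below sub by (intro measurable_restrict measurable_component_singleton) blast
  qed
  have "law m n lam z k (Suc N) = distr (distr Om ((borel \<Otimes>\<^sub>M borel) \<Otimes>\<^sub>M K) (\<lambda>q. ((X False q, X True q), Y q))) borel
     (\<lambda>((z1, z2), Q). Phi m n lam z1 z2 (\<lambda>i. k * Q i))"
    unfolding law.simps K_def[symmetric] D ..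
  also have "\<dots> = distr Om borel ((\<lambda>((z1, z2), Q). Phi m n lam z1 z2 (\<lambda>i. k * Q i)) \<circ> (\<lambda>q. ((X False q, X True q), Y q)))"
    using Phi_measurable_product[of borel m n lam k] mm unfolding K_def by (intro distr_distr) auto
  also have "(\<lambda>((z1, z2), Q). Phi m n lam z1 z2 (\<lambda>i. k * Q i)) \<circ> (\<lambda>q. ((X False q, X True q), Y q)) = (\<lambda>q. trunc m n lam z k q (Suc N) u)"
    unfolding fun_eq_iff by (auto simp: X_def Y_def intro!: Phi_cong)
  finally show ?case by (simp add: Om_def)
qed

lemma law_facts:
  assumes "0 < Im z" "0 \<le> Im lam"
  shows "prob_space (law m n lam z k N)" "sets (law m n lam z k N) = sets borel" "AE x in law m n lam z k N. 0 < Im x"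
proof -
  interpret P: prob_space "PiM (Tset m n) (\<lambda>_. \<nu>)" by (rule prob_space_PiM_nu)
  have m: "(\<lambda>q. trunc m n lam z k q N []) \<in> borel_measurable (PiM (Tset m n) (\<lambda>_. \<nu>))"
    using below_Tset by (intro borel_measurable_trunc) blast
  note D = distr_trunc[of m n lam z k N "[]", symmetric]
  show "prob_space (law m n lam z k N)" unfolding D by (rule P.prob_space_distr[OF m])
  show "sets (law m n lam z k N) = sets borel" unfolding D by simp
  have "{x \<in> space borel. 0 < Im x} \<in> sets borel" by measurable
  then show "AE x in law m n lam z k N. 0 < Im x" unfolding D
    using m assms by (subst AE_distr_iff) (auto intro: trunc_pos)
qed

end

section \<open>Moments\<close>

text \<open>The price charged when some potential leaves the range in which contraction holds: there
  only the factor of \<open>Phi_swap_crude\<close> is available.\<close>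

definition overflow :: "real \<Rightarrow> real \<Rightarrow> real \<Rightarrow> nat \<Rightarrow> (nat \<Rightarrow> real) \<Rightarrow> ennreal" where
  "overflow c \<kappa> p M Q = (if \<forall>i<M. \<bar>Q i\<bar> \<le> \<kappa> then 0 else ennreal (theta c M Q powr (1 + p)))"

context real_prob_space
begin

lemma moment_finite:
  assumes p0: "0 < p0" and mom: "(\<integral>\<^sup>+ t. ennreal (\<bar>t\<bar> powr (2 * (1 + p0))) \<partial>\<nu>) < \<infinity>"
    and p: "0 < p" "p < p0" and c: "0 < c"
  shows "(\<integral>\<^sup>+ t. ennreal ((1 + \<bar>t\<bar> / c) powr (2 * (1 + p))) \<partial>\<nu>) < \<infinity>"
proof -
  define r where "r = 2 * (1 + p)"
  define r0 where "r0 = 2 * (1 + p0)"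
  define b where "b = 1 + 1 / c"
  have b: "1 \<le> b" using c by (simp add: b_def)
  have *: "(1 + \<bar>t\<bar> / c) powr r \<le> b powr r + b powr r * \<bar>t\<bar> powr r0" for t :: real
  proof (cases "\<bar>t\<bar> \<le> 1")
    case True
    then have "1 + \<bar>t\<bar> / c \<le> b" using c by (simp add: b_def divide_right_mono)
    then have "(1 + \<bar>t\<bar> / c) powr r \<le> b powr r" using p c by (intro powr_mono2) (auto simp: r_def)
    then show ?thesis by (simp add: add_increasing2)
  next
    case False
    then have "1 + \<bar>t\<bar> / c \<le> b * \<bar>t\<bar>" using c by (simp add: b_def distrib_right)
    then have "(1 + \<bar>t\<bar> / c) powr r \<le> (b * \<bar>t\<bar>) powr r" using p c by (intro powr_mono2) (auto simp: r_def)
    also have "\<dots> = b powr r * \<bar>t\<bar> powr r" by (rule powr_mult)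
    also have "\<dots> \<le> b powr r * \<bar>t\<bar> powr r0" using False p by (intro mult_left_mono powr_mono) (auto simp: r_def r0_def)
    finally show ?thesis by (simp add: add_increasing)
  qed
  have "(\<integral>\<^sup>+ t. ennreal ((1 + \<bar>t\<bar> / c) powr r) \<partial>\<nu>) 
      \<le> (\<integral>\<^sup>+ t. ennreal (b powr r) + ennreal (b powr r) * ennreal (\<bar>t\<bar> powr r0) \<partial>\<nu>)"
    using * by (intro nn_integral_mono) (simp add: ennreal_mult[symmetric] ennreal_plus[symmetric] del: ennreal_plus)
  also have "\<dots> = ennreal (b powr r) + ennreal (b powr r) * (\<integral>\<^sup>+ t. ennreal (\<bar>t\<bar> powr r0) \<partial>\<nu>)"
    by (subst nn_integral_add) (auto simp: nn_integral_cmult emeasure_space_1)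
  also have "\<dots> < \<infinity>" using mom by (simp add: r0_def ennreal_mult_less_top)
  finally show ?thesis by (simp add: r_def)
qed

lemma theta_moment_finite:
  assumes p0: "0 < p0" and mom: "(\<integral>\<^sup>+ t. ennreal (\<bar>t\<bar> powr (2 * (1 + p0))) \<partial>\<nu>) < \<infinity>"
    and p: "0 < p" "p < p0" and c: "0 < c"
  shows "(\<integral>\<^sup>+ Q. ennreal (theta c M Q powr (1 + p)) \<partial>PiM {..<M} (\<lambda>_. \<nu>)) < \<infinity>"
proof -
  interpret S: product_sigma_finite "\<lambda>_::nat. \<nu>" by unfold_locales
  have "theta c M Q powr (1 + p) = (\<Prod>i<M. (1 + \<bar>Q i\<bar> / c) powr (2 * (1 + p)))" for Q
  proof (induction M)
    case (Suc M)
    have "((1 + \<bar>Q M\<bar> / c)\<^sup>2) powr (1 + p) = (1 + \<bar>Q M\<bar> / c) powr (2 * (1 + p))"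
    proof -
      have "0 < 1 + \<bar>Q M\<bar> / c" using c by (simp add: add_pos_nonneg)
      then have "(1 + \<bar>Q M\<bar> / c)\<^sup>2 = (1 + \<bar>Q M\<bar> / c) powr 2" by simp
      then show ?thesis by (simp only: powr_powr)
    qed
    then show ?case using Suc by (simp add: theta_def powr_mult)
  qed (simp add: theta_def)
  then have "(\<integral>\<^sup>+ Q. ennreal (theta c M Q powr (1 + p)) \<partial>PiM {..<M} (\<lambda>_. \<nu>))
      = (\<integral>\<^sup>+ Q. (\<Prod>i<M. ennreal ((1 + \<bar>Q i\<bar> / c) powr (2 * (1 + p)))) \<partial>PiM {..<M} (\<lambda>_. \<nu>))"
    by (simp add: prod_ennreal)
  also have "\<dots> = (\<Prod>i<M. \<integral>\<^sup>+ t. ennreal ((1 + \<bar>t\<bar> / c) powr (2 * (1 + p))) \<partial>\<nu>)"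
    by (rule S.product_nn_integral_prod) auto
  also have "\<dots> < \<infinity>" using moment_finite[OF assms] by (simp add: less_top[symmetric] ennreal_prod_eq_top del: prod_constant)
  finally show ?thesis .
qed

lemma borel_measurable_theta: "(\<lambda>Q. theta c M (\<lambda>i. k * Q i)) \<in> borel_measurable (PiM {..<M} (\<lambda>_. \<nu>))"
  unfolding theta_def
  by (intro borel_measurable_prod borel_measurable_power borel_measurable_add borel_measurable_divide borel_measurable_abs
      borel_measurable_times borel_measurable_const borel_measurable_PiM_component)

lemma borel_measurable_overflow: "(\<lambda>Q. overflow c \<kappa> p M (\<lambda>i. k * Q i)) \<in> borel_measurable (PiM {..<M} (\<lambda>_. \<nu>))"
proof -
  have "{Q \<in> space (PiM {..<M} (\<lambda>_. \<nu>)). \<forall>i\<in>{..<M}. \<bar>k * Q i\<bar> \<le> \<kappa>} \<in> sets (PiM {..<M} (\<lambda>_. \<nu>))"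
    by (intro sets.sets_Collect_finite_All borel_measurable_le borel_measurable_abs borel_measurable_times
        borel_measurable_PiM_component borel_measurable_const) auto
  moreover have "(\<lambda>Q. ennreal (theta c M (\<lambda>i. k * Q i) powr (1 + p))) \<in> borel_measurable (PiM {..<M} (\<lambda>_. \<nu>))"
    using borel_measurable_theta[of c M k] by measurable
  ultimately have "(\<lambda>Q. if \<forall>i\<in>{..<M}. \<bar>k * Q i\<bar> \<le> \<kappa> then 0 else ennreal (theta c M (\<lambda>i. k * Q i) powr (1 + p)))
     \<in> borel_measurable (PiM {..<M} (\<lambda>_. \<nu>))" by (intro measurable_If) auto
  then show ?thesis by (simp only: overflow_def[abs_def] Ball_def lessThan_iff)
qed

text \<open>Cutting at a fixed level N of the unscaled potentials gives an integral that tends to 0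
  by dominated convergence, with the \<open>theta\<close> moment as majorant. One such N then
  handles all small k simultaneously.\<close>

lemma large_potential_negligible:
  assumes p0: "0 < p0" and mom: "(\<integral>\<^sup>+ t. ennreal (\<bar>t\<bar> powr (2 * (1 + p0))) \<partial>\<nu>) < \<infinity>"
    and p: "0 < p" "p < p0" and c: "0 < c" and \<kappa>: "0 < \<kappa>" and d: "0 < d"
  shows "\<exists>k0>0. \<forall>k. \<bar>k\<bar> < k0 \<longrightarrow> (\<integral>\<^sup>+ Q. overflow c \<kappa> p M (\<lambda>i. k * Q i)
     \<partial>PiM {..<M} (\<lambda>_. \<nu>)) \<le> ennreal d"
proof -
  define K where "K = PiM {..<M} (\<lambda>_. \<nu>)"
  define H where "H Q = ennreal (theta c M Q powr (1 + p))" for Q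
  define u where "u N Q = overflow c (real N) p M Q" for N Q
  have Hm: "H \<in> borel_measurable K" 
    unfolding H_def K_def using borel_measurable_theta[of c M 1] by simp
  have um: "u N \<in> borel_measurable K" for N
    using borel_measurable_overflow[of c "real N" p M 1] by (simp add: u_def[abs_def] K_def)
  have "(\<lambda>N. \<integral>\<^sup>+ Q. u N Q \<partial>K) \<longlonglongrightarrow> (\<integral>\<^sup>+ Q. 0 \<partial>K)"
  proof (rule nn_integral_dominated_convergence[where w=H])
    show "AE Q in K. (\<lambda>N. u N Q) \<longlonglongrightarrow> 0"
    proof (intro AE_I2)
      fix Q :: "nat \<Rightarrow> real"
      obtain B where B: "\<And>i. i < M \<Longrightarrow> \<bar>Q i\<bar> \<le> B" 
        using that[of "\<Sum>i<M. \<bar>Q i\<bar>"] member_le_sum[of _ "{..<M}" "\<lambda>i. \<bar>Q i\<bar>"] by auto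
      obtain N0 where N0: "B \<le> real N0" using real_arch_simple by blast
      have "\<forall>\<^sub>F N in sequentially. u N Q = 0"
      proof (rule eventually_sequentiallyI[of N0])
        fix N assume "N0 \<le> N"
        then have "\<forall>i<M. \<bar>Q i\<bar> \<le> real N" using B N0 by (meson of_nat_mono order_trans)
        then show "u N Q = 0" by (simp add: u_def overflow_def)
      qed
      then show "(\<lambda>N. u N Q) \<longlonglongrightarrow> 0" by (rule tendsto_eventually)
    qed
    show "integral\<^sup>N K H < \<infinity>" unfolding H_def K_def by (rule theta_moment_finite[OF p0 mom p c])
    show "AE Q in K. u N Q \<le> H Q" for N by (simp add: u_def H_def overflow_def)
  qed (rule um Hm borel_measurable_const)+
  then have "(\<lambda>N. \<integral>\<^sup>+ Q. u N Q \<partial>K) \<longlonglongrightarrow> 0" by simp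
  then have "\<forall>\<^sub>F N in sequentially. (\<integral>\<^sup>+ Q. u N Q \<partial>K) < ennreal d" using d by (intro order_tendstoD(2)) auto
  then obtain N where N: "(\<integral>\<^sup>+ Q. u N Q \<partial>K) < ennreal d" by (auto simp: eventually_sequentially)
  \<comment> \<open>The bound 1 gives \<open>theta\<close> of k Q at most \<open>theta\<close> of Q;
    the other bound makes every \<open>k * Q i\<close> at most \<kappa> wherever the Q i are at most
    N.\<close>
  define k0 where "k0 = min 1 (\<kappa> / (real N + 1))"
  have k0: "0 < k0" using \<kappa> by (simp add: k0_def)
  have "(\<integral>\<^sup>+ Q. overflow c \<kappa> p M (\<lambda>i. k * Q i) \<partial>K) \<le> ennreal d"
    if k: "\<bar>k\<bar> < k0" for k
  proof -
    have "overflow c \<kappa> p M (\<lambda>i. k * Q i) \<le> u N Q" for Q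
    proof (cases "\<forall>i<M. \<bar>Q i\<bar> \<le> real N")
      case True
      have "\<bar>k * Q i\<bar> \<le> \<kappa>" if "i < M" for i
      proof -
        have "\<bar>k * Q i\<bar> \<le> \<kappa> / (real N + 1) * real N"
          unfolding abs_mult using k True that \<kappa> by (intro mult_mono) (auto simp: k0_def)
        also have "\<dots> \<le> \<kappa>" using \<kappa> by (simp add: field_simps)
        finally show ?thesis .
      qed
      then show ?thesis by (simp add: overflow_def)
    next
      case False
      have "theta c M (\<lambda>i. k * Q i) \<le> theta c M Q"
        unfolding theta_def
      proof (intro prod_mono conjI power_mono add_mono divide_right_mono)
        fix i
        show "\<bar>k * Q i\<bar> \<le> \<bar>Q i\<bar>" using k by (simp add: k0_def abs_mult mult_left_le_one_le)
      qed (use c in auto)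
      then have "theta c M (\<lambda>i. k * Q i) powr (1 + p) \<le> theta c M Q powr (1 + p)"
        using p theta_ge_1[OF c, of M "\<lambda>i. k * Q i"] by (intro powr_mono2) auto
      then have "overflow c \<kappa> p M (\<lambda>i. k * Q i) \<le> H Q" by (simp add: overflow_def H_def ennreal_leI)
      moreover have "u N Q = H Q" using False by (simp only: u_def H_def overflow_def if_False)
      ultimately show ?thesis by simp
    qed
    then have "(\<integral>\<^sup>+ Q. overflow c \<kappa> p M (\<lambda>i. k * Q i) \<partial>K) \<le> (\<integral>\<^sup>+ Q. u N Q \<partial>K)"
      by (intro nn_integral_mono)
    with N show ?thesis by simp
  qed
  then show ?thesis using k0 unfolding K_def by blast
qed

text \<open>As the branches are independent with the same law, exchanging them preserves the moment
  I of the next law, so 2I is the integral of the sum over both orders. It is at most (1 -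
  \<delta>/2) 2B + C, which does not exceed 2B when C is at most \<delta> B; hence one B serves all
  levels.\<close>

lemma law_moment_step:
  assumes nd: "nondeg m n c lam z" and c: "0 < c" and p: "0 < p" and \<delta>: "0 < \<delta>" "\<delta> < 1" and C: "0 \<le> C"
    and contr: "swap_contracts m n p \<delta> \<kappa> C lam z"
    and small: "(\<integral>\<^sup>+ Q. overflow c \<kappa> p (m+n+1) (\<lambda>i. k * Q i)
     \<partial>PiM {..<m+n+1} (\<lambda>_. \<nu>)) \<le> ennreal (\<delta> / 2)"
    and B: "(\<integral>\<^sup>+ x. ennreal (sw z x powr (1 + p)) \<partial>law m n lam z k N) \<le> ennreal B" "C / \<delta> \<le> B"
  shows "(\<integral>\<^sup>+ x. ennreal (sw z x powr (1 + p)) \<partial>law m n lam z k (Suc N)) \<le> ennreal B"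
proof -
  define L where "L = law m n lam z k N"
  define K where "K = PiM {..<m+n+1} (\<lambda>_. \<nu>)"
  define f where "f x = ennreal (sw z x powr (1 + p))" for x
  define P where "P z1 z2 Q = Phi m n lam z1 z2 (\<lambda>i. k * Q i)" for z1 z2 and Q :: "nat \<Rightarrow> real"
  \<comment> \<open>A common factor for both regimes; its overflow part integrates to at most
    \<delta>/2 and so consumes at most half of the contraction.\<close>
  define g where "g Q = ennreal (1 - \<delta>) + overflow c \<kappa> p (m+n+1) (\<lambda>i. k * Q i)" for Q
  note D = nondegD[OF nd]
  have lam: "0 \<le> Im lam" using D by simp
  note LF = law_facts[OF D(1) lam, of m n k N, folded L_def]
  interpret L: prob_space L by (rule LF)
  interpret K: prob_space K unfolding K_def by (rule prob_space_PiM_nu)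
  interpret LL: pair_prob_space L L ..
  interpret LK: pair_sigma_finite "L \<Otimes>\<^sub>M L" K ..
  note [measurable_cong] = LF(2)
  have fm[measurable]: "f \<in> borel_measurable borel" unfolding f_def sw_def by measurable
  have Pm: "(\<lambda>((z1, z2), Q). P z1 z2 Q) \<in> borel_measurable ((L \<Otimes>\<^sub>M L) \<Otimes>\<^sub>M K)"
    unfolding P_def K_def by (rule Phi_measurable_product[OF LF(2)])
  have fPm: "(\<lambda>w. f (P (fst (fst w)) (snd (fst w)) (snd w))) \<in> borel_measurable ((L \<Otimes>\<^sub>M L) \<Otimes>\<^sub>M K)"
    using measurable_compose[OF Pm fm] by (simp add: case_prod_unfold)
  have Pm': "(\<lambda>w. P (snd (fst w)) (fst (fst w)) (snd w)) \<in> borel_measurable ((L \<Otimes>\<^sub>M L) \<Otimes>\<^sub>M K)"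
  proof -
    have "(\<lambda>w. ((snd (fst w), fst (fst w)), snd w)) \<in> measurable ((L \<Otimes>\<^sub>M L) \<Otimes>\<^sub>M K) ((L \<Otimes>\<^sub>M L) \<Otimes>\<^sub>M K)" by measurable
    from measurable_compose[OF this Pm] show ?thesis by simp
  qed
  have fPm': "(\<lambda>w. f (P (snd (fst w)) (fst (fst w)) (snd w))) \<in> borel_measurable ((L \<Otimes>\<^sub>M L) \<Otimes>\<^sub>M K)"
    using measurable_compose[OF Pm' fm] by simp
  have om: "(\<lambda>Q. overflow c \<kappa> p (m+n+1) (\<lambda>i. k * Q i)) \<in> borel_measurable K"
    unfolding K_def by (rule borel_measurable_overflow)
  then have gm: "g \<in> borel_measurable K" unfolding g_def[abs_def] by (intro borel_measurable_add) auto
  have g_int: "(\<integral>\<^sup>+ Q. g Q \<partial>K) \<le> ennreal (1 - \<delta> / 2)"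
  proof -
    have "(\<integral>\<^sup>+ Q. g Q \<partial>K) = ennreal (1 - \<delta>) + (\<integral>\<^sup>+ Q. overflow c \<kappa> p (m+n+1) (\<lambda>i. k * Q i) \<partial>K)"
      unfolding g_def using om by (subst nn_integral_add) (auto simp: K.emeasure_space_1)
    also have "\<dots> \<le> ennreal (1 - \<delta>) + ennreal (\<delta> / 2)" using small by (simp add: K_def add_left_mono)
    also have "\<dots> = ennreal (1 - \<delta> / 2)" using \<delta> by (simp add: ennreal_plus[symmetric] del: ennreal_plus)
    finally show ?thesis .
  qed
  define I where "I = (\<integral>\<^sup>+ x. f x \<partial>law m n lam z k (Suc N))"
  have I1: "I = (\<integral>\<^sup>+ w. f (P (fst (fst w)) (snd (fst w)) (snd w)) \<partial>((L \<Otimes>\<^sub>M L) \<Otimes>\<^sub>M K))"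
    unfolding I_def law.simps L_def[symmetric] K_def[symmetric]
    by (subst nn_integral_distr) (use Pm in \<open>auto simp: P_def case_prod_unfold\<close>)
  also have "\<dots> = (\<integral>\<^sup>+ y. \<integral>\<^sup>+ Q. f (P (fst y) (snd y) Q) \<partial>K \<partial>(L \<Otimes>\<^sub>M L))"
    using K.nn_integral_fst[OF fPm] by simp
  finally have I2: "I = (\<integral>\<^sup>+ y. \<integral>\<^sup>+ Q. f (P (fst y) (snd y) Q) \<partial>K \<partial>(L \<Otimes>\<^sub>M L))" .
  have hm: "(\<lambda>y. \<integral>\<^sup>+ Q. f (P (fst y) (snd y) Q) \<partial>K) \<in> borel_measurable (L \<Otimes>\<^sub>M L)"
    using K.borel_measurable_nn_integral_fst[OF fPm] by simp
  \<comment> \<open>The product of two copies of one law is invariant under exchange of the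
    coordinates.\<close>
  have "I = (\<integral>\<^sup>+ y. \<integral>\<^sup>+ Q. f (P (fst y) (snd y) Q) \<partial>K \<partial>(distr (L \<Otimes>\<^sub>M L) (L \<Otimes>\<^sub>M L) (\<lambda>(x, y). (y, x))))"
    unfolding I2 using LL.distr_pair_swap by simp
  also have "\<dots> = (\<integral>\<^sup>+ y. \<integral>\<^sup>+ Q. f (P (snd y) (fst y) Q) \<partial>K \<partial>(L \<Otimes>\<^sub>M L))"
    by (subst nn_integral_distr) (use hm in \<open>auto simp: case_prod_unfold\<close>)
  also have "\<dots> = (\<integral>\<^sup>+ w. f (P (snd (fst w)) (fst (fst w)) (snd w)) \<partial>((L \<Otimes>\<^sub>M L) \<Otimes>\<^sub>M K))"
    using K.nn_integral_fst[OF fPm'] by simp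
  finally have I3: "I = (\<integral>\<^sup>+ w. f (P (snd (fst w)) (fst (fst w)) (snd w)) \<partial>((L \<Otimes>\<^sub>M L) \<Otimes>\<^sub>M K))" .
  have "I + I = (\<integral>\<^sup>+ w. f (P (fst (fst w)) (snd (fst w)) (snd w)) + f (P (snd (fst w)) (fst (fst w)) (snd w)) \<partial>((L \<Otimes>\<^sub>M L) \<Otimes>\<^sub>M K))"
    by (subst nn_integral_add[OF fPm fPm']) (simp add: I1[symmetric] I3[symmetric])
  also have "\<dots> = (\<integral>\<^sup>+ y. \<integral>\<^sup>+ Q. f (P (fst y) (snd y) Q) + f (P (snd y) (fst y) Q) \<partial>K \<partial>(L \<Otimes>\<^sub>M L))"
    using K.nn_integral_fst[OF borel_measurable_add[OF fPm fPm']] by simp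
  also have "\<dots> \<le> (\<integral>\<^sup>+ y. ennreal (1 - \<delta> / 2) * (f (fst y) + f (snd y)) + ennreal C \<partial>(L \<Otimes>\<^sub>M L))"
  proof (rule nn_integral_mono_AE)
    have "AE y in L \<Otimes>\<^sub>M L. 0 < Im (fst y) \<and> 0 < Im (snd y)"
    proof -
      have "AE x in L. AE y in L. 0 < Im x \<and> 0 < Im y" using LF(3) by auto
      moreover have "{x \<in> space (L \<Otimes>\<^sub>M L). 0 < Im (fst x) \<and> 0 < Im (snd x)} \<in> sets (L \<Otimes>\<^sub>M L)" by measurable
      ultimately show ?thesis using LL.AE_pair_iff[of "\<lambda>x y. 0 < Im x \<and> 0 < Im y"] by simp
    qed
    then show "AE y in L \<Otimes>\<^sub>M L. (\<integral>\<^sup>+ Q. f (P (fst y) (snd y) Q) + f (P (snd y) (fst y) Q) \<partial>K) \<le> ennreal (1 - \<delta> / 2) * (f (fst y) + f (snd y)) + ennreal C"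
    proof eventually_elim
      case (elim y)
      define V where "V = sw z (fst y) powr (1 + p) + sw z (snd y) powr (1 + p)"
      have V: "0 \<le> V" by (simp add: V_def)
      have pt: "f (P (fst y) (snd y) Q) + f (P (snd y) (fst y) Q) \<le> g Q * ennreal V + ennreal C" for Q
      proof (cases "\<forall>i<m+n+1. \<bar>k * Q i\<bar> \<le> \<kappa>")
        case True
        have "f (P (fst y) (snd y) Q) + f (P (snd y) (fst y) Q) \<le> ennreal ((1 - \<delta>) * V + C)"
          unfolding f_def P_def V_def using contr True elim
          by (simp add: swap_contracts_def swap_sum_def ennreal_plus[symmetric] ennreal_leI del: ennreal_plus)
        also have "\<dots> = ennreal (1 - \<delta>) * ennreal V + ennreal C" using \<delta> C V by (simp add: ennreal_mult)
        finally show ?thesis using True by (simp add: g_def overflow_def)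
      next
        case False
        have "f (P (fst y) (snd y) Q) + f (P (snd y) (fst y) Q) \<le> ennreal (theta c (m+n+1) (\<lambda>i. k * Q i) powr (1 + p) * V)"
          unfolding f_def P_def V_def using Phi_swap_crude[OF nd c _ _ p] elim
          by (simp add: swap_sum_def ennreal_plus[symmetric] ennreal_leI del: ennreal_plus)
        also have "\<dots> = ennreal (theta c (m+n+1) (\<lambda>i. k * Q i) powr (1 + p)) * ennreal V" using V by (simp add: ennreal_mult)
        also have "\<dots> \<le> g Q * ennreal V" using False by (intro mult_right_mono) (auto simp: g_def overflow_def)
        also have "\<dots> \<le> g Q * ennreal V + ennreal C" by simp
        finally show ?thesis .
      qed
      then have "(\<integral>\<^sup>+ Q. f (P (fst y) (snd y) Q) + f (P (snd y) (fst y) Q) \<partial>K) \<le> (\<integral>\<^sup>+ Q. g Q * ennreal V + ennreal C \<partial>K)"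
        by (intro nn_integral_mono)
      also have "\<dots> = (\<integral>\<^sup>+ Q. g Q \<partial>K) * ennreal V + ennreal C"
        using gm by (simp add: nn_integral_add nn_integral_multc K.emeasure_space_1)
      also have "\<dots> \<le> ennreal (1 - \<delta> / 2) * ennreal V + ennreal C" using g_int by (intro add_mono mult_right_mono) auto
      also have "ennreal V = f (fst y) + f (snd y)" by (simp add: V_def f_def)
      finally show ?case .
    qed
  qed
  also have "\<dots> = ennreal (1 - \<delta> / 2) * ((\<integral>\<^sup>+ x. f x \<partial>L) + (\<integral>\<^sup>+ x. f x \<partial>L)) + ennreal C"
  proof -
    have m1: "(\<lambda>y. f (fst y)) \<in> borel_measurable (L \<Otimes>\<^sub>M L)" "(\<lambda>y. f (snd y)) \<in> borel_measurable (L \<Otimes>\<^sub>M L)" by measurable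
    have "(\<integral>\<^sup>+ y. f (fst y) \<partial>(L \<Otimes>\<^sub>M L)) = (\<integral>\<^sup>+ x. f x \<partial>L)"
      using L.nn_integral_fst[OF m1(1)] by (simp add: L.emeasure_space_1)
    moreover have "(\<integral>\<^sup>+ y. f (snd y) \<partial>(L \<Otimes>\<^sub>M L)) = (\<integral>\<^sup>+ x. f x \<partial>L)"
      using L.nn_integral_fst[OF m1(2)] by (simp add: L.emeasure_space_1)
    ultimately show ?thesis using m1
      by (simp add: nn_integral_add nn_integral_cmult LL.emeasure_space_1)
  qed
  also have "\<dots> \<le> ennreal (1 - \<delta> / 2) * (ennreal B + ennreal B) + ennreal C"
    using B(1) unfolding f_def L_def by (intro add_mono mult_left_mono) auto
  also have "\<dots> = ennreal ((1 - \<delta> / 2) * (B + B) + C)"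
  proof -
    have "0 \<le> C / \<delta>" using C \<delta> by simp
    then have "0 \<le> B" using B by linarith
    then show ?thesis using \<delta> C by (simp add: ennreal_plus[symmetric] ennreal_mult[symmetric] del: ennreal_plus)
  qed
  also have "\<dots> \<le> ennreal (2 * B)"
  proof (rule ennreal_leI)
    have "C \<le> \<delta> * B" using B(2) \<delta> by (simp add: field_simps)
    then show "(1 - \<delta> / 2) * (B + B) + C \<le> 2 * B" by (simp add: algebra_simps)
  qed
  finally have II: "I + I \<le> ennreal (2 * B)" .
  have "0 \<le> C / \<delta>" using C \<delta> by simp
  then have B0: "0 \<le> B" using B by linarith
  have "I \<le> ennreal B"
  proof (cases I rule: ennreal_cases)
    case (real r)
    then have "ennreal (r + r) = I + I" by (simp only: ennreal_plus)
    with II have "ennreal (r + r) \<le> ennreal (2 * B)" by (simp only:)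
    then have "r + r \<le> 2 * B" using B0 by (subst (asm) ennreal_le_iff) auto
    then show ?thesis using real by (simp add: ennreal_leI)
  next
    case top
    then show ?thesis using II by (simp add: top.extremum_unique)
  qed
  then show ?thesis by (simp add: I_def f_def)
qed

end

text \<open>The limit Green function lies in the open half plane, where the weight is continuous, so
  the integrands converge pointwise and Fatou's lemma carries the uniform bound over. Returning from
  \<open>sw\<close> to the weight subtracts 4.\<close>

lemma (in real_prob_space) greenF_moment_le:
  assumes nd: "nondeg m n c lam (zfix m n lam)" and w: "w \<noteq> []" and p: "0 < p"
    and B: "\<And>N. (\<integral>\<^sup>+ x. ennreal (sw (zfix m n lam) x powr (1 + p)) \<partial>law m n lam (zfix m n lam) k N) \<le> ennreal B"
  shows "(\<integral>\<^sup>+ q. ennreal (wgt m n lam (greenF m n k q (w, 0) lam) powr (1 + p)) \<partial>PiM (Tset m n) (\<lambda>_. \<nu>)) \<le> ennreal B"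
proof -
  define z where "z = zfix m n lam"
  define Om where "Om = PiM (Tset m n) (\<lambda>_. \<nu>)"
  note D = nondegD[OF nd, folded z_def]
  have zl: "zlam m n lam = z" using D(2) by (simp add: zlam_def z_def)
  have zb: "cmod z \<le> 1 / Im lam" unfolding z_def by (rule cmod_zfix_le[OF D(2)])
  define X where "X N q = trunc m n lam z k q N w" for N q
  define G where "G q = greenF m n k q (w, 0) lam" for q
  define f where "f x = ennreal (sw z x powr (1 + p))" for x
  have lim: "(\<lambda>N. X N q) \<longlonglongrightarrow> G q" and Gpos: "0 < Im (G q)" for q
    unfolding X_def G_def using trunc_tendsto_greenF[OF w D(2) D(1) zb] by auto
  have Xm: "X N \<in> borel_measurable Om" for N
    unfolding X_def Om_def using below_Tset by (intro borel_measurable_trunc) blast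
  have fm[measurable]: "f \<in> borel_measurable borel" unfolding f_def sw_def by measurable
  have flim: "(\<lambda>N. f (X N q)) \<longlonglongrightarrow> f (G q)" for q
  proof -
    have "(\<lambda>N. sw z (X N q)) \<longlonglongrightarrow> sw z (G q)"
      unfolding sw_def using Gpos[of q] D(1) by (intro tendsto_intros lim) auto
    moreover have "sw z (G q) \<noteq> 0" using sw_ge_4[OF D(1) Gpos[of q]] by simp
    ultimately show ?thesis unfolding f_def by (intro tendsto_ennrealI tendsto_powr tendsto_const)
  qed
  have "(\<integral>\<^sup>+ q. ennreal (wgt m n lam (G q) powr (1 + p)) \<partial>Om) \<le> (\<integral>\<^sup>+ q. f (G q) \<partial>Om)"
  proof (intro nn_integral_mono)
    fix q
    have "wgt m n lam (G q) = sw z (G q) - 4"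
      using sw_eq_dist[OF D(1) Gpos[of q]] by (simp add: wgt_def zl)
    then have "wgt m n lam (G q) powr (1 + p) \<le> sw z (G q) powr (1 + p)"
      using sw_ge_4[OF D(1) Gpos[of q]] p by (intro powr_mono2) auto
    then show "ennreal (wgt m n lam (G q) powr (1 + p)) \<le> f (G q)" by (simp add: f_def ennreal_leI)
  qed
  also have "\<dots> = (\<integral>\<^sup>+ q. liminf (\<lambda>N. f (X N q)) \<partial>Om)"
    using lim_imp_Liminf[OF _ flim] by simp
  also have "\<dots> \<le> liminf (\<lambda>N. \<integral>\<^sup>+ q. f (X N q) \<partial>Om)"
    by (rule nn_integral_liminf) (use Xm fm in \<open>blast intro: measurable_compose\<close>)
  also have "\<dots> \<le> ennreal B"
  proof -
    have "(\<integral>\<^sup>+ q. f (X N q) \<partial>Om) \<le> ennreal B" for N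
    proof -
      have "(\<integral>\<^sup>+ q. f (X N q) \<partial>Om) = (\<integral>\<^sup>+ x. f x \<partial>distr Om borel (X N))"
        by (rule nn_integral_distr[symmetric]) (use Xm fm in auto)
      also have "distr Om borel (X N) = law m n lam z k N"
        unfolding Om_def X_def[abs_def] by (rule distr_trunc)
      finally show ?thesis using B[of N] by (simp add: z_def f_def)
    qed
    then show ?thesis by (intro Liminf_le) (auto intro: always_eventually)
  qed
  finally show ?thesis by (simp add: Om_def G_def)
qed

theorem theorem3:
  fixes m n :: nat and \<nu> :: "real measure" and p0 :: real
  assumes "m \<noteq> n"
    and "prob_space \<nu>" and "sets \<nu> = sets borel"
    and "0 < p0"
    and "(\<integral>\<^sup>+ t. ennreal (\<bar>t\<bar> powr (2 * (1 + p0))) \<partial>\<nu>) < \<infinity>"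
  shows "\<exists>S :: real set. finite S \<and>
    (\<forall>a b. {a..b} \<subseteq> interior (F0 m n) - S \<longrightarrow>
      (\<exists>p1>0. \<forall>p. 0 < p \<and> p < p1 \<longrightarrow>
        (\<exists>eps>0. \<exists>k0>0. \<forall>k::real. 0 < \<bar>k\<bar> \<and> \<bar>k\<bar> < k0 \<longrightarrow>
          (\<forall>x\<in>Tprin m n.
             (SUP lam\<in>Rset {a..b} eps.
                \<integral>\<^sup>+ q. ennreal (wgt m n lam (greenF m n k q x lam) powr (1 + p))
                  \<partial>(PiM (Tset m n) (\<lambda>_. \<nu>))) < \<infinity>))))"
proof -
  interpret real_prob_space \<nu>
    using assms(2,3) by (simp add: real_prob_space_def real_prob_space_axioms_def)
  have main: "\<exists>eps>0. \<exists>k0>0. \<forall>k::real. 0 < \<bar>k\<bar> \<and> \<bar>k\<bar> < k0 \<longrightarrow>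
          (\<forall>x\<in>Tprin m n.
             (SUP lam\<in>Rset {a..b} eps.
                \<integral>\<^sup>+ q. ennreal (wgt m n lam (greenF m n k q x lam) powr (1 + p))
                  \<partial>(PiM (Tset m n) (\<lambda>_. \<nu>))) < \<infinity>)"
    if ab: "{a..b} \<subseteq> interior (F0 m n) - exceptional m n" and p: "0 < p" "p < p0" for a b p
  proof -
    have "{a..b} \<subseteq> F0 m n - exceptional m n" using ab interior_subset by blast
    then obtain c e0 where c: "0 < c" and e0: "0 < e0" and nd: "\<And>lam. lam \<in> Rset {a..b} e0 \<Longrightarrow> nondeg m n c lam (zfix m n lam)"
      using nondeg_uniform[OF assms(1)] by meson
    obtain \<delta> \<kappa> C where \<delta>: "0 < \<delta>" "\<delta> < 1" and \<kappa>: "0 < \<kappa>" and C: "0 \<le> C"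
      and contr: "\<And>lam z. nondeg m n c lam z \<Longrightarrow> Im lam \<le> \<kappa> \<Longrightarrow> swap_contracts m n p \<delta> \<kappa> C lam z"
      using Phi_swap_contraction[OF c p(1), of m n] by meson
    have "0 < \<delta> / 2" using \<delta> by simp
    from large_potential_negligible[OF assms(4,5) p c \<kappa> this, of "m + n + 1"]
    obtain k0 where k0: "0 < k0" and small: "\<And>k. \<bar>k\<bar> < k0 \<Longrightarrow> 
        (\<integral>\<^sup>+ Q. overflow c \<kappa> p (m+n+1) (\<lambda>i. k * Q i)
          \<partial>PiM {..<m+n+1} (\<lambda>_. \<nu>)) \<le> ennreal (\<delta> / 2)" by meson
    \<comment> \<open>The recursion starts at the fixed point itself, where
      \<open>sw z z = 4\<close>; \<open>C / \<delta>\<close> is what \<open>law_moment_step\<close>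
      needs to reproduce B.\<close>
    define B where "B = max (4 powr (1 + p)) (C / \<delta>)"
    \<comment> \<open>\<kappa> enters because the contraction was proved for
      \<open>Im lam \<le> \<kappa>\<close>.\<close>
    define e where "e = min e0 \<kappa>"
    have bound: "(\<integral>\<^sup>+ q. ennreal (wgt m n lam (greenF m n k q x lam) powr (1 + p)) \<partial>(PiM (Tset m n) (\<lambda>_. \<nu>))) \<le> ennreal B"
      if k: "\<bar>k\<bar> < k0" and x: "x \<in> Tprin m n" and lam: "lam \<in> Rset {a..b} e" for k x lam
    proof -
      obtain w where xw: "x = (w, 0)" "w \<noteq> []" using x by (auto simp: Tprin_def)
      have lam': "lam \<in> Rset {a..b} e0" "Im lam \<le> \<kappa>" using lam by (auto simp: Rset_def e_def)
      define z where "z = zfix m n lam"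
      note N = nd[OF lam'(1)]
      note D = nondegD[OF N, folded z_def]
      have "(\<integral>\<^sup>+ y. ennreal (sw z y powr (1 + p)) \<partial>law m n lam z k N) \<le> ennreal B" for N
      proof (induction N)
        case 0
        have "sw z z = 4" using sw_eq_dist[OF D(1) D(1)] by simp
        moreover have "(\<lambda>y. ennreal (sw z y powr (1 + p))) \<in> borel_measurable borel" unfolding sw_def by measurable
        ultimately show ?case by (simp add: nn_integral_return B_def ennreal_leI)
      next
        case (Suc N)
        show ?case
          by (rule law_moment_step[OF nd[OF lam'(1), folded z_def] c p(1) \<delta> C
                contr[OF nd[OF lam'(1), folded z_def] lam'(2)] small[OF k] Suc]) (simp add: B_def)
      qed
      then show ?thesis unfolding xw(1) by (intro greenF_moment_le[OF N xw(2) p(1)]) (simp add: z_def)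
    qed
    have "(SUP lam\<in>Rset {a..b} e. \<integral>\<^sup>+ q. ennreal (wgt m n lam (greenF m n k q x lam) powr (1 + p)) \<partial>(PiM (Tset m n) (\<lambda>_. \<nu>))) < \<infinity>"
      if "\<bar>k\<bar> < k0" "x \<in> Tprin m n" for k x
    proof -
      have "(SUP lam\<in>Rset {a..b} e. \<integral>\<^sup>+ q. ennreal (wgt m n lam (greenF m n k q x lam) powr (1 + p)) \<partial>(PiM (Tset m n) (\<lambda>_. \<nu>))) \<le> ennreal B"
        by (rule SUP_least) (rule bound[OF that])
      also have "\<dots> < \<infinity>" by simp
      finally show ?thesis .
    qed
    moreover have "0 < e" using e0 \<kappa> by (simp add: e_def)
    ultimately show ?thesis using k0 by blast
  qed
  show ?thesis
    by (rule exI[of _ "exceptional m n"], intro conjI finite_exceptional[OF assms(1)] allI impI, rule exI[of _ p0])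
       (use main assms(4) in blast)
qed

end
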